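(* Let $(R,\mathfrak m)$ be a regular local ring with quotient field $F$ and $\dim R\ge 2$, let $\{(R_i,\mathfrak m_i)\}_{i\ge 0}$ be an infinite sequence of local quadratic transforms with $R_0=R$, let $S=\bigcup_{i\ge0}R_i$ with maximal ideal $N=\bigcup_i\mathfrak m_i$, let $x\in S$ be such that $xS$ is $N$-primary, let $T$ be the Noetherian hull of $S$ and assume $T$ is a localization of $R$. Let $S^*$ be the complete integral closure of $S$, let $V$ be the boundary valuation ring of $S$, and let $W$ be the rank one valuation overring of $V$. Assume $S$ is archimedean and not a DVR. Then $NV$ is the height $1$ prime ideal of $V$, hence $W=V_{NV}$. Furthermore: (1) $S^*=(N:_F N)=W\cap T$; and (2) $W$ is the unique rank $1$ valuation overring of $S$ such that $S^*=W\cap T$.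
   Context: A local quadratic transform of a regular local ring $(A,\mathfrak n)$ is a local ring $A[\mathfrak n/y]_{\mathfrak q}$ with $y\in\mathfrak n\setminus\mathfrak n^2$ and $\mathfrak q$ a prime ideal of $A[\mathfrak n/y]$ containing $\mathfrak n$. The sequence satisfies: for each $i\ge 0$, $R_{i+1}$ is a local quadratic transform of $R_i$, $R_i\subsetneq R_{i+1}$, and each $R_i$ is a regular local ring of dimension at least $2$ with maximal ideal $\mathfrak m_i$. $\mathrm{ord}_i$ is the order valuation of $R_i$ ($\mathrm{ord}_i(a)=\max\{n:a\in\mathfrak m_i^n\}$ for $0\ne a\in R_i$, extended to $F$ by $\mathrm{ord}_i(a/b)=\mathrm{ord}_i(a)-\mathrm{ord}_i(b)$), with valuation ring $V_i$. The boundary valuation ring of $S$ is the unique valuation ring $V$ with $R\subseteq V\subseteq F$ that is a limit point of $\{V_i\}$ in the patch topology (basic open sets $\{U: G\subseteq U, H\subseteq\mathfrak M_U\}$, $G,H\subseteq F$ finite); equivalently $V=\{q\in F:\mathrm{ord}_i(q)\ge 0\text{ for } i\gg0\}$. The rank one valuation overring $W$ of $V$ is the localization of $V$ at its height one prime ideal. The Noetherian hull $T$ of $S$ is the intersection of all DVRs with quotient field $F$ properly containing $S$ (empty intersection $=F$). A domain $A$ is archimedean if $\bigcap_{n>0}a^nA=0$ for every nonunit $a\in A$. The complete integral closure of $S$ is the ring of elements $\theta\in F$ that are almost integral over $S$, i.e. such that $S[\theta]$ is a fractional ideal of $S$. $(N:_FN)=\{q\in F: qN\subseteq N\}$. An ideal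 is $N$-primary if its radical is $N$. *)

theory Defs
  imports Main "HOL-Library.Extended_Nat"
begin

text \<open>Convention: all rings are subrings of a fixed field, the type 'a, which plays
the role of the quotient field F.\<close>

definition subring :: "'a::field set \<Rightarrow> bool" where
  "subring A \<longleftrightarrow> 0 \<in> A \<and> 1 \<in> A \<and> (\<forall>a\<in>A. \<forall>b\<in>A. a + b \<in> A \<and> a * b \<in> A) \<and> (\<forall>a\<in>A. - a \<in> A)"

definition has_quotient_field :: "'a::field set \<Rightarrow> bool" where
  "has_quotient_field A \<longleftrightarrow> subring A \<and> (\<forall>q. \<exists>a\<in>A. \<exists>b\<in>A. b \<noteq> 0 \<and> q = a / b)"

definition gen_subring :: "'a::field set \<Rightarrow> 'a set" where
  "gen_subring X = \<Inter>{A. subring A \<and> X \<subseteq> A}"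

definition ideal :: "'a::field set \<Rightarrow> 'a set \<Rightarrow> bool" where
  "ideal A I \<longleftrightarrow> I \<subseteq> A \<and> 0 \<in> I \<and> (\<forall>a\<in>I. \<forall>b\<in>I. a + b \<in> I) \<and> (\<forall>r\<in>A. \<forall>a\<in>I. r * a \<in> I)"

definition gen_ideal :: "'a::field set \<Rightarrow> 'a set \<Rightarrow> 'a set" where
  "gen_ideal A X = \<Inter>{I. ideal A I \<and> X \<subseteq> I}"

definition principal :: "'a::field set \<Rightarrow> 'a \<Rightarrow> 'a set" where
  "principal A x = {x * s | s. s \<in> A}"

definition prime_ideal :: "'a::field set \<Rightarrow> 'a set \<Rightarrow> bool" where
  "prime_ideal A P \<longleftrightarrow> ideal A P \<and> P \<noteq> A \<and> (\<forall>a\<in>A. \<forall>b\<in>A. a * b \<in> P \<longrightarrow> a \<in> P \<or> b \<in> P)"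

definition radical :: "'a::field set \<Rightarrow> 'a set \<Rightarrow> 'a set" where
  "radical A I = {a \<in> A. \<exists>n. a ^ n \<in> I}"

fun ideal_pow :: "'a::field set \<Rightarrow> 'a set \<Rightarrow> nat \<Rightarrow> 'a set" where
  "ideal_pow A I 0 = A"
| "ideal_pow A I (Suc n) = gen_ideal A {a * b | a b. a \<in> ideal_pow A I n \<and> b \<in> I}"

definition units_of_ring :: "'a::field set \<Rightarrow> 'a set" where
  "units_of_ring A = {a \<in> A. a \<noteq> 0 \<and> inverse a \<in> A}"

definition max_ideal :: "'a::field set \<Rightarrow> 'a set" where
  "max_ideal A = A - units_of_ring A"

definition local_ring :: "'a::field set \<Rightarrow> bool" where
  "local_ring A \<longleftrightarrow> subring A \<and> ideal A (max_ideal A)"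

definition noetherian :: "'a::field set \<Rightarrow> bool" where
  "noetherian A \<longleftrightarrow> subring A \<and>
     (\<forall>I. ideal A I \<longrightarrow> (\<exists>X. finite X \<and> X \<subseteq> A \<and> I = gen_ideal A X))"

definition prime_chain :: "'a::field set \<Rightarrow> (nat \<Rightarrow> 'a set) \<Rightarrow> nat \<Rightarrow> bool" where
  "prime_chain A c n \<longleftrightarrow> (\<forall>i\<le>n. prime_ideal A (c i)) \<and> (\<forall>i<n. c i \<subset> c (Suc i))"

definition krull_dim :: "'a::field set \<Rightarrow> enat" where
  "krull_dim A = Sup {enat n | n. \<exists>c. prime_chain A c n}"

definition height :: "'a::field set \<Rightarrow> 'a set \<Rightarrow> enat" where
  "height A P = Sup {enat n | n. \<exists>c. prime_chain A c n \<and> c n = P}"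

definition regular_local :: "'a::field set \<Rightarrow> bool" where
  "regular_local A \<longleftrightarrow> local_ring A \<and> noetherian A \<and> krull_dim A \<noteq> \<infinity> \<and>
     (\<exists>X. finite X \<and> X \<subseteq> A \<and> enat (card X) = krull_dim A \<and> gen_ideal A X = max_ideal A)"

definition localization_at :: "'a::field set \<Rightarrow> 'a set \<Rightarrow> 'a set" where
  "localization_at A P = {a / b | a b. a \<in> A \<and> b \<in> A - P}"

definition is_localization :: "'a::field set \<Rightarrow> 'a set \<Rightarrow> bool" where
  "is_localization A B \<longleftrightarrow> (\<exists>M. M \<subseteq> A - {0} \<and> 1 \<in> M \<and> (\<forall>s\<in>M. \<forall>t\<in>M. s * t \<in> M) \<and>
      B = {a / s | a s. a \<in> A \<and> s \<in> M})"

definition local_quadratic_transform :: "'a::field set \<Rightarrow> 'a set \<Rightarrow> bool" where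
  "local_quadratic_transform A B \<longleftrightarrow>
    (\<exists>y q. y \<in> max_ideal A - ideal_pow A (max_ideal A) 2 \<and>
       prime_ideal (gen_subring (A \<union> {a / y | a. a \<in> max_ideal A})) q \<and>
       max_ideal A \<subseteq> q \<and>
       B = localization_at (gen_subring (A \<union> {a / y | a. a \<in> max_ideal A})) q)"

definition quadratic_sequence :: "(nat \<Rightarrow> 'a::field set) \<Rightarrow> bool" where
  "quadratic_sequence Rs \<longleftrightarrow> (\<forall>i. local_quadratic_transform (Rs i) (Rs (Suc i)) \<and>
      Rs i \<subset> Rs (Suc i) \<and> regular_local (Rs i) \<and> krull_dim (Rs i) \<ge> 2)"

definition seq_union :: "(nat \<Rightarrow> 'a::field set) \<Rightarrow> 'a set" where
  "seq_union Rs = (\<Union>i. Rs i)"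

definition seq_max :: "(nat \<Rightarrow> 'a::field set) \<Rightarrow> 'a set" where
  "seq_max Rs = (\<Union>i. max_ideal (Rs i))"

definition ord :: "'a::field set \<Rightarrow> 'a \<Rightarrow> nat" where
  "ord A a = (GREATEST n. a \<in> ideal_pow A (max_ideal A) n)"

definition ordF :: "'a::field set \<Rightarrow> 'a \<Rightarrow> int" where
  "ordF A q = (let (a, b) = (SOME (a, b). a \<in> A \<and> b \<in> A \<and> b \<noteq> 0 \<and> a \<noteq> 0 \<and> q = a / b)
               in int (ord A a) - int (ord A b))"

text \<open>Boundary valuation ring: q such that ord_i(q) \<ge> 0 for i \<gg> 0 (ord_i(0) = \<infinity>).\<close>
definition boundary_val :: "(nat \<Rightarrow> 'a::field set) \<Rightarrow> 'a set" where
  "boundary_val Rs = {q. q = 0 \<or> (\<forall>\<^sub>F i in sequentially. ordF (Rs i) q \<ge> 0)}"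

definition valuation_ring :: "'a::field set \<Rightarrow> bool" where
  "valuation_ring A \<longleftrightarrow> subring A \<and> (\<forall>q. q \<noteq> 0 \<longrightarrow> q \<in> A \<or> inverse q \<in> A)"

definition DVR :: "'a::field set \<Rightarrow> bool" where
  "DVR A \<longleftrightarrow> valuation_ring A \<and> noetherian A \<and> max_ideal A \<noteq> {0}"

definition noetherian_hull :: "'a::field set \<Rightarrow> 'a set" where
  "noetherian_hull S = \<Inter>{D. DVR D \<and> S \<subset> D}"

definition archimedean :: "'a::field set \<Rightarrow> bool" where
  "archimedean A \<longleftrightarrow> (\<forall>a \<in> A - units_of_ring A. (\<Inter>n. principal A (a ^ n)) = {0})"

definition fractional_ideal :: "'a::field set \<Rightarrow> 'a set \<Rightarrow> bool" where
  "fractional_ideal A M \<longleftrightarrow> (\<forall>a\<in>A. \<forall>m\<in>M. a * m \<in> M) \<and> (\<forall>m\<in>M. \<forall>n\<in>M. m + n \<in> M) \<and> 0 \<in> M \<and>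
     (\<exists>d\<in>A. d \<noteq> 0 \<and> (\<forall>m\<in>M. d * m \<in> A))"

definition complete_integral_closure :: "'a::field set \<Rightarrow> 'a set" where
  "complete_integral_closure A = {\<theta>. fractional_ideal A (gen_subring (A \<union> {\<theta>}))}"

definition colon :: "'a::field set \<Rightarrow> 'a set" where
  "colon N = {q. \<forall>n\<in>N. q * n \<in> N}"

definition rank_one_val_overring :: "'a::field set \<Rightarrow> 'a set \<Rightarrow> bool" where
  "rank_one_val_overring S U \<longleftrightarrow> valuation_ring U \<and> S \<subseteq> U \<and> krull_dim U = 1"

end

theory Submission
  imports Defs "HOL-Computational_Algebra.Polynomial"
begin

text \<open>
  Krull's principal ideal theorem gives the order of a regular local ring \<open>A\<close> as a valuation: if
  \<open>\<mm>\<close> is generated by \<open>dim A\<close> elements, every subset of them generates a prime ideal, hence the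
  associated graded ring is a domain and \<open>A\<close> is completely integrally closed. Under a local quadratic
  transform \<open>A[\<mm>/y]\<^sub>q\<close> the order of the transform \<open>f/y\<^sup>r\<close> of an element \<open>f\<close> of order \<open>r\<close> is at most
  \<open>r\<close>: modulo \<open>y\<close> it is a nonzero polynomial of degree at most \<open>r\<close> in the fractions \<open>z/y\<close>, and the
  Hasse derivatives of order \<open>i\<close> lower the \<open>q\<close>-order by at most \<open>i\<close>.

  Since these orders cannot drop forever, the sign of \<open>ord\<^sub>i(u)\<close> is eventually constant for every
  \<open>u \<noteq> 0\<close>, so \<open>V\<close> is a valuation ring. If \<open>1/s \<in> T\<close>, the successive transforms of \<open>s\<close> become units;
  otherwise they have a common height one prime, whose local ring is a discrete valuation ring
  containing \<open>S\<close> in which \<open>s\<close> is not a unit. This yields \<open>S = V \<inter> T\<close>, and then \<open>a/x\<^sup>k \<in> V\<close> for all \<open>k\<close>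
  forces \<open>a = 0\<close> when \<open>S\<close> is archimedean, so that \<open>NV\<close> is contained in every nonzero prime of \<open>V\<close>. As
  \<open>S\<close> is not discrete, every element of \<open>N\<close> is divisible in \<open>V\<close> by the square of another one, which
  makes \<open>NV\<close> prime. The rest is the arithmetic of rank one valuation rings.
\<close>

section \<open>Ideals of a subring of a field\<close>

text \<open>A quotient A/J is not a subring of the fixed field, so every argument that passes to a
  quotient carries an ideal \<open>J\<close> along and is phrased modulo \<open>J\<close>;
  inductions on the number of parameters enlarge \<open>J\<close> instead of changing the ring. The
  order estimate is the main obstacle: without it nothing would keep the sign of ord_i(u) from
  oscillating. Ordinary derivatives lose information in positive characteristic, hence the Hasse
  derivatives. The hypotheses enter at separate places. That T is a localization of R gives every
  element of T a denominator s in R with 1/s in T, so that following the transforms of this one s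
  decides membership in S. That xS is N-primary puts 1/x into T, because a discrete valuation ring
  properly containing S cannot have N inside its maximal ideal. Hence elements of S can be divided
  by powers of x without leaving T. This is used twice: to connect V with the archimedean property
  of S, and to recover W from its intersection with T.\<close>

definition ideal_sum :: "'a::field set \<Rightarrow> 'a set \<Rightarrow> 'a set" where
  "ideal_sum I J = {a + b | a b. a \<in> I \<and> b \<in> J}"

definition ideal_prod :: "'a::field set \<Rightarrow> 'a set \<Rightarrow> 'a set \<Rightarrow> 'a set" where
  "ideal_prod A I J = gen_ideal A {a * b | a b. a \<in> I \<and> b \<in> J}"

lemma ideal_pow_Suc: "ideal_pow A I (Suc n) = ideal_prod A (ideal_pow A I n) I"
  by (simp add: ideal_prod_def)

declare ideal_pow.simps(2) [simp del]

lemma ideal_sumI: "a \<in> I \<Longrightarrow> b \<in> J \<Longrightarrow> a + b \<in> ideal_sum I J"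
  unfolding ideal_sum_def by blast

lemma ideal_sumE:
  assumes "c \<in> ideal_sum I J"
  obtains a b where "a \<in> I" "b \<in> J" "c = a + b"
  using assms unfolding ideal_sum_def by blast

lemma ideal_sum_mono: "I \<subseteq> I' \<Longrightarrow> J \<subseteq> J' \<Longrightarrow> ideal_sum I J \<subseteq> ideal_sum I' J'"
  unfolding ideal_sum_def by blast

lemma ideal_subset: "ideal A I \<Longrightarrow> I \<subseteq> A"
  by (simp add: ideal_def)

lemma idealI:
  assumes "\<And>a. a \<in> I \<Longrightarrow> a \<in> A" "0 \<in> I" "\<And>a b. a \<in> I \<Longrightarrow> b \<in> I \<Longrightarrow> a + b \<in> I"
    "\<And>r a. r \<in> A \<Longrightarrow> a \<in> I \<Longrightarrow> r * a \<in> I"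
  shows "ideal A I"
  using assms by (auto simp: ideal_def)

locale field_subring =
  fixes A :: "'a::field set"
  assumes subring: "subring A"
begin

lemma zero_closed [simp]: "0 \<in> A"
  and one_closed [simp]: "1 \<in> A"
  and add_closed [simp]: "a \<in> A \<Longrightarrow> b \<in> A \<Longrightarrow> a + b \<in> A"
  and mult_closed [simp]: "a \<in> A \<Longrightarrow> b \<in> A \<Longrightarrow> a * b \<in> A"
  and minus_closed [simp]: "a \<in> A \<Longrightarrow> - a \<in> A"
  using subring by (auto simp: subring_def)

lemma diff_closed [simp]: "a \<in> A \<Longrightarrow> b \<in> A \<Longrightarrow> a - b \<in> A"
  using add_closed[of a "- b"] by simp

lemma power_closed [simp]: "a \<in> A \<Longrightarrow> a ^ n \<in> A"
  by (induction n) auto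

lemma sum_closed [simp]: "(\<And>i. i \<in> I \<Longrightarrow> f i \<in> A) \<Longrightarrow> sum f I \<in> A"
  by (induction I rule: infinite_finite_induct) auto

lemma ideal_zero [simp]: "ideal A I \<Longrightarrow> 0 \<in> I"
  and ideal_add [simp]: "ideal A I \<Longrightarrow> a \<in> I \<Longrightarrow> b \<in> I \<Longrightarrow> a + b \<in> I"
  and ideal_mult [simp]: "ideal A I \<Longrightarrow> r \<in> A \<Longrightarrow> a \<in> I \<Longrightarrow> r * a \<in> I"
  and ideal_mult_right [simp]: "ideal A I \<Longrightarrow> r \<in> A \<Longrightarrow> a \<in> I \<Longrightarrow> a * r \<in> I"
  and ideal_closed: "ideal A I \<Longrightarrow> a \<in> I \<Longrightarrow> a \<in> A"
  by (auto simp: ideal_def mult.commute)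

lemma ideal_minus [simp]: "ideal A I \<Longrightarrow> a \<in> I \<Longrightarrow> - a \<in> I"
  using ideal_mult[of I "-1" a] by simp

lemma ideal_diff [simp]: "ideal A I \<Longrightarrow> a \<in> I \<Longrightarrow> b \<in> I \<Longrightarrow> a - b \<in> I"
  using ideal_add[of I a "- b"] by simp

lemma ideal_add_cancel: "ideal A I \<Longrightarrow> a \<in> I \<Longrightarrow> a + b \<in> I \<longleftrightarrow> b \<in> I"
  by (metis add_diff_cancel_left' ideal_add ideal_diff)

lemma ideal_sum_closed [simp]: "ideal A I \<Longrightarrow> (\<And>i. i \<in> X \<Longrightarrow> f i \<in> I) \<Longrightarrow> sum f X \<in> I"
  by (induction X rule: infinite_finite_induct) auto

lemma ideal_self [simp]: "ideal A A"
  by (rule idealI) auto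

lemma ideal_0 [simp]: "ideal A {0}"
  by (rule idealI) auto

lemma ideal_eq_self: "ideal A I \<Longrightarrow> 1 \<in> I \<Longrightarrow> I = A"
  using ideal_mult[of I _ 1] ideal_closed[of I] by auto

lemma ideal_Int [simp]: "ideal A I \<Longrightarrow> ideal A J \<Longrightarrow> ideal A (I \<inter> J)"
  by (rule idealI) (auto simp: ideal_closed[of I])

lemma ideal_colon: "ideal A I \<Longrightarrow> b \<in> A \<Longrightarrow> ideal A {a \<in> A. a * b \<in> I}"
  by (rule idealI) (auto simp: distrib_right mult.assoc)

lemma ideal_gen [simp]: "X \<subseteq> A \<Longrightarrow> ideal A (gen_ideal A X)"
  unfolding gen_ideal_def by (rule idealI) auto

lemma gen_subset: "X \<subseteq> gen_ideal A X"
  unfolding gen_ideal_def by blast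

lemma gen_incl: "x \<in> X \<Longrightarrow> x \<in> gen_ideal A X"
  using gen_subset by blast

lemma gen_least: "ideal A I \<Longrightarrow> X \<subseteq> I \<Longrightarrow> gen_ideal A X \<subseteq> I"
  unfolding gen_ideal_def by blast

lemma gen_mono: "X \<subseteq> Y \<Longrightarrow> gen_ideal A X \<subseteq> gen_ideal A Y"
  unfolding gen_ideal_def by blast

lemma gen_closed: "X \<subseteq> A \<Longrightarrow> gen_ideal A X \<subseteq> A"
  using ideal_gen ideal_subset by blast

lemma gen_ideal_ideal [simp]: "ideal A I \<Longrightarrow> gen_ideal A I = I"
  by (meson gen_least gen_subset order_refl subset_antisym)

lemma gen_empty [simp]: "gen_ideal A {} = {0}"
  using gen_least[of "{0}" "{}"] ideal_zero[of "gen_ideal A {}"] by fastforce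

lemma ideal_ideal_sum [simp]:
  assumes "ideal A I" "ideal A J" shows "ideal A (ideal_sum I J)"
proof -
  have "0 \<in> ideal_sum I J" using ideal_sumI[of 0 I 0 J] assms by simp
  moreover have "a + b \<in> ideal_sum I J" if ab: "a \<in> ideal_sum I J" "b \<in> ideal_sum I J" for a b
  proof -
    obtain a1 a2 b1 b2 where "a1 \<in> I" "b1 \<in> I" "a2 \<in> J" "b2 \<in> J" "a = a1 + a2" "b = b1 + b2"
      using ab by (meson ideal_sumE)
    then show ?thesis using ideal_sumI[of "a1 + b1" I "a2 + b2" J] assms by (simp add: algebra_simps)
  qed
  moreover have "r * a \<in> ideal_sum I J" if ab: "r \<in> A" "a \<in> ideal_sum I J" for r a
  proof -
    obtain a1 a2 where "a1 \<in> I" "a2 \<in> J" "a = a1 + a2"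
      using ab by (meson ideal_sumE)
    then show ?thesis using ideal_sumI[of "r * a1" I "r * a2" J] assms ab by (simp add: algebra_simps)
  qed
  ultimately show ?thesis
    using assms by (intro idealI) (auto elim!: ideal_sumE simp: ideal_closed[of I] ideal_closed[of J])
qed

lemma ideal_sum_upper:
  assumes "ideal A I" "ideal A J" shows "I \<subseteq> ideal_sum I J" "J \<subseteq> ideal_sum I J"
  using ideal_sumI[of _ I 0 J] ideal_sumI[of 0 I _ J] assms by auto

lemma ideal_sum_least:
  assumes "ideal A K" "I \<subseteq> K" "J \<subseteq> K" shows "ideal_sum I J \<subseteq> K"
  using assms by (auto simp: ideal_sum_def subset_iff)

lemma gen_Un:
  assumes "X \<subseteq> A" "Y \<subseteq> A"
  shows "gen_ideal A (X \<union> Y) = ideal_sum (gen_ideal A X) (gen_ideal A Y)"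
proof
  have i: "ideal A (gen_ideal A X)" "ideal A (gen_ideal A Y)" "ideal A (gen_ideal A (X \<union> Y))"
    using assms by simp_all
  show "gen_ideal A (X \<union> Y) \<subseteq> ideal_sum (gen_ideal A X) (gen_ideal A Y)"
    using ideal_sum_upper[OF i(1,2)] gen_subset[of X] gen_subset[of Y] i
    by (intro gen_least) auto
  show "ideal_sum (gen_ideal A X) (gen_ideal A Y) \<subseteq> gen_ideal A (X \<union> Y)"
    using i by (intro ideal_sum_least gen_mono) auto
qed

lemma gen_Un_gen:
  assumes "X \<subseteq> A" "Y \<subseteq> A"
  shows "gen_ideal A (gen_ideal A X \<union> Y) = gen_ideal A (X \<union> Y)"
  using assms gen_closed[of X] by (simp add: gen_Un)

lemma ideal_scale:
  assumes I: "ideal A I" and y: "y \<in> A" shows "ideal A ((*) y ` I)"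
proof (rule idealI)
  show "a \<in> A" if "a \<in> (*) y ` I" for a using that y ideal_closed[OF I] by auto
  show "0 \<in> (*) y ` I" using image_eqI[of 0 "(*) y" 0 I] I by simp
  show "a + b \<in> (*) y ` I" if "a \<in> (*) y ` I" "b \<in> (*) y ` I" for a b
    using that I by (auto simp flip: distrib_left)
  show "r * a \<in> (*) y ` I" if "r \<in> A" "a \<in> (*) y ` I" for r a
    using that I by (auto simp: mult.left_commute[of r])
qed

lemma principal_image: "principal A y = (*) y ` A"
  by (auto simp: principal_def)

lemma principal_closed [simp]: "y \<in> A \<Longrightarrow> ideal A (principal A y)"
  unfolding principal_image by (rule ideal_scale) auto

lemma principalI: "s \<in> A \<Longrightarrow> y * s \<in> principal A y"
  by (auto simp: principal_def)

lemma gen_singleton [simp]: "y \<in> A \<Longrightarrow> gen_ideal A {y} = principal A y"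
proof
  assume y: "y \<in> A"
  show "gen_ideal A {y} \<subseteq> principal A y"
    using y principalI[of 1 y] by (intro gen_least) auto
  show "principal A y \<subseteq> gen_ideal A {y}"
    using y ideal_mult_right[of "gen_ideal A {y}" _ y] gen_incl[of y "{y}"] by (auto simp: principal_def)
qed

lemma gen_insert:
  assumes "y \<in> A" "X \<subseteq> A"
  shows "gen_ideal A (insert y X) = ideal_sum (principal A y) (gen_ideal A X)"
  using gen_Un[of "{y}" X] assms by simp

lemma gen_insertE:
  assumes "c \<in> gen_ideal A (insert y X)" "y \<in> A" "X \<subseteq> A"
  obtains s b where "s \<in> A" "b \<in> gen_ideal A X" "c = y * s + b"
proof -
  have "c \<in> ideal_sum (principal A y) (gen_ideal A X)" using assms by (simp add: gen_insert)
  then show ?thesis using that by (elim ideal_sumE) (auto simp: principal_def)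
qed

lemma gen_insertE_ideal:
  assumes "c \<in> gen_ideal A (insert y I)" "y \<in> A" "ideal A I"
  obtains s b where "s \<in> A" "b \<in> I" "c = y * s + b"
  using gen_insertE[OF assms(1,2) ideal_subset[OF assms(3)]] that assms(3) by auto

section \<open>Products and powers of ideals\<close>

lemma ideal_ideal_prod [simp]: "ideal A I \<Longrightarrow> ideal A J \<Longrightarrow> ideal A (ideal_prod A I J)"
  unfolding ideal_prod_def by (intro ideal_gen) (auto simp: ideal_closed[of I] ideal_closed[of J])

lemma ideal_prodI: "a \<in> I \<Longrightarrow> b \<in> J \<Longrightarrow> a * b \<in> ideal_prod A I J"
  unfolding ideal_prod_def by (intro gen_incl) auto

lemma ideal_prod_least:
  assumes "ideal A K" "\<And>a b. a \<in> I \<Longrightarrow> b \<in> J \<Longrightarrow> a * b \<in> K" shows "ideal_prod A I J \<subseteq> K"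
  unfolding ideal_prod_def using assms by (intro gen_least) auto

lemma ideal_prod_mono: "I \<subseteq> I' \<Longrightarrow> J \<subseteq> J' \<Longrightarrow> ideal_prod A I J \<subseteq> ideal_prod A I' J'"
  unfolding ideal_prod_def by (intro gen_mono) auto

lemma ideal_prod_subset: "ideal A I \<Longrightarrow> ideal A J \<Longrightarrow> ideal_prod A I J \<subseteq> I"
  by (rule ideal_prod_least) (auto simp: ideal_closed[of J])

lemma ideal_pow_ideal [simp]: "ideal A I \<Longrightarrow> ideal A (ideal_pow A I n)"
  by (induction n) (auto simp: ideal_pow_Suc)

lemma ideal_pow_Suc_subset: "ideal A I \<Longrightarrow> ideal_pow A I (Suc n) \<subseteq> ideal_pow A I n"
  by (simp add: ideal_pow_Suc ideal_prod_subset)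

lemma ideal_pow_antimono: "ideal A I \<Longrightarrow> m \<le> n \<Longrightarrow> ideal_pow A I n \<subseteq> ideal_pow A I m"
  using lift_Suc_antimono_le[of "ideal_pow A I" m n] ideal_pow_Suc_subset by blast

lemma ideal_pow_1 [simp]: "ideal A I \<Longrightarrow> ideal_pow A I (Suc 0) = I"
proof
  assume I: "ideal A I"
  show "ideal_pow A I (Suc 0) \<subseteq> I" unfolding ideal_pow_Suc using I by (intro ideal_prod_least) auto
  show "I \<subseteq> ideal_pow A I (Suc 0)"
    using I ideal_prodI[of 1 A _ I] by (auto simp: ideal_pow_Suc)
qed

lemma ideal_pow_mono: "I \<subseteq> J \<Longrightarrow> ideal_pow A I n \<subseteq> ideal_pow A J n"
  by (induction n) (auto simp: ideal_pow_Suc dest: ideal_prod_mono)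

lemma ideal_pow_mult:
  assumes I: "ideal A I" and a: "a \<in> ideal_pow A I m" and b: "b \<in> ideal_pow A I n"
  shows "a * b \<in> ideal_pow A I (m + n)"
  using b
proof (induction n arbitrary: b)
  case 0 then show ?case using a I by simp
next
  case (Suc n)
  let ?K = "{b \<in> A. b * a \<in> ideal_pow A I (m + Suc n)}"
  have aA: "a \<in> A" using a I ideal_closed ideal_pow_ideal by blast
  have "ideal_pow A I (Suc n) \<subseteq> ?K" unfolding ideal_pow_Suc
  proof (rule ideal_prod_least)
    show "ideal A ?K" using I aA by (simp add: ideal_colon)
    fix c d assume c: "c \<in> ideal_pow A I n" and d: "d \<in> I"
    have "a * c * d \<in> ideal_pow A I (Suc (m + n))"
      unfolding ideal_pow_Suc by (rule ideal_prodI[OF Suc.IH[OF c] d])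
    moreover have "c \<in> A" "d \<in> A" using c d I ideal_closed ideal_pow_ideal by blast+
    ultimately show "c * d \<in> ?K" by (simp add: mult_ac)
  qed
  then show ?case using Suc.prems by (auto simp: mult_ac)
qed

lemma ideal_pow_power: "ideal A I \<Longrightarrow> a \<in> I \<Longrightarrow> a ^ n \<in> ideal_pow A I n"
  by (induction n) (auto simp: ideal_pow_Suc mult.commute[of a] intro: ideal_prodI)

lemma ideal_pow_principal:
  assumes "y \<in> A" shows "ideal_pow A (principal A y) n = principal A (y ^ n)"
proof
  show "ideal_pow A (principal A y) n \<subseteq> principal A (y ^ n)"
  proof (induction n)
    case 0 then show ?case by (auto simp: principal_def)
  next
    case (Suc n)
    show ?case unfolding ideal_pow_Suc
    proof (rule ideal_prod_least)
      show "ideal A (principal A (y ^ Suc n))" using assms by (intro principal_closed) simp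
      fix a b assume "a \<in> ideal_pow A (principal A y) n" "b \<in> principal A y"
      then obtain s t where "s \<in> A" "t \<in> A" "a = y ^ n * s" "b = y * t"
        using Suc by (auto simp: principal_def)
      then show "a * b \<in> principal A (y ^ Suc n)"
        using principalI[of "s * t" "y ^ Suc n"] by (simp add: mult_ac)
    qed
  qed
  have "y ^ n \<in> ideal_pow A (principal A y) n"
    using assms principalI[of 1 y] by (intro ideal_pow_power) auto
  then show "principal A (y ^ n) \<subseteq> ideal_pow A (principal A y) n"
    unfolding principal_image[of "y ^ n"] using assms by auto
qed

text \<open>Binomial expansion of the powers of I + gA with the degree in \<open>g\<close> kept
  visible. It serves twice: for the exponent count in \<open>ideal_pow_insert_subset\<close>, and in
  \<open>degree_bound\<close> to control the degree in a single fraction z/y.\<close>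

lemma ideal_pow_insert_poly:
  assumes I: "ideal A I" and g: "g \<in> A" and a: "a \<in> ideal_pow A (gen_ideal A (insert g I)) n"
  obtains p where "a = poly p g" "\<And>i. i \<le> n \<Longrightarrow> coeff p i \<in> ideal_pow A I (n - i)"
    "\<And>i. i > n \<Longrightarrow> coeff p i = 0"
proof -
  define K where "K n = {poly p g | p. (\<forall>i\<le>n. coeff p i \<in> ideal_pow A I (n - i)) \<and> (\<forall>i>n. coeff p i = 0)}" for n
  have pA: "poly p g \<in> A" if "\<forall>i\<le>n. coeff p i \<in> ideal_pow A I (n - i)" "\<forall>i>n. coeff p i = 0" for p n
  proof -
    have "coeff p i \<in> A" for i
      using that I ideal_closed[OF ideal_pow_ideal[OF I]] by (cases "i \<le> n") auto
    then show ?thesis using g by (auto simp: poly_altdef)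
  qed
  have K: "ideal A (K n)" for n
  proof -
    have "poly p g + poly q g \<in> K n"
      if "\<forall>i\<le>n. coeff p i \<in> ideal_pow A I (n - i)" "\<forall>i>n. coeff p i = 0"
         "\<forall>i\<le>n. coeff q i \<in> ideal_pow A I (n - i)" "\<forall>i>n. coeff q i = 0" for p q
      unfolding K_def using that I by (intro CollectI exI[of _ "p + q"]) auto
    moreover have "r * poly p g \<in> K n"
      if "\<forall>i\<le>n. coeff p i \<in> ideal_pow A I (n - i)" "\<forall>i>n. coeff p i = 0" "r \<in> A" for p r
      unfolding K_def using that I by (intro CollectI exI[of _ "smult r p"]) auto
    moreover have "0 \<in> K n" unfolding K_def using I by (intro CollectI exI[of _ 0]) auto
    ultimately show ?thesis using pA by (intro idealI) (auto simp: K_def)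
  qed
  have "ideal_pow A (gen_ideal A (insert g I)) n \<subseteq> K n"
  proof (induction n)
    case 0
    have "a \<in> K 0" if "a \<in> A" for a
      unfolding K_def using that by (intro CollectI exI[of _ "[:a:]"]) (auto simp: coeff_pCons split: nat.splits)
    then show ?case by auto
  next
    case (Suc n)
    show ?case unfolding ideal_pow_Suc
    proof (rule ideal_prod_least[OF K])
      fix a b assume "a \<in> ideal_pow A (gen_ideal A (insert g I)) n" and b: "b \<in> gen_ideal A (insert g I)"
      then obtain p where p: "a = poly p g" "\<forall>i\<le>n. coeff p i \<in> ideal_pow A I (n - i)" "\<forall>i>n. coeff p i = 0"
        using Suc unfolding K_def by blast
      obtain s h where sh: "s \<in> A" "h \<in> I" "b = g * s + h" using gen_insertE_ideal[OF b g I] by metis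
      have eq: "a * b = poly ([:h, s:] * p) g" using p sh by (simp add: algebra_simps)
      have "coeff ([:h, s:] * p) i \<in> ideal_pow A I (Suc n - i)" if "i \<le> Suc n" for i
      proof -
        have 1: "h * coeff p i \<in> ideal_pow A I (Suc n - i)"
        proof (cases "i \<le> n")
          case True
          then have "coeff p i * h \<in> ideal_pow A I (Suc (n - i))"
            using p sh unfolding ideal_pow_Suc by (intro ideal_prodI) auto
          then show ?thesis using True by (simp add: Suc_diff_le mult.commute)
        next
          case False then show ?thesis using p I by simp
        qed
        have 2: "s * coeff p (i - 1) \<in> ideal_pow A I (Suc n - i)" if "i > 0"
          using p(2)[rule_format, of "i - 1"] \<open>i \<le> Suc n\<close> that sh I by (cases i) auto
        show ?thesis using 1 2 I by (cases i) (auto simp: coeff_pCons)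
      qed
      moreover have "coeff ([:h, s:] * p) i = 0" if "i > Suc n" for i
        using p(3) that by (cases i) (auto simp: coeff_pCons)
      ultimately show "a * b \<in> K (Suc n)" unfolding K_def eq by blast
    qed
  qed
  then show ?thesis using a that unfolding K_def by blast
qed

text \<open>Pigeonhole on exponents: a term with \<open>g ^ i\<close> either has
  \<open>i >= e\<close>, or its coefficient lies in the power \<open>n + e - i > n\<close> of
  \<open>I\<close>.\<close>

lemma ideal_pow_insert_subset:
  assumes I: "ideal A I" and g: "g \<in> A" and K: "ideal A K" and IK: "ideal_pow A I n \<subseteq> K" and gK: "g ^ e \<in> K"
  shows "ideal_pow A (gen_ideal A (insert g I)) (n + e) \<subseteq> K"
proof
  fix a assume "a \<in> ideal_pow A (gen_ideal A (insert g I)) (n + e)"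
  then obtain p where p: "a = poly p g" "\<And>i. i \<le> n + e \<Longrightarrow> coeff p i \<in> ideal_pow A I (n + e - i)"
    "\<And>i. i > n + e \<Longrightarrow> coeff p i = 0"
    by (metis ideal_pow_insert_poly[OF I g])
  have "coeff p i * g ^ i \<in> K" for i
  proof -
    consider "i > n + e" | "i \<le> n + e" "i \<ge> e" | "i < e" by linarith
    then show ?thesis
    proof cases
      case 1 then show ?thesis using p K by simp
    next
      case 2
      then have "coeff p i \<in> A" using p(2) I ideal_closed[OF ideal_pow_ideal[OF I]] by blast
      moreover have "g ^ i = g ^ (i - e) * g ^ e" using 2 by (simp flip: power_add)
      ultimately show ?thesis using gK K g by (simp add: mult.assoc)
    next
      case 3
      then have "coeff p i \<in> K" using p(2)[of i] ideal_pow_antimono[OF I, of n "n + e - i"] IK by fastforce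
      then show ?thesis using K g by simp
    qed
  qed
  then show "a \<in> K" unfolding p(1) poly_altdef using K by simp
qed

lemma ideal_pow_subset_of_radical:
  assumes "finite X" "X \<subseteq> A" "ideal A K" "\<And>g. g \<in> X \<Longrightarrow> \<exists>e. g ^ e \<in> K"
  shows "\<exists>n. ideal_pow A (gen_ideal A X) n \<subseteq> K"
  using assms
proof (induction X rule: finite_induct)
  case empty
  have "ideal_pow A (gen_ideal A {}) (Suc 0) \<subseteq> K" using empty by (simp add: ideal_pow_1)
  then show ?case by blast
next
  case (insert g X)
  then obtain n e where n: "ideal_pow A (gen_ideal A X) n \<subseteq> K" and e: "g ^ e \<in> K"
    by (metis insert_iff insert_subset)
  have "ideal_pow A (gen_ideal A (insert g (gen_ideal A X))) (n + e) \<subseteq> K"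
    using insert n e by (intro ideal_pow_insert_subset) auto
  moreover have "gen_ideal A (insert g (gen_ideal A X)) = gen_ideal A (insert g X)"
    using gen_Un_gen[of X "{g}"] insert.prems by simp
  ultimately show ?case by auto
qed

section \<open>Prime ideals, and Nakayama's lemma at a prime\<close>

lemma prime_ideal_ideal: "prime_ideal A P \<Longrightarrow> ideal A P"
  by (simp add: prime_ideal_def)

lemma prime_ideal_mult: "prime_ideal A P \<Longrightarrow> a \<in> A \<Longrightarrow> b \<in> A \<Longrightarrow> a * b \<in> P \<Longrightarrow> a \<in> P \<or> b \<in> P"
  by (simp add: prime_ideal_def)

lemma prime_ideal_one: "prime_ideal A P \<Longrightarrow> 1 \<notin> P"
  using ideal_eq_self by (auto simp: prime_ideal_def)

lemma prime_ideal_power: "prime_ideal A P \<Longrightarrow> a \<in> A \<Longrightarrow> a ^ n \<in> P \<Longrightarrow> a \<in> P"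
proof (induction n)
  case (Suc n) then show ?case using prime_ideal_mult[of P a "a ^ n"] by auto
qed (simp add: prime_ideal_one)

lemma prime_ideal_pow: "prime_ideal A P \<Longrightarrow> ideal A I \<Longrightarrow> ideal_pow A I n \<subseteq> P \<Longrightarrow> I \<subseteq> P"
  using ideal_pow_power prime_ideal_power ideal_closed by blast

lemma prime_idealI:
  assumes "ideal A I" "1 \<notin> I"
    and "\<And>a b. a \<in> A \<Longrightarrow> b \<in> A \<Longrightarrow> a * b \<in> I \<Longrightarrow> a \<notin> I \<Longrightarrow> b \<notin> I \<Longrightarrow> False"
  shows "prime_ideal A I"
  using assms one_closed unfolding prime_ideal_def by blast

lemma prime_ideal_0: "prime_ideal A {0}"
  by (rule prime_idealI) auto

text \<open>The condition with varying multipliers \<open>s\<close> outside \<open>Q\<close> expresses Nakayama's lemma over the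
  localization at \<open>Q\<close> without leaving \<open>A\<close>.\<close>

lemma nakayama_at_prime:
  assumes X: "finite X" "X \<subseteq> A" and Q: "prime_ideal A Q" and J: "ideal A J"
    and "\<And>g. g \<in> X \<Longrightarrow> \<exists>s\<in>A - Q. s * g \<in> ideal_sum (ideal_prod A Q (gen_ideal A X)) J"
  shows "\<exists>s\<in>A - Q. \<forall>g\<in>X. s * g \<in> J"
  using X assms(5)
proof (induction X rule: finite_induct)
  case empty
  then show ?case using prime_ideal_one[OF Q] by (intro bexI[of _ 1]) auto
next
  case (insert g X)
  note iQ [simp] = prime_ideal_ideal[OF Q]
  have gX [simp]: "g \<in> A" "X \<subseteq> A" using insert.prems by auto
  let ?L = "ideal_sum (ideal_prod A Q (gen_ideal A X)) J"
  have L [simp]: "ideal A ?L" using J by simp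
  \<comment> \<open>All contributions of \<open>g\<close> are collected into one multiple
    \<open>q * g\<close> with \<open>q\<close> in \<open>Q\<close>; what remains involves only
    \<open>X\<close>.\<close>
  have split: "\<exists>q\<in>Q. \<exists>e\<in>?L. c = q * g + e"
    if c: "c \<in> ideal_sum (ideal_prod A Q (gen_ideal A (insert g X))) J" for c
  proof -
    let ?K = "ideal_sum ((*) g ` Q) ?L"
    have Qg: "ideal A ((*) g ` Q)" by (simp add: ideal_scale)
    then have K: "ideal A ?K" by simp
    have "ideal_prod A Q (gen_ideal A (insert g X)) \<subseteq> ?K"
    proof (rule ideal_prod_least[OF K])
      fix a b assume a: "a \<in> Q" and b: "b \<in> gen_ideal A (insert g X)"
      obtain s h where s: "s \<in> A" "h \<in> gen_ideal A X" "b = g * s + h" using gen_insertE[OF b] by auto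
      have "a * h \<in> ?L" using ideal_sum_upper[of "ideal_prod A Q (gen_ideal A X)" J] J
          ideal_prodI[OF a s(2)] by auto
      moreover have "a * s \<in> Q" using a s by simp
      moreover have "a * b = g * (a * s) + a * h" using s by (simp add: algebra_simps)
      ultimately show "a * b \<in> ?K" by (auto intro!: ideal_sumI)
    qed
    moreover have "J \<subseteq> ?K"
      using ideal_sum_upper(2)[OF Qg L] ideal_sum_upper(2)[of "ideal_prod A Q (gen_ideal A X)" J] J by auto
    ultimately have "c \<in> ?K" using c ideal_sum_least[OF K] by blast
    then obtain u e where "u \<in> (*) g ` Q" "e \<in> ?L" "c = u + e" by (rule ideal_sumE)
    then show ?thesis by (auto simp: mult.commute)
  qed
  obtain s where s: "s \<in> A - Q" "s * g \<in> ideal_sum (ideal_prod A Q (gen_ideal A (insert g X))) J"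
    using insert.prems by blast
  obtain q e where qe: "q \<in> Q" "e \<in> ?L" "s * g = q * g + e" using split[OF s(2)] by blast
  \<comment> \<open>From \<open>s * g = q * g + e\<close> the term \<open>q * g\<close> moves to the
    left, and \<open>s - q\<close> still avoids \<open>Q\<close>. So \<open>g\<close> can be
    eliminated from the hypotheses on the other generators.\<close>
  define s1 where "s1 = s - q"
  have s1A: "s1 \<in> A" using s qe ideal_closed[OF iQ] by (auto simp: s1_def)
  have s1Q: "s1 \<notin> Q" using s qe ideal_add[OF iQ, of s1 q] by (auto simp: s1_def)
  have s1g: "s1 * g \<in> ?L" using qe by (simp add: s1_def algebra_simps)
  have "\<exists>s\<in>A - Q. s * h \<in> ?L" if h: "h \<in> X" for h
  proof -
    obtain sh where sh: "sh \<in> A - Q" "sh * h \<in> ideal_sum (ideal_prod A Q (gen_ideal A (insert g X))) J"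
      using insert.prems h by blast
    obtain q' e' where qe': "q' \<in> Q" "e' \<in> ?L" "sh * h = q' * g + e'" using split[OF sh(2)] by blast
    have "s1 * sh * h = q' * (s1 * g) + s1 * e'" unfolding mult.assoc qe'(3) by (simp add: algebra_simps)
    moreover have "q' * (s1 * g) + s1 * e' \<in> ?L" using s1g qe' s1A ideal_closed[OF iQ] by simp
    moreover have "s1 * sh \<in> A - Q" using s1A s1Q sh prime_ideal_mult[OF Q] by auto
    ultimately show ?thesis by metis
  qed
  then obtain s' where s': "s' \<in> A - Q" "\<forall>h\<in>X. s' * h \<in> J" using insert.IH gX by blast
  \<comment> \<open>The multiplier found for \<open>X\<close> carries the whole ideal generated by
    \<open>X\<close> into \<open>J\<close>, hence also the right-hand side of the relation for
    \<open>s1 * g\<close>.\<close>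
  have "gen_ideal A X \<subseteq> {a \<in> A. a * s' \<in> J}"
    using s' J gX(2) by (intro gen_least ideal_colon subsetI CollectI) (auto simp: mult.commute subset_iff)
  then have "ideal_prod A Q (gen_ideal A X) \<subseteq> {a \<in> A. a * s' \<in> J}"
    using s' J ideal_closed[OF iQ] by (intro ideal_prod_least ideal_colon) (auto simp: mult.assoc)
  then have "?L \<subseteq> {a \<in> A. a * s' \<in> J}"
    using s' J ideal_closed[OF J] by (intro ideal_sum_least ideal_colon) auto
  then have "(s1 * g) * s' \<in> J" using s1g by blast
  moreover have "s1 * s' \<in> A - Q" using s1A s1Q s' prime_ideal_mult[OF Q] by auto
  moreover have "(s1 * s') * h \<in> J" if "h \<in> X" for h
    using s' J s1A that by (simp add: mult.assoc)
  ultimately show ?case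
    by (intro bexI[of _ "s1 * s'"]) (auto simp: mult_ac)
qed

end

section \<open>Noetherian rings\<close>

locale noeth_ring = field_subring +
  assumes noeth: "noetherian A"
begin

lemma finite_gen:
  assumes "ideal A I"
  obtains X where "finite X" "X \<subseteq> A" "I = gen_ideal A X"
  using noeth assms unfolding noetherian_def by blast

lemma ideal_acc:
  assumes I: "\<And>n::nat. ideal A (I n)" and mono: "\<And>n. I n \<subseteq> I (Suc n)"
  obtains n where "\<And>m. m \<ge> n \<Longrightarrow> I m = I n"
proof -
  have mono': "I m \<subseteq> I n" if "m \<le> n" for m n using lift_Suc_mono_le[of I, OF mono that] .
  have "ideal A (\<Union>n. I n)"
  proof (rule idealI)
    show "a \<in> A" if "a \<in> (\<Union>n. I n)" for a using that I ideal_closed by blast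
    show "0 \<in> (\<Union>n. I n)" using I by auto
    show "r * a \<in> (\<Union>n. I n)" if "r \<in> A" "a \<in> (\<Union>n. I n)" for r a using that I ideal_mult by blast
    show "a + b \<in> (\<Union>n. I n)" if ab: "a \<in> (\<Union>n. I n)" "b \<in> (\<Union>n. I n)" for a b
    proof -
      obtain i j where ij: "a \<in> I i" "b \<in> I j" using ab by blast
      then have "a \<in> I (max i j)" "b \<in> I (max i j)" using mono'[of i "max i j"] mono'[of j "max i j"] by auto
      then show ?thesis using ideal_add[OF I[of "max i j"]] by blast
    qed
  qed
  then obtain X where X: "finite X" "X \<subseteq> A" "(\<Union>n. I n) = gen_ideal A X" by (rule finite_gen)
  have "X \<subseteq> (\<Union>n. I n)" using X gen_subset by auto
  from X(1) this have "\<exists>n. X \<subseteq> I n"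
  proof (induction X rule: finite_induct)
    case (insert x X)
    then obtain n m where "X \<subseteq> I n" "x \<in> I m" by auto
    then have "insert x X \<subseteq> I (max n m)" using mono'[of n "max n m"] mono'[of m "max n m"] by auto
    then show ?case by blast
  qed auto
  then obtain n where n: "X \<subseteq> I n" by blast
  then have "(\<Union>n. I n) \<subseteq> I n" using X(3) gen_least[OF I n] by simp
  then have "I m = I n" if "m \<ge> n" for m using mono'[OF that] by blast
  then show ?thesis using that by blast
qed

lemma ideal_maximal:
  assumes "S \<noteq> {}" "\<And>I. I \<in> S \<Longrightarrow> ideal A I"
  obtains (ex) M where "M \<in> S" "\<And>J. J \<in> S \<Longrightarrow> M \<subseteq> J \<Longrightarrow> J = M"
proof (rule ccontr)
  assume no: "\<not> thesis"
  have step: "\<exists>J\<in>S. I \<subset> J" if "I \<in> S" for I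
    using no that ex by blast
  obtain I0 where "I0 \<in> S" using assms by blast
  then obtain f where f: "\<And>n::nat. f n \<in> S \<and> f n \<subset> f (Suc n)"
    using dependent_nat_choice[of "\<lambda>_ I. I \<in> S" "\<lambda>_ I J. I \<subset> J"] step by metis
  obtain n where "\<And>m. m \<ge> n \<Longrightarrow> f m = f n" using ideal_acc[of f] f assms(2) by (metis psubset_imp_subset)
  then show False using f[of n] by (metis le_add2 plus_1_eq_Suc psubset_eq)
qed

text \<open>An ideal that is maximal among those over \<open>L\<close> without a power of
  \<open>t\<close> is prime. Used in contrapositive form: an element of all primes over
  \<open>L\<close> has a power in \<open>L\<close>.\<close>

lemma prime_avoiding_powers:
  assumes L: "ideal A L" and t: "t \<in> A" "\<And>e. t ^ e \<notin> L"
  obtains P where "prime_ideal A P" "L \<subseteq> P" "t \<notin> P"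
proof -
  let ?S = "{I. ideal A I \<and> L \<subseteq> I \<and> (\<forall>e. t ^ e \<notin> I)}"
  obtain P where P: "P \<in> ?S" "\<And>J. J \<in> ?S \<Longrightarrow> P \<subseteq> J \<Longrightarrow> J = P"
    by (rule ideal_maximal[of ?S]) (use L t in auto)
  have iP: "ideal A P" using P by blast
  have ex: "\<exists>e s b. s \<in> A \<and> b \<in> P \<and> t ^ e = a * s + b" if a: "a \<in> A" "a \<notin> P" for a
  proof -
    have sub: "insert a P \<subseteq> A" using a ideal_subset[OF iP] by auto
    have 1: "insert a P \<subseteq> gen_ideal A (insert a P)" by (rule gen_subset)
    then have "gen_ideal A (insert a P) \<noteq> P" using a by blast
    then have "gen_ideal A (insert a P) \<notin> ?S" using P(2) 1 by blast
    then obtain e where "t ^ e \<in> gen_ideal A (insert a P)" using 1 P(1) sub by auto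
    then show ?thesis using gen_insertE_ideal[OF _ a(1) iP] by metis
  qed
  have "prime_ideal A P"
  proof (rule prime_idealI[OF iP])
    show "1 \<notin> P" using P(1) by (auto dest: spec[of _ 0])
    fix a b assume ab: "a \<in> A" "b \<in> A" "a * b \<in> P" "a \<notin> P" "b \<notin> P"
    obtain e s c where e: "s \<in> A" "c \<in> P" "t ^ e = a * s + c" using ex ab by blast
    obtain e' s' c' where e': "s' \<in> A" "c' \<in> P" "t ^ e' = b * s' + c'" using ex ab by blast
    have "t ^ (e + e') = (s * s') * (a * b) + (a * s * c' + c * (b * s' + c'))"
      unfolding power_add e(3) e'(3) by (simp add: algebra_simps)
    also have "\<dots> \<in> P" using iP ab e e' ideal_closed[OF iP] by simp
    finally show False using P(1) by blast
  qed
  moreover have "t \<notin> P" using P(1) by (auto dest: spec[of _ 1])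
  ultimately show ?thesis using that P(1) by blast
qed

text \<open>Noetherian induction. A maximal counterexample \<open>M\<close> is not prime, so it
  contains some \<open>a * b\<close> with neither factor in it; every prime over \<open>M\<close>
  contains \<open>a\<close> or \<open>b\<close>, and the finite lists for M + (a) and M + (b)
  together serve \<open>M\<close>. The finiteness feeds the compactness argument in
  \<open>exists_DVR\<close>.\<close>

lemma finite_primes_over:
  assumes "ideal A I"
  shows "\<exists>\<P>. finite \<P> \<and> (\<forall>P\<in>\<P>. prime_ideal A P \<and> I \<subseteq> P) \<and>
           (\<forall>P. prime_ideal A P \<and> I \<subseteq> P \<longrightarrow> (\<exists>P'\<in>\<P>. P' \<subseteq> P))" (is "?T I")
proof (rule ccontr)
  assume "\<not> ?T I"
  then have ne: "{I. ideal A I \<and> \<not> ?T I} \<noteq> {}" using assms by blast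
  obtain M where M: "M \<in> {I. ideal A I \<and> \<not> ?T I}"
      "\<And>J. J \<in> {I. ideal A I \<and> \<not> ?T I} \<Longrightarrow> M \<subseteq> J \<Longrightarrow> J = M"
    by (rule ideal_maximal[OF ne]) auto
  have iM: "ideal A M" and nM: "\<not> ?T M" using M(1) by auto
  have 1: "1 \<notin> M"
  proof
    assume "1 \<in> M"
    then have "?T M" using prime_ideal_one by (intro exI[of _ "{}"]) auto
    then show False using nM by blast
  qed
  have "\<not> prime_ideal A M"
  proof
    assume "prime_ideal A M"
    then have "?T M" by (intro exI[of _ "{M}"]) auto
    then show False using nM by blast
  qed
  then obtain a b where ab: "a \<in> A" "b \<in> A" "a * b \<in> M" "a \<notin> M" "b \<notin> M"
    using prime_idealI[OF iM 1] by blast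
  have T: "?T (gen_ideal A (insert c M))" if "c \<in> A" "c \<notin> M" for c
  proof (rule ccontr)
    assume "\<not> ?T (gen_ideal A (insert c M))"
    moreover have "insert c M \<subseteq> A" using that ideal_subset[OF iM] by auto
    ultimately have "gen_ideal A (insert c M) = M" using gen_subset[of "insert c M"] by (intro M(2)) auto
    then show False using gen_subset[of "insert c M"] that by auto
  qed
  obtain P1 where
    P1: "finite P1" "\<forall>P\<in>P1. prime_ideal A P \<and> gen_ideal A (insert a M) \<subseteq> P"
      "\<forall>P. prime_ideal A P \<and> gen_ideal A (insert a M) \<subseteq> P \<longrightarrow> (\<exists>P'\<in>P1. P' \<subseteq> P)"
    using T[OF ab(1,4)] by (elim exE conjE)
  obtain P2 where
    P2: "finite P2" "\<forall>P\<in>P2. prime_ideal A P \<and> gen_ideal A (insert b M) \<subseteq> P"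
      "\<forall>P. prime_ideal A P \<and> gen_ideal A (insert b M) \<subseteq> P \<longrightarrow> (\<exists>P'\<in>P2. P' \<subseteq> P)"
    using T[OF ab(2,5)] by (elim exE conjE)
  have h1: "\<exists>P'\<in>P1 \<union> P2. P' \<subseteq> P" if P: "prime_ideal A P" "M \<subseteq> P" for P
  proof -
    have "a \<in> P \<or> b \<in> P" using prime_ideal_mult[OF P(1), of a b] ab P by auto
    then have "gen_ideal A (insert a M) \<subseteq> P \<or> gen_ideal A (insert b M) \<subseteq> P"
      using P(2) gen_least[OF prime_ideal_ideal[OF P(1)]] by (metis insert_subset)
    then show ?thesis using P1(3)[rule_format, of P] P2(3)[rule_format, of P] P(1) by (meson UnI1 UnI2)
  qed
  have h2: "\<forall>P\<in>P1 \<union> P2. prime_ideal A P \<and> M \<subseteq> P"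
  proof -
    have "M \<subseteq> gen_ideal A (insert c M)" for c using gen_subset[of "insert c M"] by auto
    then show ?thesis using P1(2) P2(2) by (meson Un_iff order_trans)
  qed
  have "?T M"
  proof (intro exI conjI)
    show "finite (P1 \<union> P2)" using P1(1) P2(1) by simp
    show "\<forall>P\<in>P1 \<union> P2. prime_ideal A P \<and> M \<subseteq> P" by (rule h2)
    show "\<forall>P. prime_ideal A P \<and> M \<subseteq> P \<longrightarrow> (\<exists>P'\<in>P1 \<union> P2. P' \<subseteq> P)"
      by (intro allI impI h1) auto
  qed
  then show False using nM by blast
qed

end

locale local_domain = field_subring +
  assumes local: "local_ring A"
begin

lemma max_ideal [simp]: "ideal A (max_ideal A)"
  using local by (simp add: local_ring_def)

lemma max_closed: "a \<in> max_ideal A \<Longrightarrow> a \<in> A"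
  by (simp add: max_ideal_def)

lemma not_max_unit: "a \<in> A \<Longrightarrow> a \<notin> max_ideal A \<Longrightarrow> a \<noteq> 0 \<and> inverse a \<in> A"
  by (simp add: max_ideal_def units_of_ring_def)

lemma one_not_max: "1 \<notin> max_ideal A"
  by (simp add: max_ideal_def units_of_ring_def)

lemma proper_subset_max:
  assumes I: "ideal A I" and 1: "1 \<notin> I" shows "I \<subseteq> max_ideal A"
proof
  fix a assume a: "a \<in> I"
  show "a \<in> max_ideal A"
  proof (rule ccontr)
    assume "a \<notin> max_ideal A"
    then have "a \<noteq> 0" "inverse a \<in> A" using not_max_unit ideal_closed[OF I a] by auto
    then have "inverse a * a \<in> I" using ideal_mult[OF I _ a] by blast
    then show False using 1 \<open>a \<noteq> 0\<close> by simp
  qed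
qed

lemma prime_max: "prime_ideal A (max_ideal A)"
proof (rule prime_idealI)
  fix a b assume "a \<in> A" "b \<in> A" "a * b \<in> max_ideal A" "a \<notin> max_ideal A" "b \<notin> max_ideal A"
  moreover from this have "inverse a * inverse b \<in> A" "a * b \<noteq> 0"
    using not_max_unit[of a] not_max_unit[of b] by auto
  ultimately show False by (simp add: max_ideal_def units_of_ring_def)
qed (auto simp: one_not_max)

lemma prime_subset_max: "prime_ideal A P \<Longrightarrow> P \<subseteq> max_ideal A"
  using proper_subset_max prime_ideal_one prime_ideal_ideal by blast

lemma ideal_cancel_unit:
  assumes "ideal A I" "u \<in> A" "u \<notin> max_ideal A" "u * a \<in> I" shows "a \<in> I"
  using ideal_mult[OF assms(1), of "inverse u" "u * a"] not_max_unit[OF assms(2,3)] assms(4)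
  by (simp flip: mult.assoc)

end

section \<open>Noetherian local rings: Nakayama's lemma, Krull's intersection theorem, descending
  chains\<close>

locale noeth_local = noeth_ring + local_domain
begin

lemma nakayama:
  assumes I: "ideal A I" and J: "ideal A J"
    and sub: "I \<subseteq> ideal_sum (ideal_prod A (max_ideal A) I) J"
  shows "I \<subseteq> J"
proof -
  obtain X where X: "finite X" "X \<subseteq> A" "I = gen_ideal A X" using finite_gen[OF I] .
  have "\<exists>s\<in>A - max_ideal A. \<forall>g\<in>X. s * g \<in> J"
  proof (rule nakayama_at_prime[OF X(1,2) prime_max J])
    fix g assume "g \<in> X"
    then have "g \<in> ideal_sum (ideal_prod A (max_ideal A) (gen_ideal A X)) J"
      using sub X gen_incl by blast
    then show "\<exists>s\<in>A - max_ideal A. s * g \<in> ideal_sum (ideal_prod A (max_ideal A) (gen_ideal A X)) J"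
      using one_not_max by (intro bexI[of _ 1]) auto
  qed
  then have "X \<subseteq> J" using ideal_cancel_unit[OF J] by blast
  then show ?thesis using X gen_least[OF J] by simp
qed

lemma nakayama_elem:
  assumes I: "ideal A I" and J: "ideal A J" and x: "x \<in> max_ideal A"
    and sub: "\<And>a. a \<in> I \<Longrightarrow> \<exists>j\<in>J. \<exists>b\<in>I. a = j + x * b"
  shows "I \<subseteq> J"
proof (rule nakayama[OF I J])
  show "I \<subseteq> ideal_sum (ideal_prod A (max_ideal A) I) J"
  proof
    fix a assume "a \<in> I"
    then obtain j b where "j \<in> J" "b \<in> I" "a = x * b + j" using sub by (metis add.commute)
    then show "a \<in> ideal_sum (ideal_prod A (max_ideal A) I) J"
      using ideal_prodI[OF x, of b I] by (auto intro!: ideal_sumI)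
  qed
qed

text \<open>Krull's intersection theorem, by Zorn-style maximality instead of Artin--Rees: an ideal \<open>K\<close>
  maximal with \<open>K \<inter> E = \<mm>E + I\<close> contains a power of \<open>\<mm>\<close>.\<close>

lemma krull_intersection:
  assumes I: "ideal A I" and a: "\<And>n. a \<in> ideal_sum I (ideal_pow A (max_ideal A) n)"
  shows "a \<in> I"
proof -
  let ?m = "max_ideal A"
  define E where "E = (\<Inter>n. ideal_sum I (ideal_pow A ?m n))"
  have E: "ideal A E" unfolding E_def
  proof (rule idealI)
    show "b \<in> A" if "b \<in> (\<Inter>n. ideal_sum I (ideal_pow A ?m n))" for b
      using that ideal_closed[of "ideal_sum I (ideal_pow A ?m 0)" b] I
      by (meson INT_D UNIV_I ideal_ideal_sum ideal_pow_ideal max_ideal)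
  qed (use I in auto)
  have IE: "I \<subseteq> E" unfolding E_def using ideal_sum_upper(1)[OF I] ideal_pow_ideal[OF max_ideal] by blast
  define L where "L = ideal_sum (ideal_prod A ?m E) I"
  have L: "ideal A L" using E I by (simp add: L_def)
  have mE: "ideal_prod A ?m E \<subseteq> E" using E by (intro ideal_prod_least) (auto simp: max_closed)
  have LE: "L \<subseteq> E" unfolding L_def using mE IE E by (intro ideal_sum_least) auto
  let ?S = "{K. ideal A K \<and> K \<inter> E = L}"
  have "L \<in> ?S" using L LE by auto
  then have "?S \<noteq> {}" by blast
  then obtain K where K: "K \<in> ?S" "\<And>J. J \<in> ?S \<Longrightarrow> K \<subseteq> J \<Longrightarrow> J = K" by (rule ideal_maximal) auto
  have iK: "ideal A K" and KE: "K \<inter> E = L" using K by auto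
  have pow: "\<exists>e. y ^ e \<in> K" if y: "y \<in> ?m" for y
  proof -
    have yA: "y \<in> A" using y by (simp add: max_closed)
    \<comment> \<open>The colon ideals of \<open>K\<close> by powers of \<open>y\<close> increase
      and become stationary at \<open>n\<close>; this is the exponent for which adjoining
      \<open>y ^ n\<close> leaves the intersection with \<open>E\<close> unchanged.\<close>
    obtain n where n: "\<And>m. m \<ge> n \<Longrightarrow> {a \<in> A. a * y ^ m \<in> K} = {a \<in> A. a * y ^ n \<in> K}"
    proof (rule ideal_acc[of "\<lambda>n. {a \<in> A. a * y ^ n \<in> K}"])
      show "ideal A {a \<in> A. a * y ^ n \<in> K}" for n using ideal_colon[OF iK, of "y ^ n"] yA by simp
      show "{a \<in> A. a * y ^ n \<in> K} \<subseteq> {a \<in> A. a * y ^ Suc n \<in> K}" for n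
        using iK yA by (auto simp: mult.left_commute[of _ y])
    qed blast
    let ?G = "gen_ideal A (insert (y ^ n) K)"
    have GA: "insert (y ^ n) K \<subseteq> A" using yA ideal_subset[OF iK] by auto
    have KG: "K \<subseteq> ?G" using gen_subset[of "insert (y ^ n) K"] by auto
    have "?G \<inter> E \<subseteq> K"
    proof
      fix e assume e: "e \<in> ?G \<inter> E"
      then obtain s k where s: "s \<in> A" "k \<in> K" "e = y ^ n * s + k"
        using gen_insertE_ideal[of e "y ^ n" K] yA iK by auto
      \<comment> \<open>Multiplying by \<open>y\<close> moves \<open>e\<close> into the product of
        the maximal ideal with \<open>E\<close>, hence into \<open>K\<close>. Then
        \<open>s * y ^ Suc n\<close> lies in \<open>K\<close>, and stationarity lowers the exponent
        by one.\<close>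
      have "y * e \<in> L" unfolding L_def
        using ideal_sum_upper(1)[of "ideal_prod A ?m E" I] ideal_prodI[OF y, of e E] e E I by auto
      then have "y * e \<in> K" using KE by auto
      moreover have "y * e = s * y ^ Suc n + y * k" using s by (simp add: algebra_simps)
      ultimately have "s * y ^ Suc n \<in> K"
        using ideal_diff[OF iK, of "y * e" "y * k"] s yA iK by simp
      then have "s * y ^ n \<in> K" using n[of "Suc n"] s by auto
      then show "e \<in> K" using s iK by (simp add: mult.commute)
    qed
    then have "?G \<inter> E = L" using KG KE by auto
    then have "?G = K" using KG GA by (intro K(2)) auto
    then have "y ^ n \<in> K" using gen_subset[of "insert (y ^ n) K"] by auto
    then show ?thesis by blast
  qed
  obtain X where X: "finite X" "X \<subseteq> A" "?m = gen_ideal A X" using finite_gen[OF max_ideal] .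
  obtain N where N: "ideal_pow A ?m N \<subseteq> K"
    using ideal_pow_subset_of_radical[OF X(1,2) iK] pow gen_incl[of _ X] X(3) by auto
  have "I \<subseteq> K" using KE ideal_sum_upper(2)[of "ideal_prod A ?m E" I] E I by (auto simp: L_def)
  then have "ideal_sum I (ideal_pow A ?m N) \<subseteq> K" using N iK by (intro ideal_sum_least) auto
  then have "E \<subseteq> K" unfolding E_def by auto
  then have "E \<subseteq> I" using KE by (intro nakayama[OF E I]) (auto simp: L_def)
  then show ?thesis using a by (auto simp: E_def)
qed

corollary krull_intersection_0:
  assumes "\<And>n. a \<in> ideal_pow A (max_ideal A) n" shows "a = 0"
  using krull_intersection[of "{0}" a] assms ideal_sumI[of 0 "{0}" a] by force

text \<open>A strictly descending chain would give elements \<open>v i\<close> outside the next term; the ascending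
  chain condition makes some \<open>v n\<close> a combination of its predecessors modulo \<open>L\<close>, and the first
  unit coefficient contradicts the choice of \<open>v i\<close>.\<close>

lemma dcc_layer:
  assumes K: "\<And>n::nat. ideal A (K n)" and anti: "\<And>n. K (Suc n) \<subseteq> K n"
    and L: "ideal A L" "\<And>n. L \<subseteq> K n" and mL: "\<And>a b. a \<in> max_ideal A \<Longrightarrow> b \<in> K 0 \<Longrightarrow> a * b \<in> L"
  shows "\<exists>n. \<forall>m\<ge>n. K m = K n"
proof (rule ccontr)
  have anti': "K n \<subseteq> K m" if "m \<le> n" for m n using lift_Suc_antimono_le[of K, OF anti that] .
  assume no: "\<not> ?thesis"
  have step: "\<exists>m>n. K m \<subset> K n" for n
  proof -
    obtain m where "m \<ge> n" "K m \<noteq> K n" using no by blast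
    then show ?thesis using anti'[of n m] by (metis le_neq_implies_less psubsetI)
  qed
  have "\<exists>f::nat \<Rightarrow> nat. (\<forall>i. True) \<and> (\<forall>i. f i < f (Suc i) \<and> K (f (Suc i)) \<subset> K (f i))"
    using dependent_nat_choice[of "\<lambda>_ _. True" "\<lambda>_ i j. i < j \<and> K j \<subset> K i"] step by metis
  then obtain f :: "nat \<Rightarrow> nat" where f: "\<And>i. f i < f (Suc i)" "\<And>i. K (f (Suc i)) \<subset> K (f i)" by blast
  have fanti: "K (f j) \<subseteq> K (f i)" if "i \<le> j" for i j
    using lift_Suc_antimono_le[of "\<lambda>i. K (f i)" i j] f(2) that by (simp add: psubset_imp_subset)
  have "\<forall>i. \<exists>v. v \<in> K (f i) \<and> v \<notin> K (f (Suc i))" using f(2) by blast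
  then obtain v where v: "\<And>i. v i \<in> K (f i)" "\<And>i. v i \<notin> K (f (Suc i))" by metis
  have vA: "v i \<in> A" for i using v K ideal_closed by blast
  have LA: "L \<subseteq> A" using L ideal_subset by blast
  define E where "E i n = gen_ideal A (L \<union> v ` {i..<n})" for i n
  have E: "ideal A (E i n)" for i n unfolding E_def using LA vA by (intro ideal_gen) auto
  have "E 0 n \<subseteq> E 0 (Suc n)" for n unfolding E_def by (intro gen_mono) auto
  then obtain n where nn: "\<And>m. m \<ge> n \<Longrightarrow> E 0 m = E 0 n" using ideal_acc[of "E 0", OF E] by blast
  have "E 0 (Suc n) = E 0 n" by (rule nn) simp
  moreover have "v n \<in> E 0 (Suc n)" unfolding E_def by (intro gen_incl) auto
  ultimately have vn: "v n \<in> E 0 n" by simp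
  have "v n \<in> E i n" if "i \<le> n" for i
    using that
  proof (induction i)
    case (Suc i)
    then have "v n \<in> E i n" by simp
    moreover have "L \<union> v ` {i..<n} = insert (v i) (L \<union> v ` {Suc i..<n})"
    proof -
      have "{i..<n} = insert i {Suc i..<n}" using Suc.prems by auto
      then show ?thesis by simp
    qed
    ultimately have "v n \<in> gen_ideal A (insert (v i) (L \<union> v ` {Suc i..<n}))" by (simp add: E_def)
    then obtain s e where s: "s \<in> A" "e \<in> E (Suc i) n" "v n = v i * s + e"
      using gen_insertE[of "v n" "v i" "L \<union> v ` {Suc i..<n}"] vA LA by (auto simp: E_def)
    have EK: "E (Suc i) n \<subseteq> K (f (Suc i))" unfolding E_def
    proof (intro gen_least K Un_least L(2) image_subsetI)
      show "v j \<in> K (f (Suc i))" if "j \<in> {Suc i..<n}" for j using v(1)[of j] fanti[of "Suc i" j] that by auto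
    qed
    have "s \<in> max_ideal A"
    proof (rule ccontr)
      assume "s \<notin> max_ideal A"
      moreover have "s * v i \<in> K (f (Suc i))"
        using ideal_diff[OF K, of "v n" "f (Suc i)" e] s EK v(1)[of n] fanti[of "Suc i" n] Suc.prems
        by (auto simp: mult.commute)
      ultimately show False using ideal_cancel_unit[OF K, of s "v i" "f (Suc i)"] s v(2) by blast
    qed
    then have "s * v i \<in> L" using mL v(1)[of i] anti'[of 0 "f i"] by blast
    then have "s * v i \<in> E (Suc i) n" unfolding E_def by (intro gen_incl) auto
    then show ?case using s E by (simp add: mult.commute)
  qed (use vn in simp)
  then have "v n \<in> E n n" by simp
  then have "v n \<in> L" using L by (simp add: E_def)
  then show False using L(2) v(2) by blast
qed

text \<open>The quotient by a power of the maximal ideal is Artinian. The chain is intersected with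
  the powers \<open>?p j\<close>, by descending induction on \<open>j\<close>;
  \<open>dcc_layer\<close> treats its image in the layer between \<open>?p j\<close> and
  \<open>?p (Suc j)\<close>.\<close>

lemma dcc_above_power:
  assumes I: "\<And>n::nat. ideal A (I n)" and anti: "\<And>n. I (Suc n) \<subseteq> I n"
    and k: "\<And>n. ideal_pow A (max_ideal A) k \<subseteq> I n"
  shows "\<exists>n. \<forall>m\<ge>n. I m = I n"
proof -
  let ?p = "ideal_pow A (max_ideal A)"
  have anti': "I n \<subseteq> I m" if "m \<le> n" for m n using lift_Suc_antimono_le[of I, OF anti that] .
  have "\<exists>n. \<forall>m\<ge>n. I m \<inter> ?p j = I n \<inter> ?p j" if "j \<le> k" for j
    using that
  proof (induction rule: inc_induct)
    case base then show ?case using k by blast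
  next
    case (step j)
    obtain n1 where n1: "\<And>m. m \<ge> n1 \<Longrightarrow> I m \<inter> ?p (Suc j) = I n1 \<inter> ?p (Suc j)" using step by blast
    let ?K = "\<lambda>n. ideal_sum (I n \<inter> ?p j) (?p (Suc j))"
    have "\<exists>n. \<forall>m\<ge>n. ?K m = ?K n"
    proof (rule dcc_layer[of ?K "?p (Suc j)"])
      show "ideal A (?K n)" for n using I by simp
      show "?K (Suc n) \<subseteq> ?K n" for n using anti[of n] by (intro ideal_sum_mono) auto
      show "ideal A (?p (Suc j))" by simp
      show "?p (Suc j) \<subseteq> ?K n" for n using I by (intro ideal_sum_upper) auto
      fix a b assume a: "a \<in> max_ideal A" and b: "b \<in> ?K 0"
      have "?K 0 \<subseteq> ?p j" using ideal_pow_Suc_subset[of "max_ideal A" j] by (intro ideal_sum_least) auto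
      then show "a * b \<in> ?p (Suc j)"
        using a b ideal_prodI[of b "?p j" a "max_ideal A"] by (auto simp: ideal_pow_Suc mult.commute)
    qed
    then obtain n2 where n2: "\<And>m. m \<ge> n2 \<Longrightarrow> ?K m = ?K n2" by blast
    let ?n = "max n1 n2"
    have "I m \<inter> ?p j = I ?n \<inter> ?p j" if m: "m \<ge> ?n" for m
    proof
      show "I m \<inter> ?p j \<subseteq> I ?n \<inter> ?p j" using anti'[OF m] by auto
      show "I ?n \<inter> ?p j \<subseteq> I m \<inter> ?p j"
      proof
        fix a assume a: "a \<in> I ?n \<inter> ?p j"
        have "a \<in> ?K ?n" using a ideal_sum_upper(1)[of "I ?n \<inter> ?p j" "?p (Suc j)"] I by auto
        then have "a \<in> ?K m" using n2[of ?n] n2[of m] m by auto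
        then obtain b c where bc: "b \<in> I m \<inter> ?p j" "c \<in> ?p (Suc j)" "a = b + c" by (rule ideal_sumE)
        have "b \<in> I ?n" using bc anti'[OF m] by auto
        then have "c \<in> I ?n" using bc a ideal_diff[OF I, of a ?n b] by auto
        then have "c \<in> I m" using bc n1[of ?n] n1[of m] m by auto
        then show "a \<in> I m \<inter> ?p j" using bc a I by auto
      qed
    qed
    then show ?case by blast
  qed
  from this[of 0] obtain n where n: "\<And>m. m \<ge> n \<Longrightarrow> I m \<inter> A = I n \<inter> A" by auto
  have "I m \<inter> A = I m" for m using ideal_subset[OF I] by auto
  then show ?thesis using n by metis
qed

end

section \<open>Localization at a prime\<close>

definition loc_ext :: "'a::field set \<Rightarrow> 'a set \<Rightarrow> 'a set \<Rightarrow> 'a set" where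
  "loc_ext A P I = {a / s | a s. a \<in> I \<and> s \<in> A - P}"

lemma localization_at_eq: "localization_at A P = loc_ext A P A"
  by (simp add: localization_at_def loc_ext_def)

lemma loc_extI: "a \<in> I \<Longrightarrow> s \<in> A \<Longrightarrow> s \<notin> P \<Longrightarrow> a / s \<in> loc_ext A P I"
  unfolding loc_ext_def by blast

lemma loc_extE:
  assumes "b \<in> loc_ext A P I"
  obtains a s where "a \<in> I" "s \<in> A" "s \<notin> P" "b = a / s"
  using assms unfolding loc_ext_def by blast

context field_subring
begin

context
  fixes P assumes P: "prime_ideal A P"
begin

lemma not_prime_nonzero: "s \<notin> P \<Longrightarrow> s \<noteq> 0"
  using ideal_zero[OF prime_ideal_ideal[OF P]] by blast

lemma compl_prime_mult: "s \<in> A \<Longrightarrow> t \<in> A \<Longrightarrow> s \<notin> P \<Longrightarrow> t \<notin> P \<Longrightarrow> s * t \<notin> P"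
  using prime_ideal_mult[OF P] by blast

lemma loc_ext_add:
  assumes I: "ideal A I" and a: "a \<in> loc_ext A P I" and b: "b \<in> loc_ext A P I"
  shows "a + b \<in> loc_ext A P I"
proof -
  obtain c s where c: "c \<in> I" "s \<in> A" "s \<notin> P" "a = c / s" using a by (rule loc_extE)
  obtain d t where d: "d \<in> I" "t \<in> A" "t \<notin> P" "b = d / t" using b by (rule loc_extE)
  have "a + b = (t * c + s * d) / (s * t)"
    using c d not_prime_nonzero by (simp add: field_simps)
  then show ?thesis using c d I compl_prime_mult by (auto intro!: loc_extI)
qed

lemma loc_ext_mult:
  assumes I: "ideal A I" and a: "a \<in> localization_at A P" and b: "b \<in> loc_ext A P I"
  shows "a * b \<in> loc_ext A P I"
proof -
  obtain c s where c: "c \<in> A" "s \<in> A" "s \<notin> P" "a = c / s"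
    using a unfolding localization_at_eq by (rule loc_extE)
  obtain d t where d: "d \<in> I" "t \<in> A" "t \<notin> P" "b = d / t" using b by (rule loc_extE)
  have "a * b = (c * d) / (s * t)" using c d by simp
  then show ?thesis using c d I compl_prime_mult by (auto intro!: loc_extI)
qed

lemma loc_ext_incl: "I \<subseteq> loc_ext A P I"
proof
  fix a assume "a \<in> I"
  then have "a / 1 \<in> loc_ext A P I" using prime_ideal_one[OF P] by (intro loc_extI) auto
  then show "a \<in> loc_ext A P I" by simp
qed

lemma loc_subring: "subring (localization_at A P)"
proof -
  have A: "A \<subseteq> localization_at A P" using loc_ext_incl by (simp add: localization_at_eq)
  have "- a \<in> localization_at A P" if "a \<in> localization_at A P" for a
    using loc_ext_mult[OF ideal_self, of "-1" a] that subsetD[OF A minus_closed[OF one_closed]]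
    by (auto simp: localization_at_eq)
  then show ?thesis
    using A loc_ext_add[OF ideal_self] loc_ext_mult[OF ideal_self]
    unfolding subring_def by (auto simp: localization_at_eq)
qed

lemma loc_incl: "A \<subseteq> localization_at A P"
  using loc_ext_incl by (simp add: localization_at_eq)

interpretation B: field_subring "localization_at A P"
  by standard (rule loc_subring)

lemma ideal_loc_ext: "ideal A I \<Longrightarrow> ideal (localization_at A P) (loc_ext A P I)"
proof (rule idealI)
  assume I: "ideal A I"
  show "0 \<in> loc_ext A P I" using loc_ext_incl I by (meson ideal_zero subsetD)
  show "a \<in> localization_at A P" if "a \<in> loc_ext A P I" for a
    using that ideal_subset[OF I] by (auto simp: loc_ext_def localization_at_def)
qed (auto intro: loc_ext_add loc_ext_mult)

lemma loc_inverse: "s \<in> A \<Longrightarrow> s \<notin> P \<Longrightarrow> inverse s \<in> localization_at A P"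
  using loc_extI[of 1 A s] by (simp add: localization_at_eq inverse_eq_divide)

lemma contract_ideal: "ideal (localization_at A P) I \<Longrightarrow> ideal A (I \<inter> A)"
  using loc_incl by (intro idealI) auto

lemma loc_ext_contract:
  assumes I: "ideal (localization_at A P) I" shows "loc_ext A P (I \<inter> A) = I"
proof
  show "loc_ext A P (I \<inter> A) \<subseteq> I"
  proof
    fix b assume "b \<in> loc_ext A P (I \<inter> A)"
    then obtain a s where as: "a \<in> I \<inter> A" "s \<in> A" "s \<notin> P" "b = a / s" by (rule loc_extE)
    then have "inverse s * a \<in> I" using I loc_inverse by auto
    then show "b \<in> I" using as by (simp add: divide_inverse mult.commute)
  qed
  show "I \<subseteq> loc_ext A P (I \<inter> A)"
  proof
    fix b assume b: "b \<in> I"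
    then have "b \<in> loc_ext A P A" using ideal_subset[OF I] by (auto simp: localization_at_eq)
    then obtain a s where as: "a \<in> A" "s \<in> A" "s \<notin> P" "b = a / s" by (rule loc_extE)
    then have "s * b \<in> I" using B.ideal_mult[OF I _ b] loc_incl by blast
    then have "a \<in> I" using as not_prime_nonzero by simp
    then show "b \<in> loc_ext A P (I \<inter> A)" using as by (auto intro: loc_extI)
  qed
qed

lemma contract_prime:
  assumes Q: "prime_ideal (localization_at A P) Q" shows "prime_ideal A (Q \<inter> A)" "Q \<inter> A \<subseteq> P"
proof -
  have iQ: "ideal (localization_at A P) Q" by (rule B.prime_ideal_ideal[OF Q])
  show "prime_ideal A (Q \<inter> A)"
    using B.prime_ideal_one[OF Q] B.prime_ideal_mult[OF Q] loc_incl contract_ideal[OF iQ]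
    by (intro prime_idealI) auto
  show "Q \<inter> A \<subseteq> P"
  proof
    fix a assume a: "a \<in> Q \<inter> A"
    show "a \<in> P"
    proof (rule ccontr)
      assume aP: "a \<notin> P"
      then have "inverse a * a \<in> Q" using a loc_inverse[of a] iQ by auto
      then show False using B.prime_ideal_one[OF Q] not_prime_nonzero[OF aP] by simp
    qed
  qed
qed

lemma loc_ext_Int:
  assumes Q: "prime_ideal A Q" "Q \<subseteq> P" shows "loc_ext A P Q \<inter> A = Q"
proof
  show "loc_ext A P Q \<inter> A \<subseteq> Q"
  proof
    fix b assume b: "b \<in> loc_ext A P Q \<inter> A"
    then have "b \<in> loc_ext A P Q" by simp
    then obtain a s where as: "a \<in> Q" "s \<in> A" "s \<notin> P" "b = a / s" by (rule loc_extE)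
    then have "s * b \<in> Q" using not_prime_nonzero by simp
    then show "b \<in> Q" using prime_ideal_mult[OF Q(1) as(2), of b] b as Q(2) by auto
  qed
  show "Q \<subseteq> loc_ext A P Q \<inter> A"
    using loc_ext_incl[of Q] ideal_subset[OF prime_ideal_ideal[OF Q(1)]] by auto
qed

lemma prime_loc_ext:
  assumes Q: "prime_ideal A Q" "Q \<subseteq> P" shows "prime_ideal (localization_at A P) (loc_ext A P Q)"
proof (rule B.prime_idealI)
  show "ideal (localization_at A P) (loc_ext A P Q)"
    by (rule ideal_loc_ext[OF prime_ideal_ideal[OF Q(1)]])
  show "1 \<notin> loc_ext A P Q" using loc_ext_Int[OF Q] prime_ideal_one[OF Q(1)] one_closed by blast
  fix a b assume ab: "a \<in> localization_at A P" "b \<in> localization_at A P" "a * b \<in> loc_ext A P Q"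
    "a \<notin> loc_ext A P Q" "b \<notin> loc_ext A P Q"
  obtain c s where c: "c \<in> A" "s \<in> A" "s \<notin> P" "a = c / s"
    using ab(1) unfolding localization_at_eq by (rule loc_extE)
  obtain d t where d: "d \<in> A" "t \<in> A" "t \<notin> P" "b = d / t"
    using ab(2) unfolding localization_at_eq by (rule loc_extE)
  have "(s * t) * (a * b) \<in> loc_ext A P Q"
    using loc_ext_mult[OF prime_ideal_ideal[OF Q(1)] _ ab(3), of "s * t"] subsetD[OF loc_incl mult_closed[OF c(2) d(2)]] by blast
  moreover have "(s * t) * (a * b) = c * d" using c d not_prime_nonzero by simp
  ultimately have "c * d \<in> Q" using loc_ext_Int[OF Q] mult_closed[OF c(1) d(1)] by (metis IntI)
  then have "c \<in> Q \<or> d \<in> Q" using prime_ideal_mult[OF Q(1)] c d by blast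
  then show False using c d ab(4,5) loc_extI by blast
qed

lemma loc_max_ideal: "max_ideal (localization_at A P) = loc_ext A P P"
proof
  show "max_ideal (localization_at A P) \<subseteq> loc_ext A P P"
  proof
    fix b assume b: "b \<in> max_ideal (localization_at A P)"
    then have "b \<in> loc_ext A P A" by (simp add: max_ideal_def localization_at_eq)
    then obtain a s where as: "a \<in> A" "s \<in> A" "s \<notin> P" "b = a / s" by (rule loc_extE)
    show "b \<in> loc_ext A P P"
    proof (cases "a \<in> P")
      case False
      then have "s / a \<in> localization_at A P" using as by (auto simp: localization_at_eq intro: loc_extI)
      then have "b \<in> units_of_ring (localization_at A P)"
        using as b False not_prime_nonzero by (auto simp: units_of_ring_def max_ideal_def)
      then show ?thesis using b by (simp add: max_ideal_def)
    qed (use as in \<open>auto intro: loc_extI\<close>)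
  qed
  have p: "prime_ideal (localization_at A P) (loc_ext A P P)" by (rule prime_loc_ext[OF P order_refl])
  show "loc_ext A P P \<subseteq> max_ideal (localization_at A P)"
  proof
    fix b assume b: "b \<in> loc_ext A P P"
    show "b \<in> max_ideal (localization_at A P)"
    proof (rule ccontr)
      assume n: "b \<notin> max_ideal (localization_at A P)"
      have "b \<in> localization_at A P" using b B.ideal_closed[OF B.prime_ideal_ideal[OF p]] by blast
      then have "b \<noteq> 0" "inverse b \<in> localization_at A P"
        using n by (auto simp: max_ideal_def units_of_ring_def)
      then have "inverse b * b \<in> loc_ext A P P"
        using B.ideal_mult[OF B.prime_ideal_ideal[OF p] _ b] by blast
      then show False using \<open>b \<noteq> 0\<close> B.prime_ideal_one[OF p] by simp
    qed
  qed
qed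

lemma loc_local: "local_ring (localization_at A P)"
  unfolding local_ring_def loc_max_ideal
  using loc_subring ideal_loc_ext[OF prime_ideal_ideal[OF P]] by blast

lemma loc_noetherian:
  assumes "noetherian A" shows "noetherian (localization_at A P)"
  unfolding noetherian_def
proof (intro conjI allI impI)
  show "subring (localization_at A P)" by (rule loc_subring)
  fix I assume I: "ideal (localization_at A P) I"
  interpret noeth_ring A by standard (rule assms)
  obtain X where X: "finite X" "X \<subseteq> A" "I \<inter> A = gen_ideal A X"
    using finite_gen[OF contract_ideal[OF I]] .
  have XB: "X \<subseteq> localization_at A P" using X loc_incl by blast
  have "gen_ideal (localization_at A P) X \<subseteq> I"
    using X(3) gen_subset[of X] by (intro B.gen_least[OF I]) auto
  moreover have "I \<subseteq> gen_ideal (localization_at A P) X"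
  proof -
    have "I \<inter> A \<subseteq> gen_ideal (localization_at A P) X \<inter> A" unfolding X(3)
      using B.gen_subset[of X] X(2) by (intro gen_least contract_ideal B.ideal_gen[OF XB]) auto
    then have "loc_ext A P (I \<inter> A) \<subseteq> loc_ext A P (gen_ideal (localization_at A P) X \<inter> A)"
      unfolding loc_ext_def by blast
    then show ?thesis using loc_ext_contract[OF I] loc_ext_contract[OF B.ideal_gen[OF XB]] by simp
  qed
  ultimately show "\<exists>X. finite X \<and> X \<subseteq> localization_at A P \<and> I = gen_ideal (localization_at A P) X"
    using X XB by blast
qed

end

text \<open>The set is the contraction to \<open>A\<close> of the extension of \<open>I\<close> to
  the localization at \<open>Q\<close>; symbolic powers arise in this way.\<close>

lemma ideal_saturation:
  assumes Q: "prime_ideal A Q" and I: "ideal A I"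
  shows "ideal A {a \<in> A. \<exists>s\<in>A - Q. s * a \<in> I}"
proof (rule idealI)
  show "0 \<in> {a \<in> A. \<exists>s\<in>A - Q. s * a \<in> I}"
    using prime_ideal_one[OF Q] I by (intro CollectI conjI bexI[of _ 1]) auto
  fix a b assume "a \<in> {a \<in> A. \<exists>s\<in>A - Q. s * a \<in> I}" "b \<in> {a \<in> A. \<exists>s\<in>A - Q. s * a \<in> I}"
  then obtain s t where st: "a \<in> A" "b \<in> A" "s \<in> A" "s \<notin> Q" "s * a \<in> I" "t \<in> A" "t \<notin> Q" "t * b \<in> I" by blast
  have "(s * t) * (a + b) = t * (s * a) + s * (t * b)" by (simp add: algebra_simps)
  also have "\<dots> \<in> I" using I st by simp
  finally show "a + b \<in> {a \<in> A. \<exists>s\<in>A - Q. s * a \<in> I}"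
    using st compl_prime_mult[OF Q] by (auto intro!: bexI[of _ "s * t"])
next
  fix r a assume "r \<in> A" "a \<in> {a \<in> A. \<exists>s\<in>A - Q. s * a \<in> I}"
  then obtain s where s: "r \<in> A" "a \<in> A" "s \<in> A - Q" "s * a \<in> I" by blast
  then have "s * (r * a) \<in> I" using ideal_mult[OF I, of r "s * a"] by (simp add: mult.left_commute)
  then show "r * a \<in> {a \<in> A. \<exists>s\<in>A - Q. s * a \<in> I}" using s by auto
qed auto

end

section \<open>Krull's principal ideal theorem and chains of primes\<close>

text \<open>Krull's argument. If only the maximal ideal lay over \<open>Q0\<close> and
  \<open>x\<close>, the ring modulo these would be Artinian, so the symbolic powers of
  \<open>Q1\<close> would become stationary modulo \<open>L\<close>. Nakayama's lemma removes
  \<open>L\<close>, and Nakayama's lemma at \<open>Q1\<close> then gives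
  \<open>Q1 \<subseteq> Q0\<close>. The existential form is what the exchange of primes in a chain
  requires.\<close>

lemma (in noeth_local) local_principal_ideal_theorem:
  assumes Q0: "prime_ideal A Q0" and Q1: "prime_ideal A Q1" and sub: "Q0 \<subset> Q1" "Q1 \<noteq> max_ideal A"
    and x: "x \<in> max_ideal A"
  shows "\<exists>P. prime_ideal A P \<and> Q0 \<subseteq> P \<and> x \<in> P \<and> P \<noteq> max_ideal A"
proof (rule ccontr)
  assume no: "\<not> ?thesis"
  let ?m = "max_ideal A"
  note i0 = prime_ideal_ideal[OF Q0] and i1 = prime_ideal_ideal[OF Q1]
  have xA: "x \<in> A" using x by (rule max_closed)
  have xQ1: "x \<notin> Q1" using no Q1 sub by blast
  define L where "L = gen_ideal A (insert x Q0)"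
  have LA: "insert x Q0 \<subseteq> A" using xA ideal_subset[OF i0] by auto
  have L: "ideal A L" unfolding L_def using LA by simp
  have rad: "\<exists>e. t ^ e \<in> L" if t: "t \<in> ?m" for t
  proof (rule ccontr)
    assume "\<not> ?thesis"
    then obtain P where P: "prime_ideal A P" "L \<subseteq> P" "t \<notin> P"
      using prime_avoiding_powers[OF L, of t] max_closed[OF t] by blast
    then show False using no t gen_subset[of "insert x Q0"] unfolding L_def by blast
  qed
  obtain X where X: "finite X" "X \<subseteq> A" "?m = gen_ideal A X" using finite_gen[OF max_ideal] .
  obtain k where k: "ideal_pow A ?m k \<subseteq> L"
    using ideal_pow_subset_of_radical[OF X(1,2) L] rad gen_incl[of _ X] X(3) by auto
  \<comment> \<open>The \<open>n\<close>-th symbolic power of \<open>Q1\<close>, taken modulo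
    \<open>Q0\<close>.\<close>
  define q where "q n = {a \<in> A. \<exists>s\<in>A - Q1. s * a \<in> ideal_sum (ideal_pow A Q1 n) Q0}" for n
  have q: "ideal A (q n)" for n unfolding q_def by (rule ideal_saturation[OF Q1]) (simp add: i0 i1)
  have qanti: "q (Suc n) \<subseteq> q n" for n
    unfolding q_def using ideal_sum_mono[OF ideal_pow_Suc_subset[OF i1, of n] order_refl[of Q0]] by auto
  have Q0q: "Q0 \<subseteq> q n" for n unfolding q_def
    using ideal_sum_upper(2)[of "ideal_pow A Q1 n" Q0] i0 i1 prime_ideal_one[OF Q1] ideal_subset[OF i0]
    by (auto intro!: bexI[of _ 1])
  have "\<exists>n. \<forall>m\<ge>n. ideal_sum (q m) L = ideal_sum (q n) L"
  proof (rule dcc_above_power)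
    show "ideal A (ideal_sum (q n) L)" for n using q L by simp
    show "ideal_sum (q (Suc n)) L \<subseteq> ideal_sum (q n) L" for n by (rule ideal_sum_mono[OF qanti order_refl])
    show "ideal_pow A ?m k \<subseteq> ideal_sum (q n) L" for n using k ideal_sum_upper(2)[OF q L] by blast
  qed
  then obtain n where n: "ideal_sum (q (Suc n)) L = ideal_sum (q n) L" by (meson le_SucI order_refl)
  have "q n \<subseteq> q (Suc n)"
  proof (rule nakayama_elem[OF q q x])
    fix a assume a: "a \<in> q n"
    then have "a \<in> ideal_sum (q (Suc n)) L" using n ideal_sum_upper(1)[OF q L] by blast
    then obtain b l where b: "b \<in> q (Suc n)" "l \<in> L" "a = b + l" by (rule ideal_sumE)
    obtain s z where s: "s \<in> A" "z \<in> Q0" "l = x * s + z"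
      using gen_insertE_ideal[OF _ xA i0] b(2) unfolding L_def by metis
    have "x * s = a - b - z" using b s by simp
    moreover have "a - b - z \<in> q n" using a b(1) s(2) qanti Q0q q by (meson ideal_diff subsetD)
    ultimately have "x * s \<in> q n" by simp
    then obtain t where t: "t \<in> A - Q1" "t * (x * s) \<in> ideal_sum (ideal_pow A Q1 n) Q0"
      unfolding q_def by blast
    \<comment> \<open>\<open>x\<close> avoids \<open>Q1\<close>, so it can be absorbed into the
      multiplier: symbolic powers allow cancellation of \<open>x\<close>. This provides the relation
      \<open>a = j + x * b\<close> with \<open>b\<close> again in \<open>q n\<close>.\<close>
    have "t * x \<in> A - Q1" using t xA xQ1 compl_prime_mult[OF Q1] by auto
    then have "s \<in> q n" unfolding q_def using s t by (auto simp: mult.assoc intro!: bexI[of _ "t * x"])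
    moreover have "b + z \<in> q (Suc n)" using b(1) s(2) Q0q q by (meson ideal_add subsetD)
    ultimately show "\<exists>j\<in>q (Suc n). \<exists>b\<in>q n. a = j + x * b"
      using b s by (intro bexI[of _ "b + z"] bexI[of _ s]) auto
  qed
  moreover have "ideal_pow A Q1 n \<subseteq> q n" unfolding q_def
    using ideal_sum_upper(1)[of "ideal_pow A Q1 n" Q0] i0 i1 prime_ideal_one[OF Q1]
      ideal_closed[OF ideal_pow_ideal[OF i1, of n]]
    by (auto intro!: bexI[of _ 1])
  ultimately have Qn: "ideal_pow A Q1 n \<subseteq> q (Suc n)" by blast
  obtain G where G: "finite G" "G \<subseteq> A" "ideal_pow A Q1 n = gen_ideal A G"
    using finite_gen[OF ideal_pow_ideal[OF i1]] .
  \<comment> \<open>Localized at \<open>Q1\<close> and modulo \<open>Q0\<close>, the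
    \<open>n\<close>-th power of \<open>Q1\<close> now equals the next one, so it vanishes
    there.\<close>
  have "\<exists>s\<in>A - Q1. \<forall>g\<in>G. s * g \<in> Q0"
  proof (rule nakayama_at_prime[OF G(1,2) Q1 i0])
    fix g assume "g \<in> G"
    then have "g \<in> q (Suc n)" using Qn G gen_incl by blast
    moreover have "ideal_pow A Q1 (Suc n) \<subseteq> ideal_prod A Q1 (gen_ideal A G)"
      unfolding ideal_pow_Suc G(3)[symmetric]
    proof (rule ideal_prod_least)
      show "a * b \<in> ideal_prod A Q1 (ideal_pow A Q1 n)" if "a \<in> ideal_pow A Q1 n" "b \<in> Q1" for a b
        using ideal_prodI[OF that(2,1)] by (simp add: mult.commute)
    qed (simp add: i1)
    ultimately show "\<exists>s\<in>A - Q1. s * g \<in> ideal_sum (ideal_prod A Q1 (gen_ideal A G)) Q0"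
      unfolding q_def using ideal_sum_mono[of "ideal_pow A Q1 (Suc n)" _ Q0 Q0] by blast
  qed
  then obtain s where s: "s \<in> A - Q1" "\<forall>g\<in>G. s * g \<in> Q0" by blast
  have "G \<subseteq> Q0" using s sub prime_ideal_mult[OF Q0, of s] G(2) by blast
  then have "ideal_pow A Q1 n \<subseteq> Q0" using gen_least[OF i0] G(3) by simp
  then have "Q1 \<subseteq> Q0" using prime_ideal_pow[OF Q0 i1] by blast
  then show False using sub by blast
qed

context noeth_ring
begin

text \<open>In the localization at \<open>Q2\<close> the prime \<open>Q2\<close> becomes the maximal
  ideal, so the local theorem applies; the prime that it yields is contracted to
  \<open>A\<close>.\<close>

lemma prime_between_containing:
  assumes Q0: "prime_ideal A Q0" and Q1: "prime_ideal A Q1" and Q2: "prime_ideal A Q2"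
    and sub: "Q0 \<subset> Q1" "Q1 \<subset> Q2" and x: "x \<in> Q2"
  shows "\<exists>P. prime_ideal A P \<and> Q0 \<subset> P \<and> P \<subset> Q2 \<and> x \<in> P"
proof -
  interpret B: noeth_local "localization_at A Q2"
    using loc_subring[OF Q2] loc_noetherian[OF Q2 noeth] loc_local[OF Q2] by unfold_locales
  have Q0': "prime_ideal (localization_at A Q2) (loc_ext A Q2 Q0)"
    and Q1': "prime_ideal (localization_at A Q2) (loc_ext A Q2 Q1)"
    using prime_loc_ext[OF Q2] Q0 Q1 sub by auto
  have int: "loc_ext A Q2 Q0 \<inter> A = Q0" "loc_ext A Q2 Q1 \<inter> A = Q1" "loc_ext A Q2 Q2 \<inter> A = Q2"
    using loc_ext_Int[OF Q2] Q0 Q1 Q2 sub by auto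
  have "loc_ext A Q2 Q0 \<subseteq> loc_ext A Q2 Q1" using sub unfolding loc_ext_def by blast
  then have "loc_ext A Q2 Q0 \<subset> loc_ext A Q2 Q1" using int sub by (metis psubset_eq)
  moreover have "loc_ext A Q2 Q1 \<noteq> max_ideal (localization_at A Q2)"
    unfolding loc_max_ideal[OF Q2] using int(2,3) sub(2) by (metis psubset_eq)
  moreover have "x \<in> max_ideal (localization_at A Q2)"
    using int(3) x loc_max_ideal[OF Q2] by blast
  ultimately obtain P where P: "prime_ideal (localization_at A Q2) P" "loc_ext A Q2 Q0 \<subseteq> P" "x \<in> P"
    "P \<noteq> max_ideal (localization_at A Q2)"
    using B.local_principal_ideal_theorem[OF Q0' Q1'] by blast
  have PA: "prime_ideal A (P \<inter> A)" "P \<inter> A \<subseteq> Q2" using contract_prime[OF Q2 P(1)] by auto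
  have "P \<inter> A \<noteq> Q2"
    using loc_ext_contract[OF Q2 B.prime_ideal_ideal[OF P(1)]] loc_max_ideal[OF Q2] P(4) by auto
  moreover have "Q0 \<subseteq> P \<inter> A" using int(1) P(2) by auto
  moreover have "x \<in> P \<inter> A" using x ideal_closed[OF prime_ideal_ideal[OF Q2]] P(3) by auto
  ultimately show ?thesis using PA Q1 sub by (cases "Q0 = P \<inter> A") blast+
qed

text \<open>Imposing one element costs at most one prime: \<open>x\<close> is pushed down the chain
  by exchanging each intermediate prime for one that contains \<open>x\<close>, until only the
  bottom one has to be dropped.\<close>

lemma prime_chain_containing:
  assumes "prime_chain A c (Suc n)" "x \<in> c (Suc n)"
  shows "\<exists>c'. prime_chain A c' n \<and> c' n = c (Suc n) \<and> c 0 \<subseteq> c' 0 \<and> x \<in> c' 0"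
  using assms
proof (induction n arbitrary: c)
  case 0
  then show ?case by (intro exI[of _ "\<lambda>i. c (Suc 0)"]) (auto simp: prime_chain_def)
next
  case (Suc n)
  have c: "prime_ideal A (c i)" if "i \<le> Suc (Suc n)" for i using Suc.prems that by (auto simp: prime_chain_def)
  have cs: "c i \<subset> c (Suc i)" if "i < Suc (Suc n)" for i using Suc.prems that by (auto simp: prime_chain_def)
  obtain P where P: "prime_ideal A P" "c n \<subset> P" "P \<subset> c (Suc (Suc n))" "x \<in> P"
    using prime_between_containing[OF c[of n] c[of "Suc n"] c cs cs Suc.prems(2)] by auto
  have "prime_chain A (c(Suc n := P)) (Suc n)"
    unfolding prime_chain_def using P c cs by (auto simp: less_Suc_eq le_Suc_eq)
  then obtain c' where c': "prime_chain A c' n" "c' n = P" "c 0 \<subseteq> c' 0" "x \<in> c' 0"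
  proof -
    have "x \<in> (c(Suc n := P)) (Suc n)" using P(4) by simp
    from Suc.IH[OF \<open>prime_chain A (c(Suc n := P)) (Suc n)\<close> this] show ?thesis using that by auto
  qed
  have "prime_chain A (c'(Suc n := c (Suc (Suc n)))) (Suc n)"
    unfolding prime_chain_def using P c c' by (auto simp: less_Suc_eq le_Suc_eq prime_chain_def)
  then show ?case
  proof (intro exI conjI)
    show "c 0 \<subseteq> (c'(Suc n := c (Suc (Suc n)))) 0" "x \<in> (c'(Suc n := c (Suc (Suc n)))) 0" using c' by auto
  qed (assumption, simp)
qed

end

context noeth_local
begin

lemma prime_chain_max_top:
  assumes "prime_chain A c (Suc n)" shows "prime_chain A (c(Suc n := max_ideal A)) (Suc n)"
proof -
  have "c n \<subset> c (Suc n)" "c (Suc n) \<subseteq> max_ideal A"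
    using assms prime_subset_max by (auto simp: prime_chain_def)
  then show ?thesis using assms prime_max by (auto simp: prime_chain_def less_Suc_eq le_Suc_eq)
qed

lemma prime_chain_over_insert:
  assumes c: "prime_chain A c (Suc n)" "J \<subseteq> c 0" and x: "x \<in> max_ideal A"
  obtains c' where "prime_chain A c' n" "c 0 \<subseteq> c' 0" "x \<in> c' 0"
  using prime_chain_containing[OF prime_chain_max_top[OF c(1)], of x] x by auto

text \<open>The dimension of A/J is at most the number of generators of the maximal ideal over
  \<open>J\<close>: absorbing a generator into \<open>J\<close> shortens the chain by one.\<close>

lemma prime_chain_length_le:
  assumes "finite Y" "Y \<subseteq> A" "ideal A J" "max_ideal A = gen_ideal A (J \<union> Y)"
    "prime_chain A c n" "J \<subseteq> c 0"
  shows "n \<le> card Y"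
  using assms
proof (induction Y arbitrary: J c n rule: finite_induct)
  case empty
  then have m: "max_ideal A \<subseteq> c 0" by simp
  have "\<not> 0 < n"
  proof
    assume "0 < n"
    then have "c 0 \<subset> c (Suc 0)" "c (Suc 0) \<subseteq> max_ideal A"
      using empty.prems(4) prime_subset_max by (auto simp: prime_chain_def)
    then show False using m by blast
  qed
  then show ?case by simp
next
  case (insert x Y)
  show ?case
  proof (cases n)
    case (Suc n')
    have JA: "J \<subseteq> A" using insert.prems ideal_subset by blast
    have x: "x \<in> max_ideal A" using insert.prems gen_incl by auto
    obtain c' where c': "prime_chain A c' n'" "c 0 \<subseteq> c' 0" "x \<in> c' 0"
      using prime_chain_over_insert[of c n' J x] insert.prems x Suc by blast
    have "n' \<le> card Y"
    proof (rule insert.IH[of "gen_ideal A (insert x J)" c' n'])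
      show "Y \<subseteq> A" using insert.prems by blast
      show "ideal A (gen_ideal A (insert x J))" using insert.prems JA by simp
      show "max_ideal A = gen_ideal A (gen_ideal A (insert x J) \<union> Y)"
        using insert.prems JA by (simp add: gen_Un_gen)
      have "ideal A (c' 0)" using c' prime_ideal_ideal by (auto simp: prime_chain_def)
      then show "gen_ideal A (insert x J) \<subseteq> c' 0"
        using c' insert.prems by (intro gen_least) auto
    qed (use c' in auto)
    then show ?thesis using insert Suc by simp
  qed simp
qed

text \<open>Modulo one of the generators \<open>x\<close> the ideals \<open>J\<close> and \<open>c 0\<close> agree by induction and dimension,
  whence \<open>c 0 \<subseteq> J + x \<cdot> c 0\<close> and \<open>J = c 0\<close> by Nakayama's lemma.\<close>

lemma regular_quotient_prime:
  assumes "finite Y" "Y \<subseteq> A" "ideal A J" "max_ideal A = gen_ideal A (J \<union> Y)"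
    "prime_chain A c (card Y)" "J \<subseteq> c 0"
  shows "prime_ideal A J"
  using assms
proof (induction Y arbitrary: J c rule: finite_induct)
  case empty
  then show ?case using prime_max by simp
next
  case (insert x Y)
  have card: "card (insert x Y) = Suc (card Y)" using insert by simp
  have JA: "J \<subseteq> A" and xA: "x \<in> A" and YA: "Y \<subseteq> A" using insert.prems(1) ideal_subset[OF insert.prems(2)] by auto
  have c0: "prime_ideal A (c 0)" using insert.prems by (auto simp: prime_chain_def)
  note ic0 = prime_ideal_ideal[OF c0]
  have c0A: "c 0 \<subseteq> A" using ideal_subset[OF ic0] .
  have x: "x \<in> max_ideal A" using insert.prems gen_incl by auto
  obtain c' where c': "prime_chain A c' (card Y)" "c 0 \<subseteq> c' 0" "x \<in> c' 0"
    using prime_chain_over_insert[of c "card Y" J x] insert.prems x card by auto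
  have c'0: "prime_ideal A (c' 0)" using c' by (auto simp: prime_chain_def)
  let ?J1 = "gen_ideal A (insert x J)" and ?P1 = "gen_ideal A (insert x (c 0))"
  have J1: "ideal A ?J1" and P1: "ideal A ?P1" using JA xA c0A by auto
  have JP: "?J1 \<subseteq> ?P1" using insert.prems by (intro gen_mono) auto
  have Pc': "?P1 \<subseteq> c' 0" using c' prime_ideal_ideal[OF c'0] by (intro gen_least) auto
  have mJ: "max_ideal A = gen_ideal A (?J1 \<union> Y)" using insert.prems JA xA YA by (simp add: gen_Un_gen)
  have mP: "max_ideal A = gen_ideal A (?P1 \<union> Y)"
  proof
    show "max_ideal A \<subseteq> gen_ideal A (?P1 \<union> Y)" unfolding mJ using JP by (intro gen_mono) auto
    show "gen_ideal A (?P1 \<union> Y) \<subseteq> max_ideal A"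
      using Pc' prime_subset_max[OF c'0] gen_subset[of "J \<union> insert x Y"] insert.prems(3)
      by (intro gen_least max_ideal) auto
  qed
  have pJ: "prime_ideal A ?J1" using insert.IH[OF YA J1 mJ c'(1)] JP Pc' by blast
  have pP: "prime_ideal A ?P1" using insert.IH[OF YA P1 mP c'(1)] Pc' by blast
  \<comment> \<open>Otherwise the prime \<open>?J1\<close> could be put in front of the chain
    \<open>c'\<close>, which would exceed the length bound for chains over
    \<open>?J1\<close>.\<close>
  have eq: "?J1 = ?P1"
  proof (rule ccontr)
    assume "?J1 \<noteq> ?P1"
    then have s: "?J1 \<subset> c' 0" using JP Pc' by blast
    define d where "d i = (case i of 0 \<Rightarrow> ?J1 | Suc j \<Rightarrow> c' j)" for i
    have "prime_chain A d (Suc (card Y))"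
      unfolding prime_chain_def d_def using pJ s c'(1) by (auto simp: prime_chain_def split: nat.splits)
    then have "Suc (card Y) \<le> card Y"
      using prime_chain_length_le[OF insert.hyps(1) YA J1 mJ, of d] by (simp add: d_def)
    then show False by simp
  qed
  \<comment> \<open>If \<open>x\<close> were in \<open>c 0\<close>, the whole chain \<open>c\<close>
    would lie over \<open>?J1\<close>, again too long by one.\<close>
  have xc: "x \<notin> c 0"
  proof
    assume "x \<in> c 0"
    then have "?J1 \<subseteq> c 0" using insert.prems ic0 by (intro gen_least) auto
    then have "card (insert x Y) \<le> card Y"
      using prime_chain_length_le[OF insert.hyps(1) YA J1 mJ, of c] insert.prems by blast
    then show False using card by simp
  qed
  have "c 0 \<subseteq> J"
  proof (rule nakayama_elem[OF ic0 insert.prems(2) x])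
    fix a assume a: "a \<in> c 0"
    then have "a \<in> ?J1" using eq gen_subset[of "insert x (c 0)"] by auto
    then obtain s j where s: "s \<in> A" "j \<in> J" "a = x * s + j"
      using gen_insertE_ideal[OF _ xA insert.prems(2)] by metis
    have "x * s \<in> c 0" using ideal_diff[OF ic0, of a j] a s insert.prems(5) by auto
    then have "s \<in> c 0" using prime_ideal_mult[OF c0 xA s(1)] xc by blast
    then show "\<exists>j\<in>J. \<exists>b\<in>c 0. a = j + x * b" using s by (intro bexI[of _ j] bexI[of _ s]) auto
  qed
  then have "J = c 0" using insert.prems by blast
  then show ?case using c0 by simp
qed

end

section \<open>Regular parameters and the order filtration\<close>

text \<open>The trace in \<open>A\<close> of part of a regular system of parameters of A/J. It is
  encoded by two properties that survive both passage to a subset of \<open>Y\<close> and absorption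
  of a parameter into \<open>J\<close>, the two moves of the inductions below.\<close>

definition prime_family :: "'a::field set \<Rightarrow> 'a set \<Rightarrow> 'a set \<Rightarrow> bool" where
  "prime_family A J Y \<longleftrightarrow> finite Y \<and> Y \<subseteq> A \<and> ideal A J \<and>
     (\<forall>Z\<subseteq>Y. prime_ideal A (gen_ideal A (J \<union> Z)) \<and> (\<forall>y\<in>Y - Z. y \<notin> gen_ideal A (J \<union> Z)))"

text \<open>The preimage in \<open>A\<close> of the \<open>n\<close>-th power of the ideal generated
  by \<open>Y\<close> in A/J.\<close>

definition order_filt :: "'a::field set \<Rightarrow> 'a set \<Rightarrow> 'a set \<Rightarrow> nat \<Rightarrow> 'a set" where
  "order_filt A J Y n = ideal_sum (ideal_pow A (gen_ideal A Y) n) J"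

text \<open>Absorbing the parameters in \<open>Z\<close> costs one prime each and leaves a chain of
  length \<open>card (Y - Z)\<close> above them, which is what \<open>regular_quotient_prime\<close>
  requires. A redundant parameter would contradict \<open>prime_chain_length_le\<close>.\<close>

lemma (in noeth_local) prime_family_of_dim:
  assumes Y: "finite Y" "Y \<subseteq> A" and gen: "gen_ideal A Y = max_ideal A" and c: "prime_chain A c (card Y)"
  shows "prime_family A {0} Y"
proof -
  have gen0: "gen_ideal A ({0} \<union> Z) = gen_ideal A Z" if "Z \<subseteq> A" for Z
    using gen_Un_gen[of "{}" Z] that by simp
  have chain: "\<exists>c. prime_chain A c (card (Y - Z)) \<and> gen_ideal A Z \<subseteq> c 0" if "Z \<subseteq> Y" for Z
    using finite_subset[OF that Y(1)] that
  proof (induction Z rule: finite_induct)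
    case empty
    have "0 \<in> c 0" using c prime_ideal_ideal by (auto simp: prime_chain_def)
    then show ?case using c by auto
  next
    case (insert z Z)
    then obtain c where c: "prime_chain A c (card (Y - Z))" "gen_ideal A Z \<subseteq> c 0" by auto
    have "Y - Z = insert z (Y - insert z Z)" using insert by auto
    then have "card (Y - Z) = Suc (card (Y - insert z Z))"
      by (metis Diff_iff card_insert_disjoint finite_Diff insertI1 Y(1))
    moreover have "z \<in> max_ideal A" using insert.prems gen gen_incl by blast
    ultimately obtain c' where c': "prime_chain A c' (card (Y - insert z Z))" "c 0 \<subseteq> c' 0" "z \<in> c' 0"
      using prime_chain_over_insert[of c "card (Y - insert z Z)" "c 0" z] c by auto
    have "ideal A (c' 0)" using c' prime_ideal_ideal by (auto simp: prime_chain_def)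
    then have "gen_ideal A (insert z Z) \<subseteq> c' 0"
      using c(2) c' gen_subset[of Z] by (intro gen_least) auto
    then show ?case using c' by blast
  qed
  have split: "max_ideal A = gen_ideal A (gen_ideal A Z \<union> (Y - Z))" if "Z \<subseteq> Y" for Z
  proof -
    have "gen_ideal A (gen_ideal A Z \<union> (Y - Z)) = gen_ideal A (Z \<union> (Y - Z))"
      using Y that by (intro gen_Un_gen) auto
    moreover have "Z \<union> (Y - Z) = Y" using that by blast
    ultimately show ?thesis using gen by simp
  qed
  have "prime_ideal A (gen_ideal A Z)" if Z: "Z \<subseteq> Y" for Z
  proof -
    obtain c where c: "prime_chain A c (card (Y - Z))" "gen_ideal A Z \<subseteq> c 0" using chain[OF Z] by blast
    show ?thesis using Y Z by (intro regular_quotient_prime[OF _ _ _ split[OF Z] c] ideal_gen) auto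
  qed
  moreover have "y \<notin> gen_ideal A Z" if Z: "Z \<subseteq> Y" and y: "y \<in> Y - Z" for Z y
  proof
    assume yZ: "y \<in> gen_ideal A Z"
    have ZA: "Z \<subseteq> A" using Z Y by blast
    obtain c where c: "prime_chain A c (card (Y - Z))" "gen_ideal A Z \<subseteq> c 0" using chain[OF Z] by blast
    have "gen_ideal A Z \<union> (Y - Z) = gen_ideal A Z \<union> (Y - Z - {y})" using yZ y by blast
    then have "card (Y - Z) \<le> card (Y - Z - {y})"
      using prime_chain_length_le[of "Y - Z - {y}" "gen_ideal A Z" c] Y ZA c split[OF Z] by auto
    moreover have "card (Y - Z - {y}) < card (Y - Z)" using y Y by (intro psubset_card_mono) auto
    ultimately show False by simp
  qed
  ultimately show ?thesis using Y gen0 unfolding prime_family_def by auto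
qed

context field_subring
begin

lemma prime_family_mono: "prime_family A J Y \<Longrightarrow> Y' \<subseteq> Y \<Longrightarrow> prime_family A J Y'"
  unfolding prime_family_def by (meson Diff_iff finite_subset order_trans subsetD)

lemma prime_family_insert:
  assumes "prime_family A J (insert y Y)" "y \<notin> Y"
  shows "prime_family A (gen_ideal A (insert y J)) Y"
proof -
  have h: "finite Y" "Y \<subseteq> A" "y \<in> A" "ideal A J" "J \<subseteq> A"
    using assms ideal_subset by (auto simp: prime_family_def)
  have eq: "gen_ideal A (gen_ideal A (insert y J) \<union> Z) = gen_ideal A (J \<union> insert y Z)" if "Z \<subseteq> Y" for Z
    using gen_Un_gen[of "insert y J" Z] h that by auto
  have "prime_ideal A (gen_ideal A (gen_ideal A (insert y J) \<union> Z)) \<and>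
      (\<forall>z\<in>Y - Z. z \<notin> gen_ideal A (gen_ideal A (insert y J) \<union> Z))" if Z: "Z \<subseteq> Y" for Z
  proof -
    have "insert y Z \<subseteq> insert y Y" using Z by blast
    then have "prime_ideal A (gen_ideal A (J \<union> insert y Z)) \<and>
      (\<forall>z\<in>insert y Y - insert y Z. z \<notin> gen_ideal A (J \<union> insert y Z))"
      using assms(1) unfolding prime_family_def by blast
    moreover have "Y - Z \<subseteq> insert y Y - insert y Z" using assms(2) by blast
    ultimately show ?thesis unfolding eq[OF Z] by blast
  qed
  then show ?thesis using h unfolding prime_family_def by auto
qed

lemma prime_family_base:
  assumes "prime_family A J Y" shows "prime_ideal A J" "\<And>y. y \<in> Y \<Longrightarrow> y \<notin> J" "ideal A J"
proof -
  have J: "ideal A J" using assms by (simp add: prime_family_def)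
  then show "ideal A J" .
  have "gen_ideal A (J \<union> {}) = J" using J by simp
  then show "prime_ideal A J" "\<And>y. y \<in> Y \<Longrightarrow> y \<notin> J"
    using assms unfolding prime_family_def by (metis Diff_empty empty_subsetI)+
qed

lemma order_filt_ideal: "Y \<subseteq> A \<Longrightarrow> ideal A J \<Longrightarrow> ideal A (order_filt A J Y n)"
  by (simp add: order_filt_def)

lemma order_filt_0: "Y \<subseteq> A \<Longrightarrow> ideal A J \<Longrightarrow> order_filt A J Y 0 = A"
  using ideal_sum_least[of A A J] ideal_sum_upper(1)[of A J] ideal_subset[of A J]
  by (auto simp: order_filt_def)

lemma order_filt_1: "Y \<subseteq> A \<Longrightarrow> ideal A J \<Longrightarrow> order_filt A J Y (Suc 0) = gen_ideal A (J \<union> Y)"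
  using gen_Un[of J Y] ideal_subset[of A J]
  by (auto simp: order_filt_def ideal_sum_def add.commute) (metis add.commute)+

lemma order_filt_antimono:
  "Y \<subseteq> A \<Longrightarrow> m \<le> n \<Longrightarrow> order_filt A J Y n \<subseteq> order_filt A J Y m"
  unfolding order_filt_def by (intro ideal_sum_mono ideal_pow_antimono) auto

lemma order_filt_mult:
  assumes Y: "Y \<subseteq> A" and J: "ideal A J" and a: "a \<in> order_filt A J Y m" and b: "b \<in> order_filt A J Y n"
  shows "a * b \<in> order_filt A J Y (m + n)"
proof -
  obtain a1 a2 where a': "a1 \<in> ideal_pow A (gen_ideal A Y) m" "a2 \<in> J" "a = a1 + a2"
    using a unfolding order_filt_def by (rule ideal_sumE)
  obtain b1 b2 where b': "b1 \<in> ideal_pow A (gen_ideal A Y) n" "b2 \<in> J" "b = b1 + b2"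
    using b unfolding order_filt_def by (rule ideal_sumE)
  have A: "a1 \<in> A" "b1 \<in> A" "a2 \<in> A" "b2 \<in> A"
    using a' b' Y J ideal_closed ideal_pow_ideal ideal_gen by meson+
  have "a * b = a1 * b1 + (a1 * b2 + a2 * (b1 + b2))" using a' b' by (simp add: algebra_simps)
  moreover have "a1 * b1 \<in> ideal_pow A (gen_ideal A Y) (m + n)"
    using a' b' Y by (intro ideal_pow_mult) auto
  moreover have "a1 * b2 + a2 * (b1 + b2) \<in> J" using a' b' A J by simp
  ultimately show ?thesis unfolding order_filt_def by (auto intro: ideal_sumI)
qed

lemma order_filt_exact:
  assumes "Y \<subseteq> A" "ideal A J" "a \<in> A" "a \<notin> order_filt A J Y n"
  obtains k where "k < n" "a \<in> order_filt A J Y k" "a \<notin> order_filt A J Y (Suc k)"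
proof -
  have "\<exists>k<n. a \<in> order_filt A J Y k \<and> a \<notin> order_filt A J Y (Suc k)"
    using assms(4)
  proof (induction n)
    case 0 then show ?case using assms order_filt_0 by auto
  next
    case (Suc n) then show ?case by (cases "a \<in> order_filt A J Y n") (auto simp: less_Suc_eq)
  qed
  then show ?thesis using that by blast
qed

text \<open>Sorts the binomial expansion by divisibility by \<open>y\<close>, so that
  \<open>y\<close> can later be cancelled inside the filtration.\<close>

lemma ideal_pow_insert_split:
  assumes I: "ideal A I" and y: "y \<in> A"
  shows "ideal_pow A (gen_ideal A (insert y I)) (Suc n)
    \<subseteq> ideal_sum (ideal_pow A I (Suc n)) ((*) y ` ideal_pow A (gen_ideal A (insert y I)) n)"
proof (induction n)
  have GA: "insert y I \<subseteq> A" using y ideal_subset[OF I] by auto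
  let ?G = "gen_ideal A (insert y I)"
  {
    case 0
    show ?case
    proof
      fix a assume "a \<in> ideal_pow A ?G (Suc 0)"
      then have "a \<in> ?G" using GA by simp
      then obtain s b where "s \<in> A" "b \<in> I" "a = y * s + b" by (rule gen_insertE_ideal[OF _ y I])
      then show "a \<in> ideal_sum (ideal_pow A I (Suc 0)) ((*) y ` ideal_pow A ?G 0)"
        using ideal_sumI[of b I "y * s"] I by (auto simp: add.commute)
    qed
  next
    case (Suc n)
    have pG: "ideal A (ideal_pow A ?G k)" for k using GA by simp
    show ?case unfolding ideal_pow_Suc[of A ?G "Suc n"]
    proof (rule ideal_prod_least)
      show "ideal A (ideal_sum (ideal_pow A I (Suc (Suc n))) ((*) y ` ideal_pow A ?G (Suc n)))"
        using I pG y by (intro ideal_ideal_sum ideal_scale) auto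
      fix a b assume a: "a \<in> ideal_pow A ?G (Suc n)" and b: "b \<in> ?G"
      obtain s h where s: "s \<in> A" "h \<in> I" "b = y * s + h" using b by (rule gen_insertE_ideal[OF _ y I])
      have "a \<in> ideal_sum (ideal_pow A I (Suc n)) ((*) y ` ideal_pow A ?G n)" using Suc a by blast
      then obtain c d where c: "c \<in> ideal_pow A I (Suc n)" "d \<in> ideal_pow A ?G n" "a = c + y * d"
        by (elim ideal_sumE) auto
      have "h \<in> ?G" using s gen_incl[of h "insert y I"] by auto
      then have "d * h \<in> ideal_pow A ?G (Suc n)" unfolding ideal_pow_Suc using c by (intro ideal_prodI)
      then have "a * s + d * h \<in> ideal_pow A ?G (Suc n)" using a s pG by simp
      moreover have "c * h \<in> ideal_pow A I (Suc (Suc n))"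
        unfolding ideal_pow_Suc[of A I "Suc n"] using c s by (intro ideal_prodI)
      moreover have "a * b = c * h + y * (a * s + d * h)" using s(3) c(3) by (simp add: algebra_simps)
      ultimately show "a * b \<in> ideal_sum (ideal_pow A I (Suc (Suc n))) ((*) y ` ideal_pow A ?G (Suc n))"
        by (auto intro: ideal_sumI)
    qed
  }
qed

lemma gen_insert_gen: "y \<in> A \<Longrightarrow> Y \<subseteq> A \<Longrightarrow> gen_ideal A (insert y (gen_ideal A Y)) = gen_ideal A (insert y Y)"
  using gen_Un_gen[of Y "{y}"] by simp

lemma order_filt_insert_split:
  assumes "y \<in> A" "Y \<subseteq> A" "ideal A J" "a \<in> order_filt A J (insert y Y) (Suc n)"
  obtains c r where "c \<in> order_filt A J Y (Suc n)" "r \<in> ideal_pow A (gen_ideal A (insert y Y)) n" "a = c + y * r"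
proof -
  obtain b j where b: "b \<in> ideal_pow A (gen_ideal A (insert y Y)) (Suc n)" "j \<in> J" "a = b + j"
    using assms(4) unfolding order_filt_def by (rule ideal_sumE)
  have "b \<in> ideal_sum (ideal_pow A (gen_ideal A Y) (Suc n)) ((*) y ` ideal_pow A (gen_ideal A (insert y Y)) n)"
    using ideal_pow_insert_split[of "gen_ideal A Y" y n] b(1) assms by (auto simp: gen_insert_gen)
  then obtain c r where c: "c \<in> ideal_pow A (gen_ideal A Y) (Suc n)"
    "r \<in> ideal_pow A (gen_ideal A (insert y Y)) n" "b = c + y * r"
    by (elim ideal_sumE) auto
  have "c + j \<in> order_filt A J Y (Suc n)" unfolding order_filt_def using c b by (intro ideal_sumI)
  then show ?thesis using that[of "c + j" r] c b by (simp add: algebra_simps)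
qed

lemma order_filt_set_mono: "Y \<subseteq> Y' \<Longrightarrow> order_filt A J Y n \<subseteq> order_filt A J Y' n"
  unfolding order_filt_def by (intro ideal_sum_mono ideal_pow_mono gen_mono) auto

lemma order_filt_insert_base:
  assumes "y \<in> A" "Y \<subseteq> A" "ideal A J"
  shows "order_filt A J (insert y Y) n \<subseteq> order_filt A (gen_ideal A (insert y J)) Y n"
proof (cases n)
  case 0
  have "insert y J \<subseteq> A" using assms ideal_subset by auto
  then show ?thesis using assms by (simp add: 0 order_filt_0)
next
  case (Suc k)
  have JA: "insert y J \<subseteq> A" using assms ideal_subset by auto
  show ?thesis
  proof
    fix a assume "a \<in> order_filt A J (insert y Y) n"
    then obtain c r where c: "c \<in> order_filt A J Y (Suc k)" "r \<in> ideal_pow A (gen_ideal A (insert y Y)) k" "a = c + y * r"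
      using order_filt_insert_split[OF assms] Suc by metis
    have i: "ideal A (order_filt A (gen_ideal A (insert y J)) Y n)" using assms JA by (intro order_filt_ideal) auto
    have "J \<subseteq> gen_ideal A (insert y J)" using gen_subset[of "insert y J"] by auto
    then have "c \<in> order_filt A (gen_ideal A (insert y J)) Y n"
      using c(1) Suc ideal_sum_mono[of _ _ J] unfolding order_filt_def by blast
    moreover have "y \<in> order_filt A (gen_ideal A (insert y J)) Y n"
      unfolding order_filt_def using assms JA gen_incl[of y "insert y J"]
      by (intro subsetD[OF ideal_sum_upper(2)]) auto
    moreover have "r \<in> A" using c assms ideal_closed[OF ideal_pow_ideal[OF ideal_gen, of "insert y Y" k]] by auto
    ultimately show "a \<in> order_filt A (gen_ideal A (insert y J)) Y n" using i c(3) by simp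
  qed
qed

text \<open>The associated graded ring of the filtration is a domain.\<close>

lemma order_filt_domain:
  assumes "prime_family A J Y"
    and "a \<in> order_filt A J Y p" "a \<notin> order_filt A J Y (Suc p)"
    and "b \<in> order_filt A J Y q" "b \<notin> order_filt A J Y (Suc q)"
  shows "a * b \<notin> order_filt A J Y (Suc (p + q))"
proof -
  have "finite Y" using assms(1) by (simp add: prime_family_def)
  then show ?thesis using assms
  proof (induction Y arbitrary: J a b p q rule: finite_induct)
    case empty
    have J: "ideal A J" "prime_ideal A J" using empty.prems(1) prime_family_base by blast+
    have 0: "order_filt A J {} (Suc n) = J" for n
    proof -
      have "ideal_pow A {0} (Suc n) \<subseteq> {0}" using ideal_pow_antimono[of "{0}" "Suc 0" "Suc n"] by simp
      then have "ideal_pow A {0} (Suc n) = {0}" using ideal_zero[of "ideal_pow A {0} (Suc n)"] by auto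
      then show ?thesis by (auto simp: order_filt_def ideal_sum_def)
    qed
    have "a \<in> A" "b \<in> A" using empty.prems(2,4) order_filt_ideal[OF empty_subsetI J(1)] ideal_closed by blast+
    then show ?case using empty.prems prime_ideal_mult[OF J(2)] unfolding 0 by blast
  next
    case (insert y Y)
    note pf = insert.prems(1)
    have h: "Y \<subseteq> A" "y \<in> A" "insert y Y \<subseteq> A" using pf by (auto simp: prime_family_def)
    have J: "ideal A J" "prime_ideal A J" using pf prime_family_base by blast+
    have pf1: "prime_family A J Y" using prime_family_mono[OF pf] by blast
    have pf2: "prime_family A (gen_ideal A (insert y J)) Y" by (rule prime_family_insert[OF pf insert.hyps(2)])
    have y1: "y \<notin> gen_ideal A (J \<union> Y)" using pf insert.hyps(2) unfolding prime_family_def by blast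
    let ?F = "order_filt A J (insert y Y)" and ?F1 = "order_filt A J Y"
      and ?F2 = "order_filt A (gen_ideal A (insert y J)) Y"
    have iF: "ideal A (?F n)" for n by (rule order_filt_ideal[OF h(3) J(1)])
    \<comment> \<open>Multiplication by the parameter \<open>y\<close> raises the order by exactly
      one. In the filtration of the smaller set \<open>Y\<close> the element \<open>y\<close> has
      order zero, so the induction hypothesis applies to \<open>y * (c - r)\<close>.\<close>
    have cancel: "c \<in> ?F n" if yc: "y * c \<in> ?F (Suc n)" and c: "c \<in> A" for c n
    proof -
      obtain d r where d: "d \<in> ?F1 (Suc n)" "r \<in> ideal_pow A (gen_ideal A (insert y Y)) n" "y * c = d + y * r"
        by (rule order_filt_insert_split[OF h(2,1) J(1) yc])
      have rA: "r \<in> A" using d h ideal_closed[OF ideal_pow_ideal[OF ideal_gen, of "insert y Y" n]] by auto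
      have "y * (c - r) \<in> ?F1 (Suc n)" using d by (simp add: algebra_simps)
      have "c - r \<in> ?F1 (Suc n)"
      proof (rule ccontr)
        assume "c - r \<notin> ?F1 (Suc n)"
        then obtain k where k: "k < Suc n" "c - r \<in> ?F1 k" "c - r \<notin> ?F1 (Suc k)"
          using order_filt_exact[OF h(1) J(1), of "c - r" "Suc n"] c rA by auto
        have "y * (c - r) \<notin> ?F1 (Suc (0 + k))"
          using k h y1 order_filt_0[OF h(1) J(1)] order_filt_1[OF h(1) J(1)]
          by (intro insert.IH[OF pf1]) auto
        then show False using \<open>y * (c - r) \<in> ?F1 (Suc n)\<close> order_filt_antimono[OF h(1), of "Suc k" "Suc n" J] k by auto
      qed
      then have "c - r \<in> ?F n"
        using order_filt_antimono[OF h(1), of n "Suc n" J] order_filt_set_mono[of Y "insert y Y" J n] by auto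
      moreover have "r \<in> ?F n" unfolding order_filt_def
        using d(2) h J by (intro subsetD[OF ideal_sum_upper(1)]) auto
      ultimately have "(c - r) + r \<in> ?F n" using iF by (intro ideal_add) auto
      then show ?thesis by simp
    qed
    \<comment> \<open>If the initial form of \<open>a\<close> vanishes modulo \<open>y\<close>, it
      is \<open>y\<close> times the initial form of some \<open>c\<close> of order one less, and a
      vanishing product with \<open>b\<close> is inherited by \<open>c\<close>.\<close>
    have reduce: "\<exists>c p'. p = Suc p' \<and> c \<in> ?F p' \<and> c \<notin> ?F p \<and> (b \<in> ?F q \<longrightarrow> a * b \<in> ?F (Suc (p + q)) \<longrightarrow> c * b \<in> ?F (p + q))"
      if a: "a \<in> ?F p" "a \<notin> ?F (Suc p)" and a2: "a \<in> ?F2 (Suc p)" for a b p q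
    proof -
      obtain e f where ef: "e \<in> ideal_pow A (gen_ideal A Y) (Suc p)" "f \<in> gen_ideal A (insert y J)" "a = e + f"
        using a2 unfolding order_filt_def by (rule ideal_sumE)
      obtain c j where c: "c \<in> A" "j \<in> J" "f = y * c + j" using gen_insertE_ideal[OF ef(2) h(2) J(1)] by metis
      define a' where "a' = e + j"
      have "a' \<in> ?F1 (Suc p)" unfolding a'_def order_filt_def using ef c by (intro ideal_sumI)
      then have a': "a' \<in> ?F (Suc p)" using order_filt_set_mono[of Y "insert y Y" J "Suc p"] by auto
      have eq: "a = y * c + a'" using ef c by (simp add: a'_def)
      have yF: "y \<in> ?F (Suc 0)" using order_filt_1[OF h(3) J(1)] gen_incl[of y "J \<union> insert y Y"] by auto
      have yc: "y * c \<notin> ?F (Suc p)" using a(2) a' eq iF by auto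
      have "y * c \<in> ?F (Suc 0)" using yF c iF by simp
      then obtain p' where p': "p = Suc p'" using yc by (cases p) auto
      have "a' \<in> ?F p" using a' order_filt_antimono[OF h(3), of p "Suc p" J] by auto
      then have "y * c \<in> ?F p" using ideal_diff[OF iF a(1), of a'] eq by simp
      then have 1: "c \<in> ?F p'" using cancel c p' by blast
      have 2: "c \<notin> ?F p" using order_filt_mult[OF h(3) J(1) yF, of c p] yc by auto
      have 3: "c * b \<in> ?F (p + q)" if b: "b \<in> ?F q" and ab: "a * b \<in> ?F (Suc (p + q))"
      proof -
        have "a' * b \<in> ?F (Suc (p + q))" using order_filt_mult[OF h(3) J(1) a' b] by simp
        then have "a * b - a' * b \<in> ?F (Suc (p + q))" using ab iF by simp
        moreover have "a * b - a' * b = y * (c * b)" using eq by (simp add: algebra_simps)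
        ultimately show ?thesis using cancel[of "c * b"] c ideal_closed[OF iF b] by simp
      qed
      show ?thesis using p' 1 2 3 by blast
    qed
    \<comment> \<open>Modulo \<open>y\<close> the graded ring is a domain by the induction
      hypothesis, so one of the two initial forms vanishes there. Dividing it by \<open>y\<close>
      lowers \<open>p + q\<close>.\<close>
    show ?case using insert.prems(2-5)
    proof (induction "p + q" arbitrary: a b p q rule: less_induct)
      case less
      show ?case
      proof
        assume ab: "a * b \<in> ?F (Suc (p + q))"
        have sub: "?F n \<subseteq> ?F2 n" for n by (rule order_filt_insert_base[OF h(2,1) J(1)])
        have "a \<in> ?F2 (Suc p) \<or> b \<in> ?F2 (Suc q)"
          using insert.IH[OF pf2, of a p b q] sub less.prems ab by blast
        then show False
        proof
          assume "a \<in> ?F2 (Suc p)"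
          from reduce[OF less.prems(1,2) this] obtain c p' where c: "p = Suc p'" "c \<in> ?F p'" "c \<notin> ?F p"
            "c * b \<in> ?F (p + q)" using less.prems(3) ab by metis
          show False using less.hyps[of p' q c b] c less.prems by simp
        next
          assume "b \<in> ?F2 (Suc q)"
          moreover have "b * a \<in> ?F (Suc (q + p))" using ab by (simp add: mult.commute add.commute)
          ultimately obtain c q' where c: "q = Suc q'" "c \<in> ?F q'" "c \<notin> ?F q" "c * a \<in> ?F (q + p)"
            using reduce[OF less.prems(3,4), of a p] less.prems(1) by metis
          show False using less.hyps[of p q' a c] c less.prems by (simp add: mult.commute add.commute)
        qed
      qed
    qed
  qed
qed

text \<open>\<open>z\<close> has order zero in the filtration, so multiplication by it does not
  raise orders.\<close>

lemma order_filt_cancel: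
  assumes pf: "prime_family A J Y" and z: "z \<in> A" "z \<notin> gen_ideal A (J \<union> Y)"
    and a: "a \<in> A" "z * a \<in> order_filt A J Y n"
  shows "a \<in> order_filt A J Y n"
proof (rule ccontr)
  assume n: "a \<notin> order_filt A J Y n"
  have h: "Y \<subseteq> A" "ideal A J" using pf by (auto simp: prime_family_def)
  obtain k where k: "k < n" "a \<in> order_filt A J Y k" "a \<notin> order_filt A J Y (Suc k)"
    by (rule order_filt_exact[OF h a(1) n])
  have "z * a \<notin> order_filt A J Y (Suc (0 + k))"
    using k h z by (intro order_filt_domain[OF pf]) (auto simp: order_filt_0 order_filt_1)
  then show False using a(2) order_filt_antimono[OF h(1), of "Suc k" n J] k by auto
qed

lemma order_filt_zero: "Y \<subseteq> A \<Longrightarrow> order_filt A {0} Y n = ideal_pow A (gen_ideal A Y) n"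
  by (auto simp: order_filt_def ideal_sum_def)

end

section \<open>Complete integral closedness\<close>

context field_subring
begin

lemma cong_mult:
  assumes "ideal A J" "a - b \<in> J" "c - d \<in> J" "b \<in> A" "c \<in> A"
  shows "a * c - b * d \<in> J"
proof -
  have "a * c - b * d = c * (a - b) + b * (c - d)" by (simp add: algebra_simps)
  then show ?thesis using assms by simp
qed

lemma cong_power:
  assumes "ideal A J" "a - b \<in> J" "a \<in> A" "b \<in> A" shows "a ^ n - b ^ n \<in> J"
  using assms by (induction n) (auto intro!: cong_mult)

end

context
  fixes A :: "'a::field set" and J y
  assumes nl: "noeth_local A" and J: "prime_ideal A J" and y: "y \<in> A" "y \<notin> J"
    and J': "prime_ideal A (gen_ideal A (insert y J))"
begin

interpretation noeth_local A by (rule nl)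

lemma cong_cancel_power:
  assumes "y ^ k * a - y ^ k * b \<in> J" "a \<in> A" "b \<in> A" shows "a - b \<in> J"
proof -
  have "y ^ k * (a - b) \<in> J" using assms by (simp add: algebra_simps)
  then show ?thesis using prime_ideal_mult[OF J, of "y ^ k" "a - b"] prime_ideal_power[OF J y(1)] y assms by auto
qed

text \<open>Modulo \<open>J\<close> the element \<open>y\<close> generates a prime ideal that does
  not contain \<open>b\<close>, so the factors \<open>y\<close> of \<open>b * u\<close> must divide
  \<open>u\<close>, one after the other.\<close>

lemma cong_divide_power:
  assumes "b \<in> A" "b \<notin> gen_ideal A (insert y J)" "u \<in> A" "v \<in> A" "b * u - y ^ k * v \<in> J"
  shows "\<exists>w\<in>A. u - y ^ k * w \<in> J"
  using assms(3,5)
proof (induction k arbitrary: u)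
  case 0
  then show ?case using ideal_zero[OF prime_ideal_ideal[OF J]] by (auto intro!: bexI[of _ u])
next
  case (Suc k)
  note iJ = prime_ideal_ideal[OF J] and iJ' = prime_ideal_ideal[OF J']
  have "insert y J \<subseteq> gen_ideal A (insert y J)" by (rule gen_subset)
  then have "y ^ Suc k * v \<in> gen_ideal A (insert y J)" "b * u - y ^ Suc k * v \<in> gen_ideal A (insert y J)"
    using iJ' y assms(4) Suc.prems by (auto simp: mult.assoc)
  then have "(b * u - y ^ Suc k * v) + y ^ Suc k * v \<in> gen_ideal A (insert y J)" using iJ' by (intro ideal_add) auto
  then have "b * u \<in> gen_ideal A (insert y J)" by simp
  then have "u \<in> gen_ideal A (insert y J)" using prime_ideal_mult[OF J' assms(1) Suc.prems(1)] assms(2) by blast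
  then obtain s j where s: "s \<in> A" "j \<in> J" "u = y * s + j" by (rule gen_insertE_ideal[OF _ y(1) iJ])
  have "y ^ 1 * (b * s) - y ^ 1 * (y ^ k * v) = (b * u - y ^ Suc k * v) - b * j"
    using s by (simp add: algebra_simps)
  also have "\<dots> \<in> J" using iJ Suc.prems s assms(1) by simp
  finally have "b * s - y ^ k * v \<in> J" by (rule cong_cancel_power) (use assms s y in auto)
  then obtain w where w: "w \<in> A" "s - y ^ k * w \<in> J" using Suc.IH s by blast
  have "u - y ^ Suc k * w = y * (s - y ^ k * w) + j" using s by (simp add: algebra_simps)
  also have "\<dots> \<in> J" using iJ w s y by simp
  finally show ?case using w by blast
qed

text \<open>Krull's intersection theorem for \<open>J\<close> bounds the power of \<open>y\<close>
  that divides \<open>u\<close> modulo \<open>J\<close>; a maximal one is split off.\<close>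

lemma order_at_param:
  assumes u: "u \<in> A" "u \<notin> J" and yM: "y \<in> max_ideal A"
  obtains k w where "w \<in> A" "w \<notin> gen_ideal A (insert y J)" "u - y ^ k * w \<in> J"
proof -
  note iJ = prime_ideal_ideal[OF J]
  have "\<exists>k. \<not> (\<exists>w\<in>A. u - y ^ k * w \<in> J)"
  proof (rule ccontr)
    assume "\<not> ?thesis"
    then have all: "\<exists>w\<in>A. u - y ^ k * w \<in> J" for k by blast
    have "u \<in> ideal_sum J (ideal_pow A (max_ideal A) k)" for k
    proof -
      obtain w where w: "w \<in> A" "u - y ^ k * w \<in> J" using all by blast
      have "y ^ k * w \<in> ideal_pow A (max_ideal A) k" using ideal_pow_power[OF max_ideal yM] w by simp
      then show ?thesis using ideal_sumI[OF w(2)] by force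
    qed
    then show False using krull_intersection[OF iJ] u by blast
  qed
  then obtain k where k: "\<not> (\<exists>w\<in>A. u - y ^ k * w \<in> J)" "\<And>i. i < k \<Longrightarrow> \<exists>w\<in>A. u - y ^ i * w \<in> J"
    using exists_least_iff[of "\<lambda>k. \<not> (\<exists>w\<in>A. u - y ^ k * w \<in> J)"] by blast
  have "k \<noteq> 0"
  proof
    assume "k = 0"
    then have "u - y ^ k * u \<in> J" using iJ by simp
    then show False using k(1) u by blast
  qed
  then obtain i where i: "k = Suc i" by (cases k) auto
  obtain w where w: "w \<in> A" "u - y ^ i * w \<in> J" using k(2)[of i] i by auto
  have "w \<notin> gen_ideal A (insert y J)"
  proof
    assume "w \<in> gen_ideal A (insert y J)"
    then obtain s j where s: "s \<in> A" "j \<in> J" "w = y * s + j" by (rule gen_insertE_ideal[OF _ y(1) iJ])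
    have "u - y ^ k * s = (u - y ^ i * w) + y ^ i * j" using s i by (simp add: algebra_simps)
    also have "\<dots> \<in> J" using iJ w s y by simp
    finally show False using k(1) s by blast
  qed
  then show ?thesis using that w by blast
qed

text \<open>If the quotient by the parameter \<open>y\<close> is completely integrally closed, then so is the ring: modulo
  \<open>y\<close> the fraction \<open>a/b\<close> is represented by some \<open>c\<close>, and \<open>(a - bc)/y\<close> satisfies the same hypothesis.\<close>

lemma cic_step:
  assumes yM: "y \<in> max_ideal A"
    and IH: "\<And>a b d. a \<in> A \<Longrightarrow> b \<in> A \<Longrightarrow> d \<in> A \<Longrightarrow> b \<notin> gen_ideal A (insert y J) \<Longrightarrow> d \<notin> gen_ideal A (insert y J) \<Longrightarrow>
      (\<And>n. \<exists>c\<in>A. d * a ^ n - b ^ n * c \<in> gen_ideal A (insert y J)) \<Longrightarrow> \<exists>c\<in>A. a - b * c \<in> gen_ideal A (insert y J)"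
    and a: "a \<in> A" and b: "b \<in> A" "b \<notin> J" and d: "d \<in> A" "d \<notin> J"
    and int: "\<And>n. \<exists>c\<in>A. d * a ^ n - b ^ n * c \<in> J"
  shows "\<exists>c\<in>A. a - b * c \<in> J"
proof -
  note iJ = prime_ideal_ideal[OF J] and iJ' = prime_ideal_ideal[OF J']
  let ?J' = "gen_ideal A (insert y J)"
  have JJ': "J \<subseteq> ?J'" and yJ': "y \<in> ?J'" using gen_subset[of "insert y J"] by auto
  have JA: "z \<in> A" if "z \<in> J" for z using that ideal_closed[OF iJ] by blast
  obtain l d' where d': "d' \<in> A" "d' \<notin> ?J'" "d - y ^ l * d' \<in> J" by (rule order_at_param[OF d yM])
  \<comment> \<open>The case where \<open>y\<close> does not divide \<open>b\<close>. First the
    power of \<open>y\<close> in \<open>d\<close> is removed; then \<open>a\<close> is approximated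
    modulo \<open>b\<close> up to ever higher powers of \<open>y\<close>, and Krull's intersection
    theorem concludes.\<close>
  have A: "\<exists>c\<in>A. a - b * c \<in> J"
    if a: "a \<in> A" and b: "b \<in> A" "b \<notin> ?J'" and int: "\<And>n. \<exists>c\<in>A. d * a ^ n - b ^ n * c \<in> J" for a b
  proof -
    have bn: "b ^ n \<notin> ?J'" for n using prime_ideal_power[OF J' b(1)] b(2) by blast
    have int': "\<exists>c\<in>A. d' * a ^ n - b ^ n * c \<in> J" for n
    proof -
      obtain c where c: "c \<in> A" "d * a ^ n - b ^ n * c \<in> J" using int by blast
      have "b ^ n * c - y ^ l * (d' * a ^ n) = (d - y ^ l * d') * a ^ n - (d * a ^ n - b ^ n * c)"
        by (simp add: algebra_simps)
      also have "\<dots> \<in> J" using iJ c d' a by simp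
      finally have e: "b ^ n * c - y ^ l * (d' * a ^ n) \<in> J" .
      obtain w where w: "w \<in> A" "c - y ^ l * w \<in> J"
        using cong_divide_power[OF _ bn[of n] c(1) _ e] b d' a by auto
      have "y ^ l * (d' * a ^ n) - y ^ l * (b ^ n * w) = b ^ n * (c - y ^ l * w) - (b ^ n * c - y ^ l * (d' * a ^ n))"
        by (simp add: algebra_simps)
      also have "\<dots> \<in> J" using iJ w e b by simp
      finally have "d' * a ^ n - b ^ n * w \<in> J" by (rule cong_cancel_power) (use d' a b w in auto)
      then show ?thesis using w by blast
    qed
    have "\<exists>c\<in>A. \<exists>e\<in>A. a - b * c - y ^ k * e \<in> J"
      if "a \<in> A" "\<And>n. \<exists>c\<in>A. d' * a ^ n - b ^ n * c \<in> J" for a k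
      using that
    proof (induction k arbitrary: a)
      case 0 then show ?case using iJ by (intro bexI[of _ 0] bexI[of _ a]) auto
    next
      case (Suc k)
      have "\<exists>c\<in>A. d' * a ^ n - b ^ n * c \<in> ?J'" for n using Suc.prems(2)[of n] JJ' by blast
      then obtain c where c: "c \<in> A" "a - b * c \<in> ?J'" using IH[OF Suc.prems(1) b(1) d'(1) b(2) d'(2)] by blast
      obtain a' j where a': "a' \<in> A" "j \<in> J" "a - b * c = y * a' + j"
        by (rule gen_insertE_ideal[OF c(2) y(1) iJ])
      \<comment> \<open>Each factor \<open>a\<close> or \<open>b * c\<close> in the expansion of the
        power contributes one factor \<open>b\<close>. The exponent \<open>i\<close> of
        \<open>a\<close> is left free so that the recursion on \<open>n\<close> closes.\<close>
      have shift: "\<exists>e\<in>A. d' * a ^ i * (a - b * c) ^ n - b ^ (n + i) * e \<in> J" for n i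
      proof (induction n arbitrary: i)
        case 0 then show ?case using Suc.prems(2)[of i] by simp
      next
        case (Suc n)
        obtain e1 where e1: "e1 \<in> A" "d' * a ^ Suc i * (a - b * c) ^ n - b ^ (n + Suc i) * e1 \<in> J" using Suc by blast
        obtain e2 where e2: "e2 \<in> A" "d' * a ^ i * (a - b * c) ^ n - b ^ (n + i) * e2 \<in> J" using Suc by blast
        have "d' * a ^ i * (a - b * c) ^ Suc n - b ^ (Suc n + i) * (e1 - c * e2) =
            (d' * a ^ Suc i * (a - b * c) ^ n - b ^ (n + Suc i) * e1)
            - (b * c) * (d' * a ^ i * (a - b * c) ^ n - b ^ (n + i) * e2)"
          by (simp add: algebra_simps)
        also have "\<dots> \<in> J" using iJ e1 e2 b c by simp
        finally show ?case using e1 e2 c by (intro bexI[of _ "e1 - c * e2"]) auto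
      qed
      have "\<exists>w\<in>A. d' * a' ^ n - b ^ n * w \<in> J" for n
      proof -
        obtain e where e: "e \<in> A" "d' * (a - b * c) ^ n - b ^ n * e \<in> J" using shift[of 0 n] by auto
        have "a - b * c - y * a' \<in> J" "a - b * c \<in> A" using a' diff_closed[OF Suc.prems(1) mult_closed[OF b(1) c(1)]] by auto
        then have "(a - b * c) ^ n - (y * a') ^ n \<in> J"
          using a'(1) y(1) by (intro cong_power[OF iJ]) auto
        then have 1: "d' * ((a - b * c) ^ n - (y * a') ^ n) \<in> J" using iJ d' by simp
        have "b ^ n * e - y ^ n * (d' * a' ^ n) =
          d' * ((a - b * c) ^ n - (y * a') ^ n) - (d' * (a - b * c) ^ n - b ^ n * e)"
          by (simp add: algebra_simps power_mult_distrib)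
        also have "\<dots> \<in> J" using iJ 1 e by simp
        finally have 2: "b ^ n * e - y ^ n * (d' * a' ^ n) \<in> J" .
        obtain w where w: "w \<in> A" "e - y ^ n * w \<in> J"
          using cong_divide_power[OF _ bn[of n] e(1) _ 2] b d' a' by auto
        have "y ^ n * (d' * a' ^ n) - y ^ n * (b ^ n * w) = b ^ n * (e - y ^ n * w) - (b ^ n * e - y ^ n * (d' * a' ^ n))"
          by (simp add: algebra_simps)
        also have "\<dots> \<in> J" using iJ w 2 b by simp
        finally have "d' * a' ^ n - b ^ n * w \<in> J" by (rule cong_cancel_power) (use d' a' b w in auto)
        then show ?thesis using w by blast
      qed
      then obtain c1 e1 where ce: "c1 \<in> A" "e1 \<in> A" "a' - b * c1 - y ^ k * e1 \<in> J"
        using Suc.IH[OF a'(1)] by blast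
      have "a - b * (c + y * c1) - y ^ Suc k * e1 = y * (a' - b * c1 - y ^ k * e1) + (a - b * c - y * a')"
        by (simp add: algebra_simps)
      also have "\<dots> = y * (a' - b * c1 - y ^ k * e1) + j" using a'(3) by simp
      also have "\<dots> \<in> J" using iJ ce a' y by simp
      finally show ?case using c ce y by (intro bexI[of _ "c + y * c1"] bexI[of _ e1]) auto
    qed
    note approx = this[OF a int']
    have iK: "ideal A (ideal_sum (principal A b) J)" using b iJ by simp
    have "a \<in> ideal_sum (ideal_sum (principal A b) J) (ideal_pow A (max_ideal A) k)" for k
    proof -
      obtain c e where ce: "c \<in> A" "e \<in> A" "a - b * c - y ^ k * e \<in> J" using approx[of k] by blast
      have 1: "y ^ k * e \<in> ideal_pow A (max_ideal A) k" using ideal_pow_power[OF max_ideal yM] ce by simp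
      have 2: "b * c + (a - b * c - y ^ k * e) \<in> ideal_sum (principal A b) J"
        using ce by (intro ideal_sumI principalI)
      show ?thesis using ideal_sumI[OF 2 1] by simp
    qed
    then have "a \<in> ideal_sum (principal A b) J" by (rule krull_intersection[OF iK])
    then obtain u j where "u \<in> principal A b" "j \<in> J" "a = u + j" by (rule ideal_sumE)
    then obtain c where "c \<in> A" "a = b * c + j" by (auto simp: principal_def)
    then show ?thesis using \<open>j \<in> J\<close> by (intro bexI[of _ c]) auto
  qed
  obtain k b' where b': "b' \<in> A" "b' \<notin> ?J'" "b - y ^ k * b' \<in> J" by (rule order_at_param[OF b yM])
  \<comment> \<open>The general denominator \<open>y ^ k * b'\<close>: each factor \<open>y\<close>
    of it is shown to divide \<open>a\<close> as well and is cancelled.\<close>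
  have B: "\<exists>c\<in>A. a - (y ^ k * b') * c \<in> J"
    if "a \<in> A" "\<And>n. \<exists>c\<in>A. d * a ^ n - (y ^ k * b') ^ n * c \<in> J" for a k
    using that
  proof (induction k arbitrary: a)
    case 0 then show ?case using A[of a b'] b' by simp
  next
    case (Suc k)
    \<comment> \<open>The exponent exceeds the order \<open>l\<close> of \<open>d\<close> at
      \<open>y\<close> by one, so that a factor \<open>y\<close> survives after \<open>y ^ l\<close>
      has been cancelled. This factor forces \<open>y\<close> to divide a power of \<open>a\<close>,
      hence \<open>a\<close>.\<close>
    obtain c where c: "c \<in> A" "d * a ^ Suc l - (y ^ Suc k * b') ^ Suc l * c \<in> J" using Suc.prems(2) by blast
    let ?e = "y * (y ^ k * b') ^ Suc l * c"
    have eA: "?e \<in> A" using y b' c by simp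
    have "y ^ l * (d' * a ^ Suc l) - y ^ l * ?e =
        (d * a ^ Suc l - (y ^ Suc k * b') ^ Suc l * c) - a ^ Suc l * (d - y ^ l * d')"
      by (simp add: algebra_simps power_mult_distrib)
    also have "\<dots> \<in> J"
      using c(2) ideal_mult[OF iJ power_closed[OF Suc.prems(1), of "Suc l"] d'(3)] by (rule ideal_diff[OF iJ])
    finally have "d' * a ^ Suc l - ?e \<in> J" by (rule cong_cancel_power) (use d' Suc.prems eA in auto)
    moreover have "?e \<in> ?J'" using yJ' iJ' y b' c by (simp add: mult.assoc)
    ultimately have "(d' * a ^ Suc l - ?e) + ?e \<in> ?J'" using JJ' iJ' by (intro ideal_add) auto
    then have "d' * a ^ Suc l \<in> ?J'" by simp
    then have "a ^ Suc l \<in> ?J'" using prime_ideal_mult[OF J' d'(1)] d'(2) Suc.prems(1) power_closed by blast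
    then have "a \<in> ?J'" using prime_ideal_power[OF J' Suc.prems(1)] by blast
    then obtain a1 j where a1: "a1 \<in> A" "j \<in> J" "a = y * a1 + j" by (rule gen_insertE_ideal[OF _ y(1) iJ])
    have "\<exists>c\<in>A. d * a1 ^ n - (y ^ k * b') ^ n * c \<in> J" for n
    proof -
      obtain c where c: "c \<in> A" "d * a ^ n - (y ^ Suc k * b') ^ n * c \<in> J" using Suc.prems(2) by blast
      have "a ^ n - (y * a1) ^ n \<in> J" using a1 Suc.prems(1) y by (intro cong_power[OF iJ]) auto
      then have 1: "d * (a ^ n - (y * a1) ^ n) \<in> J" using iJ d by simp
      have "y ^ n * (d * a1 ^ n) - y ^ n * ((y ^ k * b') ^ n * c) =
          (d * a ^ n - (y ^ Suc k * b') ^ n * c) - d * (a ^ n - (y * a1) ^ n)"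
        by (simp add: algebra_simps power_mult_distrib)
      also have "\<dots> \<in> J" using iJ 1 c by simp
      finally have "d * a1 ^ n - (y ^ k * b') ^ n * c \<in> J"
        by (rule cong_cancel_power) (use d a1 y b' c in auto)
      then show ?thesis using c by blast
    qed
    then obtain c where c: "c \<in> A" "a1 - (y ^ k * b') * c \<in> J" using Suc.IH[OF a1(1)] by blast
    have "a - (y ^ Suc k * b') * c = y * (a1 - (y ^ k * b') * c) + j" using a1 by (simp add: algebra_simps)
    also have "\<dots> \<in> J" using iJ c a1 y by simp
    finally show ?case using c by blast
  qed
  have bA: "y ^ k * b' \<in> A" using b' y by simp
  have "\<exists>c\<in>A. d * a ^ n - (y ^ k * b') ^ n * c \<in> J" for n
  proof -
    obtain c where c: "c \<in> A" "d * a ^ n - b ^ n * c \<in> J" using int by blast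
    have "b ^ n - (y ^ k * b') ^ n \<in> J" using b' b bA by (intro cong_power[OF iJ]) auto
    then have "c * (b ^ n - (y ^ k * b') ^ n) \<in> J" using iJ c by simp
    then have "(d * a ^ n - b ^ n * c) + c * (b ^ n - (y ^ k * b') ^ n) \<in> J" using iJ c by (intro ideal_add) auto
    then show ?thesis using c by (intro bexI[of _ c]) (auto simp: algebra_simps)
  qed
  then obtain c where c: "c \<in> A" "a - (y ^ k * b') * c \<in> J" using B[OF a] by blast
  have "a - b * c = (a - (y ^ k * b') * c) - c * (b - y ^ k * b')" by (simp add: algebra_simps)
  also have "\<dots> \<in> J" using iJ c b' by simp
  finally show ?thesis using c by blast
qed

end

context noeth_local
begin

text \<open>The last hypothesis says that a/b is almost integral over A/J with common denominator
  \<open>d\<close>. With no parameters left A/J is a field; each parameter is handled by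
  \<open>cic_step\<close>.\<close>

lemma cic_mod:
  assumes "prime_family A J Y" "max_ideal A = gen_ideal A (J \<union> Y)"
    and "a \<in> A" "b \<in> A" "d \<in> A" "b \<notin> J" "d \<notin> J" "\<And>n. \<exists>c\<in>A. d * a ^ n - b ^ n * c \<in> J"
  shows "\<exists>c\<in>A. a - b * c \<in> J"
proof -
  have "finite Y" using assms(1) by (simp add: prime_family_def)
  then show ?thesis using assms
  proof (induction Y arbitrary: J a b d rule: finite_induct)
    case empty
    have J: "ideal A J" using prime_family_base[OF empty.prems(1)] by blast
    then have "b \<notin> max_ideal A" using empty.prems by simp
    then have "b \<noteq> 0" "inverse b \<in> A" using not_max_unit empty.prems by auto
    then show ?case using J empty.prems(3) by (intro bexI[of _ "inverse b * a"]) (auto simp flip: mult.assoc)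
  next
    case (insert y Y)
    note pf = insert.prems(1)
    have J: "ideal A J" "prime_ideal A J" "y \<notin> J" using prime_family_base[OF pf] by auto
    have JA: "J \<subseteq> A" and yA: "y \<in> A" and YA: "Y \<subseteq> A" using ideal_subset[OF J(1)] pf by (auto simp: prime_family_def)
    have pf': "prime_family A (gen_ideal A (insert y J)) Y" by (rule prime_family_insert[OF pf insert.hyps(2)])
    have J': "prime_ideal A (gen_ideal A (insert y J))" using prime_family_base[OF pf'] by blast
    have m: "max_ideal A = gen_ideal A (gen_ideal A (insert y J) \<union> Y)"
      using gen_Un_gen[of "insert y J" Y] JA yA YA insert.prems(2) by simp
    have yM: "y \<in> max_ideal A" using gen_incl[of y "J \<union> insert y Y"] insert.prems(2) by simp
    show ?case
    proof (rule cic_step[OF noeth_local_axioms J(2) yA J(3) J' yM])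
      show "\<exists>c\<in>A. a - b * c \<in> gen_ideal A (insert y J)"
        if "a \<in> A" "b \<in> A" "d \<in> A" "b \<notin> gen_ideal A (insert y J)" "d \<notin> gen_ideal A (insert y J)"
          "\<And>n. \<exists>c\<in>A. d * a ^ n - b ^ n * c \<in> gen_ideal A (insert y J)" for a b d
        by (rule insert.IH[OF pf' m that])
    qed (fact insert.prems)+
  qed
qed

end

section \<open>Discrete valuation rings\<close>

text \<open>Every nonzero element is a unit times a power of \<open>p\<close>. Separatedness of the
  powers of \<open>p\<close> is assumed in place of the Noetherian property, so that the criterion
  also applies to the union \<open>S\<close>, where being archimedean supplies it.\<close>

lemma DVR_of_principal_max:
  assumes "local_ring A" and quot: "\<And>q. \<exists>a\<in>A. \<exists>b\<in>A. b \<noteq> 0 \<and> q = a / b"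
    and p: "p \<in> A" "p \<noteq> 0" "max_ideal A = principal A p"
    and inter: "\<And>a. a \<in> A \<Longrightarrow> (\<And>n. a \<in> principal A (p ^ n)) \<Longrightarrow> a = 0"
  shows "DVR A"
proof -
  interpret local_domain A using assms(1) by unfold_locales (auto simp: local_ring_def)
  have fac: "\<exists>u n. u \<in> A \<and> u \<noteq> 0 \<and> inverse u \<in> A \<and> a = u * p ^ n" if a: "a \<in> A" "a \<noteq> 0" for a
  proof -
    have "\<exists>n. a \<notin> principal A (p ^ n)" using inter a by blast
    then obtain n where n: "a \<notin> principal A (p ^ n)" "\<And>i. i < n \<Longrightarrow> a \<in> principal A (p ^ i)"
      using exists_least_iff[of "\<lambda>n. a \<notin> principal A (p ^ n)"] by blast
    have "n \<noteq> 0" using n(1) a principalI[of a 1] by (cases "n = 0") auto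
    then obtain i where i: "n = Suc i" by (cases n) auto
    then obtain u where u: "u \<in> A" "a = p ^ i * u" using n(2)[of i] by (auto simp: principal_def)
    have "u \<notin> max_ideal A"
    proof
      assume "u \<in> max_ideal A"
      then obtain v where "v \<in> A" "u = p * v" using p(3) by (auto simp: principal_def)
      then show False using n(1) u i principalI[of v "p ^ n"] by (simp add: mult_ac)
    qed
    then show ?thesis using u not_max_unit by (auto simp: mult.commute)
  qed
  have "q \<in> A \<or> inverse q \<in> A" if q0: "q \<noteq> 0" for q
  proof -
    obtain a b where ab: "a \<in> A" "b \<in> A" "b \<noteq> 0" "q = a / b" using quot by blast
    obtain u n where u: "u \<in> A" "u \<noteq> 0" "inverse u \<in> A" "a = u * p ^ n" using fac[of a] ab q0 by auto
    obtain v m where v: "v \<in> A" "v \<noteq> 0" "inverse v \<in> A" "b = v * p ^ m" using fac[of b] ab by auto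
    show ?thesis
    proof (cases "m \<le> n")
      case True
      then have "q = u * inverse v * p ^ (n - m)"
        unfolding ab(4) u(4) v(4) using u v p by (simp add: power_diff field_simps)
      then show ?thesis using u v p by simp
    next
      case False
      then have "inverse q = v * inverse u * p ^ (m - n)"
        unfolding ab(4) u(4) v(4) using u v p by (simp add: power_diff field_simps)
      then show ?thesis using u v p by simp
    qed
  qed
  then have "valuation_ring A" using subring by (simp add: valuation_ring_def)
  moreover have "noetherian A" unfolding noetherian_def
  proof (intro conjI allI impI)
    fix I assume I: "ideal A I"
    show "\<exists>X. finite X \<and> X \<subseteq> A \<and> I = gen_ideal A X"
    proof (cases "I = {0}")
      case True then show ?thesis by (intro exI[of _ "{}"]) auto
    next
      case False
      then obtain a where a: "a \<in> I" "a \<noteq> 0" using ideal_zero[OF I] by blast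
      have pw: "p ^ n \<in> I" if "u * p ^ n \<in> I" "u \<noteq> 0" "inverse u \<in> A" for u n
        using ideal_mult[OF I that(3,1)] that(2) by (simp flip: mult.assoc)
      have "\<exists>n. p ^ n \<in> I" using fac[of a] a ideal_closed[OF I] pw by metis
      then obtain n where n: "p ^ n \<in> I" "\<And>i. i < n \<Longrightarrow> p ^ i \<notin> I"
        using exists_least_iff[of "\<lambda>n. p ^ n \<in> I"] by blast
      have "I \<subseteq> gen_ideal A {p ^ n}"
      proof
        fix b assume b: "b \<in> I"
        show "b \<in> gen_ideal A {p ^ n}"
        proof (cases "b = 0")
          case True then show ?thesis using p by simp
        next
          case False
          obtain u m where u: "u \<in> A" "u \<noteq> 0" "inverse u \<in> A" "b = u * p ^ m"
            using fac[of b] b ideal_closed[OF I] False by blast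
          then have "n \<le> m" using pw[of u m] b n(2)[of m] by (meson not_le)
          then have "b = p ^ n * (u * p ^ (m - n))" using u by (simp add: power_add[symmetric] mult.left_commute)
          then show ?thesis
            unfolding gen_singleton[OF power_closed[OF p(1)]] using u p by (metis principalI mult_closed power_closed)
        qed
      qed
      moreover have "gen_ideal A {p ^ n} \<subseteq> I" using n by (intro gen_least[OF I]) auto
      ultimately show ?thesis using p by (intro exI[of _ "{p ^ n}"]) auto
    qed
  qed (rule subring)
  moreover have "max_ideal A \<noteq> {0}" using p principalI[of 1 p] by auto
  ultimately show ?thesis by (simp add: DVR_def)
qed

text \<open>Equality of the dimension with the number of generators is recorded as a concrete chain
  of primes of that length, the form in which the chain arguments consume it.\<close>

locale regular_ring = noeth_local +
  assumes params: "\<exists>Y c. finite Y \<and> Y \<subseteq> A \<and> gen_ideal A Y = max_ideal A \<and> prime_chain A c (card Y)"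
    and quotients: "\<And>q. \<exists>a\<in>A. \<exists>b\<in>A. b \<noteq> 0 \<and> q = a / b"
begin

lemma completely_integrally_closed:
  assumes d: "d \<in> A" "d \<noteq> 0" and int: "\<And>n. d * t ^ n \<in> A"
  shows "t \<in> A"
proof -
  obtain Y where Y: "Y \<subseteq> A" "gen_ideal A Y = max_ideal A" "prime_family A {0} Y"
    using params prime_family_of_dim by blast
  obtain a b where ab: "a \<in> A" "b \<in> A" "b \<noteq> 0" "t = a / b" using quotients by blast
  have int': "\<exists>c\<in>A. d * a ^ n - b ^ n * c \<in> {0}" for n
  proof (intro bexI)
    have "b ^ n * t ^ n = a ^ n" using ab by (simp add: power_divide)
    then show "d * a ^ n - b ^ n * (d * t ^ n) \<in> {0}" by (simp add: mult.left_commute)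
  qed (rule int)
  have m: "max_ideal A = gen_ideal A ({0} \<union> Y)" using gen_Un_gen[of "{}" Y] Y by simp
  have "\<exists>c\<in>A. a - b * c \<in> {0}" by (rule cic_mod[OF Y(3) m ab(1,2) d(1) _ _ int']) (use ab d in auto)
  then show ?thesis using ab by auto
qed

text \<open>The classical argument for one-dimensional normal domains: take \<open>a\<close> outside
  sC that multiplies the maximal ideal into sC, and put \<open>th = a / s\<close>. If
  \<open>th\<close> preserved the maximal ideal it would be almost integral; so some
  \<open>th * p\<close> is a unit, and \<open>p\<close> generates the maximal ideal.\<close>

lemma DVR_height_one:
  assumes P: "prime_ideal A P" and s: "s \<in> P" "s \<noteq> 0"
    and ht: "\<And>Q. prime_ideal A Q \<Longrightarrow> s \<in> Q \<Longrightarrow> Q \<subseteq> P \<Longrightarrow> Q = P"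
  shows "DVR (localization_at A P)"
proof -
  let ?C = "localization_at A P" and ?m = "max_ideal (localization_at A P)"
  interpret C: noeth_local ?C
    using loc_subring[OF P] loc_noetherian[OF P noeth] loc_local[OF P] by unfold_locales
  note iP = prime_ideal_ideal[OF P]
  have sA: "s \<in> A" using s ideal_closed[OF iP] by blast
  have PC: "P \<subseteq> ?m" unfolding loc_max_ideal[OF P] by (rule loc_ext_incl[OF P])
  have mA: "?m \<inter> A = P" unfolding loc_max_ideal[OF P] by (rule loc_ext_Int[OF P P order_refl])
  have sC: "s \<in> ?C" "s \<in> ?m" using s PC C.max_closed by auto
  have rad: "\<exists>e. t ^ e \<in> principal ?C s" if t: "t \<in> ?m" for t
  proof (rule ccontr)
    assume "\<not> ?thesis"
    then obtain Q where Q: "prime_ideal ?C Q" "principal ?C s \<subseteq> Q" "t \<notin> Q"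
      using C.prime_avoiding_powers[of "principal ?C s" t] C.max_closed[OF t] sC by auto
    have "s \<in> Q" using Q(2) C.principalI[of 1 s] by auto
    then have "Q \<inter> A = P" using ht contract_prime[OF P Q(1)] sA by blast
    then have "Q = ?m" using loc_ext_contract[OF P C.prime_ideal_ideal[OF Q(1)]] loc_max_ideal[OF P] by simp
    then show False using t Q(3) by blast
  qed
  obtain X where X: "finite X" "X \<subseteq> ?C" "?m = gen_ideal ?C X" using C.finite_gen[OF C.max_ideal] .
  have "\<exists>k. ideal_pow ?C ?m k \<subseteq> principal ?C s"
    using C.ideal_pow_subset_of_radical[OF X(1,2), of "principal ?C s"] rad C.gen_incl[of _ X] X(3) sC by auto
  then obtain k where k: "ideal_pow ?C ?m k \<subseteq> principal ?C s"
    "\<And>i. i < k \<Longrightarrow> \<not> ideal_pow ?C ?m i \<subseteq> principal ?C s"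
    using exists_least_iff[of "\<lambda>k. ideal_pow ?C ?m k \<subseteq> principal ?C s"] by blast
  have "k \<noteq> 0"
  proof
    assume "k = 0"
    then have "1 \<in> principal ?C s" using k(1) by auto
    moreover have "principal ?C s \<subseteq> ?m" using sC by (auto simp: principal_def)
    ultimately show False using C.one_not_max by blast
  qed
  then obtain i where i: "k = Suc i" by (cases k) auto
  obtain a where a: "a \<in> ideal_pow ?C ?m i" "a \<notin> principal ?C s" using k(2)[of i] i by auto
  define th where "th = a / s"
  have th: "th \<notin> ?C" using a(2) s C.principalI[of th s] by (auto simp: th_def)
  have th_mult: "th * b \<in> ?C" if b: "b \<in> ?m" for b
  proof -
    have "a * b \<in> ideal_pow ?C ?m k" unfolding i ideal_pow_Suc using a b by (intro C.ideal_prodI)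
    then obtain c where "c \<in> ?C" "a * b = s * c" using k(1) by (auto simp: principal_def)
    then show ?thesis using s by (simp add: th_def field_simps)
  qed
  have "\<exists>p\<in>?m. th * p \<notin> ?m"
  proof (rule ccontr)
    assume "\<not> ?thesis"
    then have st: "th * p \<in> ?m" if "p \<in> ?m" for p using that by blast
    obtain G where G: "finite G" "G \<subseteq> A" "P = gen_ideal A G" using finite_gen[OF iP] .
    \<comment> \<open>Complete integral closedness is at hand for \<open>A\<close>, not for its
      localization. A common denominator \<open>t\<close> for the finitely many generators turns
      \<open>th\<close> into \<open>t * th\<close>, which maps \<open>P\<close> itself into
      \<open>P\<close>.\<close>
    have "\<exists>t\<in>A - P. \<forall>g\<in>G. t * (th * g) \<in> P"
    proof -
      have "\<exists>t\<in>A - P. \<forall>g\<in>G'. t * (th * g) \<in> P" if "G' \<subseteq> P" "finite G'" for G'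
        using that(2,1)
      proof (induction G' rule: finite_induct)
        case empty then show ?case using prime_ideal_one[OF P] by (intro bexI[of _ 1]) auto
      next
        case (insert g G')
        then obtain t where t: "t \<in> A" "t \<notin> P" "\<forall>g\<in>G'. t * (th * g) \<in> P" by auto
        have "th * g \<in> loc_ext A P P" using st[of g] insert.prems PC unfolding loc_max_ideal[OF P] by auto
        then obtain h r where h: "h \<in> P" "r \<in> A" "r \<notin> P" "th * g = h / r" by (rule loc_extE)
        have "r * (th * g) = h" using h not_prime_nonzero[OF P h(3)] by simp
        then have "(t * r) * (th * g) = t * h" by (simp add: mult.assoc)
        then have "(t * r) * (th * g) \<in> P" using iP t h by simp
        moreover have "(t * r) * (th * g') \<in> P" if "g' \<in> G'" for g'
          using ideal_mult[OF iP h(2) t(3)[rule_format, OF that]] by (simp add: mult_ac)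
        moreover have "t * r \<in> A - P" using t h compl_prime_mult[OF P] by auto
        ultimately show ?case by blast
      qed
      then show ?thesis using G gen_subset[of G] by auto
    qed
    then obtain t where t: "t \<in> A" "t \<notin> P" "\<forall>g\<in>G. t * (th * g) \<in> P" by blast
    have stab: "(t * th) * g \<in> P" if g: "g \<in> P" for g
    proof -
      have "P \<subseteq> {g \<in> A. (t * th) * g \<in> P}" unfolding G(3)
      proof (rule gen_least)
        show "ideal A {g \<in> A. t * th * g \<in> gen_ideal A G}"
          using ideal_gen[OF G(2)] by (intro idealI) (auto simp: distrib_left mult.left_commute)
        show "G \<subseteq> {g \<in> A. t * th * g \<in> gen_ideal A G}" using t(3) G by (auto simp: mult.assoc)
      qed
      then show ?thesis using g by blast
    qed
    have "(t * th) ^ n * s \<in> P" for n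
      by (induction n) (use s stab in \<open>auto simp: mult.assoc\<close>)
    then have "s * (t * th) ^ n \<in> A" for n using ideal_closed[OF iP] by (simp add: mult.commute)
    then have "t * th \<in> A" using completely_integrally_closed[OF sA s(2)] by blast
    then have "(t * th) / t \<in> ?C" unfolding localization_at_eq using t by (intro loc_extI) auto
    then show False using th not_prime_nonzero[OF P t(2)] by simp
  qed
  then obtain p where p: "p \<in> ?m" "th * p \<notin> ?m" by blast
  have u: "th * p \<noteq> 0" "inverse (th * p) \<in> ?C" using C.not_max_unit[OF th_mult[OF p(1)] p(2)] by auto
  have pC: "p \<in> ?C" "p \<noteq> 0" using p u C.max_closed by auto
  have m: "?m = principal ?C p"
  proof
    show "?m \<subseteq> principal ?C p"
    proof
      fix b assume b: "b \<in> ?m"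
      have "b = p * ((th * b) * inverse (th * p))" using u pC by (simp add: field_simps)
      then show "b \<in> principal ?C p"
        using C.principalI[OF C.mult_closed[OF th_mult[OF b] u(2)], of p] by argo
    qed
    show "principal ?C p \<subseteq> ?m" using p by (auto simp: principal_def)
  qed
  show ?thesis
  proof (rule DVR_of_principal_max[OF C.local _ pC m])
    show "\<exists>a\<in>?C. \<exists>b\<in>?C. b \<noteq> 0 \<and> q = a / b" for q using quotients[of q] loc_incl[OF P] by blast
    show "a = 0" if "a \<in> ?C" "\<And>n. a \<in> principal ?C (p ^ n)" for a
      using that C.krull_intersection_0[of a] m C.ideal_pow_principal[OF pC(1)] by simp
  qed
qed

end

section \<open>The order valuation\<close>

context regular_ring
begin

abbreviation mpow :: "nat \<Rightarrow> 'a set" where "mpow n \<equiv> ideal_pow A (max_ideal A) n"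

lemma mpow_domain:
  assumes "a \<in> mpow p" "a \<notin> mpow (Suc p)" "b \<in> mpow q" "b \<notin> mpow (Suc q)"
  shows "a * b \<notin> mpow (Suc (p + q))"
proof -
  obtain Y where Y: "Y \<subseteq> A" "gen_ideal A Y = max_ideal A" "prime_family A {0} Y"
    using params prime_family_of_dim by blast
  show ?thesis using order_filt_domain[OF Y(3), of a p b q] assms Y by (simp add: order_filt_zero)
qed

lemma ord_exact:
  assumes a: "a \<in> A" "a \<noteq> 0"
  obtains k where "a \<in> mpow k" "a \<notin> mpow (Suc k)"
proof -
  obtain n where n: "a \<notin> mpow n" "\<And>i. i < n \<Longrightarrow> a \<in> mpow i"
    using krull_intersection_0[of a] a exists_least_iff[of "\<lambda>n. a \<notin> mpow n"] by blast
  show ?thesis using that[of "n - 1"] n a by (cases n) auto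
qed

lemma ord_eqI:
  assumes "a \<in> mpow k" "a \<notin> mpow (Suc k)" shows "ord A a = k"
  unfolding ord_def
proof (rule Greatest_equality)
  show "a \<in> mpow k" by fact
  fix n assume n: "a \<in> mpow n"
  show "n \<le> k"
  proof (rule ccontr)
    assume "\<not> n \<le> k"
    then show False using n assms(2) ideal_pow_antimono[OF max_ideal, of "Suc k" n] by auto
  qed
qed

lemma mpow_iff_ord:
  assumes "a \<in> A" "a \<noteq> 0" shows "a \<in> mpow n \<longleftrightarrow> n \<le> ord A a"
proof -
  obtain k where k: "a \<in> mpow k" "a \<notin> mpow (Suc k)" by (rule ord_exact[OF assms])
  show ?thesis unfolding ord_eqI[OF k]
    using k ideal_pow_antimono[OF max_ideal, of "Suc k" n] ideal_pow_antimono[OF max_ideal, of n k]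
    by (metis not_less_eq_eq subsetD)
qed

lemma ord_mult:
  assumes a: "a \<in> A" "a \<noteq> 0" and b: "b \<in> A" "b \<noteq> 0"
  shows "ord A (a * b) = ord A a + ord A b"
proof -
  obtain k where k: "a \<in> mpow k" "a \<notin> mpow (Suc k)" by (rule ord_exact[OF a])
  obtain l where l: "b \<in> mpow l" "b \<notin> mpow (Suc l)" by (rule ord_exact[OF b])
  show ?thesis
    using ord_eqI[OF ideal_pow_mult[OF max_ideal k(1) l(1)] mpow_domain[OF k l]] ord_eqI[OF k] ord_eqI[OF l] by simp
qed

text \<open>Multiplicativity of \<open>ord\<close> makes the value independent of the fraction that
  \<open>SOME\<close> selects.\<close>

lemma ordF_eq:
  assumes a: "a \<in> A" "a \<noteq> 0" and b: "b \<in> A" "b \<noteq> 0"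
  shows "ordF A (a / b) = int (ord A a) - int (ord A b)"
proof -
  define P where "P = (\<lambda>(c, d). c \<in> A \<and> d \<in> A \<and> d \<noteq> 0 \<and> c \<noteq> 0 \<and> a / b = c / d)"
  obtain c d where cd: "(SOME p. P p) = (c, d)" by (cases "SOME p. P p") auto
  have "P (a, b)" using a b by (simp add: P_def)
  then have "P (c, d)" using someI[of P "(a, b)"] cd by simp
  then have h: "c \<in> A" "d \<in> A" "d \<noteq> 0" "c \<noteq> 0" "a / b = c / d" by (auto simp: P_def)
  then have "a * d = c * b" using b by (simp add: field_simps)
  then have "ord A a + ord A d = ord A c + ord A b" using ord_mult a b h by metis
  moreover have "ordF A (a / b) = int (ord A c) - int (ord A d)"
    unfolding ordF_def using cd by (simp add: P_def)
  ultimately show ?thesis by simp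
qed

lemma ordF_ring: "a \<in> A \<Longrightarrow> a \<noteq> 0 \<Longrightarrow> ordF A a = int (ord A a)"
  using ordF_eq[of a 1] ord_mult[of 1 1] by simp

lemma quotients_nonzero:
  assumes "q \<noteq> 0" obtains a b where "a \<in> A" "a \<noteq> 0" "b \<in> A" "b \<noteq> 0" "q = a / b"
  using quotients[of q] assms by auto

lemma ordF_mult:
  assumes "p \<noteq> 0" "q \<noteq> 0" shows "ordF A (p * q) = ordF A p + ordF A q"
proof -
  obtain a b where ab: "a \<in> A" "a \<noteq> 0" "b \<in> A" "b \<noteq> 0" "p = a / b" by (rule quotients_nonzero[OF assms(1)])
  obtain c d where cd: "c \<in> A" "c \<noteq> 0" "d \<in> A" "d \<noteq> 0" "q = c / d" by (rule quotients_nonzero[OF assms(2)])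
  show ?thesis using ordF_eq[of "a * c" "b * d"] ordF_eq[of a b] ordF_eq[of c d] ab cd by (simp add: ord_mult)
qed

lemma ordF_1 [simp]: "ordF A 1 = 0"
  using ordF_mult[of 1 1] by simp

lemma ordF_inverse: "q \<noteq> 0 \<Longrightarrow> ordF A (inverse q) = - ordF A q"
  using ordF_mult[of q "inverse q"] by simp

lemma ordF_divide: "p \<noteq> 0 \<Longrightarrow> q \<noteq> 0 \<Longrightarrow> ordF A (p / q) = ordF A p - ordF A q"
  using ordF_mult[of p "inverse q"] ordF_inverse[of q] by (simp add: divide_inverse)

lemma ordF_power: "q \<noteq> 0 \<Longrightarrow> ordF A (q ^ n) = int n * ordF A q"
  by (induction n) (auto simp: ordF_mult algebra_simps)

lemma ordF_add:
  assumes "p \<noteq> 0" "q \<noteq> 0" "p + q \<noteq> 0" "ordF A p \<ge> n" "ordF A q \<ge> n" shows "ordF A (p + q) \<ge> n"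
proof -
  obtain a b where ab: "a \<in> A" "a \<noteq> 0" "b \<in> A" "b \<noteq> 0" "p = a / b" by (rule quotients_nonzero[OF assms(1)])
  obtain c d where cd: "c \<in> A" "c \<noteq> 0" "d \<in> A" "d \<noteq> 0" "q = c / d" by (rule quotients_nonzero[OF assms(2)])
  let ?u = "a * d" and ?v = "c * b"
  have sum: "p + q = (?u + ?v) / (b * d)" using ab cd by (simp add: field_simps)
  then have nz: "?u + ?v \<noteq> 0" using assms(3) by auto
  define k where "k = min (ord A ?u) (ord A ?v)"
  have "?u \<in> mpow k" "?v \<in> mpow k" using mpow_iff_ord[of ?u k] mpow_iff_ord[of ?v k] ab cd by (auto simp: k_def)
  then have "?u + ?v \<in> mpow k" by (intro ideal_add) auto
  then have "k \<le> ord A (?u + ?v)" using mpow_iff_ord[of "?u + ?v" k] nz ab cd by auto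
  moreover have "ordF A (p + q) = int (ord A (?u + ?v)) - int (ord A (b * d))"
    unfolding sum using ab cd nz by (intro ordF_eq) auto
  moreover have "ordF A p = int (ord A a) - int (ord A b)" "ordF A q = int (ord A c) - int (ord A d)"
    using ab cd ordF_eq by auto
  ultimately show ?thesis using assms(4,5) ab cd by (auto simp: ord_mult k_def min_def split: if_splits)
qed

text \<open>Steinitz exchange modulo the maximal ideal: either all coefficients of \<open>y\<close>
  are nonunits, or one is a unit and its generator can be solved for. The quotient vector space has
  no counterpart inside the field, so the exchange is done on generators.\<close>

lemma params_exchange:
  assumes "finite Y" "Y \<subseteq> A" "y \<in> gen_ideal A Y"
  shows "y \<in> ideal_prod A (gen_ideal A Y) (max_ideal A) \<or> (\<exists>z\<in>Y. z \<in> gen_ideal A (insert y (Y - {z})))"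
  using assms
proof (induction Y arbitrary: y rule: finite_induct)
  case empty
  then show ?case by auto
next
  case (insert z Y)
  have zA: "z \<in> A" and YA: "Y \<subseteq> A" using insert.prems by auto
  obtain s b where s: "s \<in> A" "b \<in> gen_ideal A Y" "y = z * s + b"
    by (rule gen_insertE[OF insert.prems(2) zA YA])
  have bA: "b \<in> A" using s gen_closed[OF YA] by blast
  have yA: "y \<in> A" using s bA zA by simp
  show ?case
  proof (cases "s \<in> max_ideal A")
    case False
    have yY: "insert y Y \<subseteq> A" using yA YA by auto
    have "s * z = y - b" using s by (simp add: algebra_simps)
    moreover have "y - b \<in> gen_ideal A (insert y Y)"
      using gen_incl[of y "insert y Y"] gen_mono[of Y "insert y Y"] s yY by (intro ideal_diff) auto
    ultimately have "z \<in> gen_ideal A (insert y Y)" using ideal_cancel_unit[OF ideal_gen[OF yY] s(1) False] by simp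
    moreover have "insert z Y - {z} = Y" using insert.hyps by auto
    ultimately show ?thesis by auto
  next
    case True
    have zs: "z * s \<in> ideal_prod A (gen_ideal A (insert z Y)) (max_ideal A)"
      using True gen_incl[of z "insert z Y"] by (intro ideal_prodI) auto
    consider "b \<in> ideal_prod A (gen_ideal A Y) (max_ideal A)" | w where "w \<in> Y" "w \<in> gen_ideal A (insert b (Y - {w}))"
      using insert.IH[OF YA s(2)] by blast
    then show ?thesis
    proof cases
      case 1
      then have "b \<in> ideal_prod A (gen_ideal A (insert z Y)) (max_ideal A)"
        using ideal_prod_mono[OF gen_mono[of Y "insert z Y"] order_refl[of "max_ideal A"]] by auto
      then have "z * s + b \<in> ideal_prod A (gen_ideal A (insert z Y)) (max_ideal A)"
        using zs insert.prems by (intro ideal_add) auto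
      then show ?thesis using s by simp
    next
      case 2
      let ?G = "gen_ideal A (insert y (insert z Y - {w}))"
      have G: "insert y (insert z Y - {w}) \<subseteq> A" using yA zA YA by auto
      have "z \<noteq> w" using 2 insert.hyps by auto
      then have "z \<in> ?G" "y \<in> ?G" by (auto intro!: gen_incl)
      then have "y - z * s \<in> ?G" using ideal_gen[OF G] s(1) by simp
      moreover have "y - z * s = b" using s by simp
      ultimately have "b \<in> ?G" by simp
      then have "gen_ideal A (insert b (Y - {w})) \<subseteq> ?G"
        using gen_subset[of "insert y (insert z Y - {w})"] by (intro gen_least ideal_gen[OF G]) auto
      then show ?thesis using 2 by blast
    qed
  qed
qed

lemma params_containing:
  assumes y: "y \<in> max_ideal A" "y \<notin> mpow 2"
  obtains Y where "finite Y" "Y \<subseteq> A" "y \<in> Y" "gen_ideal A Y = max_ideal A" "prime_family A {0} Y"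
proof -
  obtain Y c where Y: "finite Y" "Y \<subseteq> A" "gen_ideal A Y = max_ideal A" "prime_chain A c (card Y)" using params by blast
  have yA: "y \<in> A" using y max_closed by blast
  have "y \<notin> ideal_prod A (gen_ideal A Y) (max_ideal A)"
  proof
    assume "y \<in> ideal_prod A (gen_ideal A Y) (max_ideal A)"
    then have "y \<in> mpow (Suc (Suc 0))" using Y(3) ideal_pow_Suc[of A "max_ideal A" "Suc 0"] by simp
    then show False using y(2) by (simp add: numeral_2_eq_2)
  qed
  then obtain z where z: "z \<in> Y" "z \<in> gen_ideal A (insert y (Y - {z}))"
    using params_exchange[OF Y(1,2)] y Y(3) by blast
  let ?Y = "insert y (Y - {z})"
  have sub: "?Y \<subseteq> A" using yA Y by auto
  have gen: "gen_ideal A ?Y = max_ideal A"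
  proof
    show "gen_ideal A ?Y \<subseteq> max_ideal A"
      using y Y(3) gen_subset[of Y] by (intro gen_least) auto
    show "max_ideal A \<subseteq> gen_ideal A ?Y" unfolding Y(3)[symmetric]
    proof (rule gen_least[OF ideal_gen[OF sub]])
      show "Y \<subseteq> gen_ideal A ?Y" using z gen_subset[of ?Y] by auto
    qed
  qed
  have "0 \<in> c 0" using Y prime_ideal_ideal by (auto simp: prime_chain_def)
  \<comment> \<open>The exchanged set cannot be smaller, because it still bounds the length of the
    chain \<open>c\<close>. It is therefore again a system of as many parameters as the chain has
    steps.\<close>
  then have "card Y \<le> card ?Y"
    using prime_chain_length_le[of ?Y "{0}" c "card Y"] Y sub gen gen_Un_gen[of "{}" ?Y] by auto
  moreover have "card ?Y \<le> card Y"
    using card_Suc_Diff1[OF Y(1) z(1)] Y(1) by (simp add: card_insert_if)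
  ultimately have "prime_family A {0} ?Y" using Y sub gen by (intro prime_family_of_dim[of _ c]) auto
  then show ?thesis using that[of ?Y] Y sub gen by auto
qed

end

section \<open>Affine pieces of blow-ups\<close>

lemma gen_subring_subring: "subring (gen_subring X)"
  unfolding gen_subring_def subring_def by auto

lemma gen_subring_incl: "X \<subseteq> gen_subring X"
  unfolding gen_subring_def by auto

lemma gen_subring_least: "subring C \<Longrightarrow> X \<subseteq> C \<Longrightarrow> gen_subring X \<subseteq> C"
  unfolding gen_subring_def by auto

text \<open>An affine chart of the blow-up of \<open>I\<close>. The ideal is kept general because
  the chart is also needed for the ideal of all parameters but one.\<close>

definition blowup :: "'a::field set \<Rightarrow> 'a set \<Rightarrow> 'a \<Rightarrow> 'a set" where
  "blowup A I y = gen_subring (A \<union> {a / y | a. a \<in> I})"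

context field_subring
begin

text \<open>A normal form with a single power of \<open>y\<close> as denominator; it lets orders in
  \<open>A\<close> be read off from numerators.\<close>

lemma blowup_eq:
  assumes I: "ideal A I" and y: "y \<in> I" "y \<noteq> 0"
  shows "blowup A I y = {a / y ^ n | a n. a \<in> ideal_pow A I n}" (is "_ = ?R")
proof
  have pA: "a \<in> A" if "a \<in> ideal_pow A I n" for a n using that ideal_closed[OF ideal_pow_ideal[OF I]] by blast
  have yp: "y ^ n \<in> ideal_pow A I n" for n using ideal_pow_power[OF I y(1)] .
  have mem: "a / y ^ n \<in> ?R" if "a \<in> ideal_pow A I n" for a n using that by blast
  have "subring ?R" unfolding subring_def
  proof (intro conjI ballI)
    show "0 \<in> ?R" using mem[of 0 0] by simp
    show "1 \<in> ?R" using mem[of 1 0] by simp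
    fix b assume "b \<in> ?R"
    then obtain a n where a: "b = a / y ^ n" "a \<in> ideal_pow A I n" by blast
    show "- b \<in> ?R" using mem[of "- a" n] a I by simp
    fix c assume "c \<in> ?R"
    then obtain d m where d: "c = d / y ^ m" "d \<in> ideal_pow A I m" by blast
    have "b * c = a * d / y ^ (n + m)" using a d by (simp add: power_add)
    then show "b * c \<in> ?R" using mem[OF ideal_pow_mult[OF I a(2) d(2)]] by simp
    have "b + c = (a * y ^ m + y ^ n * d) / y ^ (n + m)" unfolding a(1) d(1) using y by (simp add: power_add field_simps)
    moreover have "a * y ^ m + y ^ n * d \<in> ideal_pow A I (n + m)"
      using ideal_pow_mult[OF I a(2) yp] ideal_pow_mult[OF I yp d(2)] I by simp
    ultimately show "b + c \<in> ?R" using mem[of "a * y ^ m + y ^ n * d" "n + m"] by argo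
  qed
  moreover have "A \<union> {a / y | a. a \<in> I} \<subseteq> ?R"
    using mem[of _ 0] mem[of _ "Suc 0"] I by fastforce
  ultimately show "blowup A I y \<subseteq> ?R" unfolding blowup_def by (rule gen_subring_least)
  interpret C: field_subring "blowup A I y" by standard (simp add: blowup_def gen_subring_subring)
  have inc: "A \<subseteq> blowup A I y" "\<And>a. a \<in> I \<Longrightarrow> a / y \<in> blowup A I y"
    using gen_subring_incl[of "A \<union> {a / y | a. a \<in> I}"] unfolding blowup_def by auto
  have "a / y ^ n \<in> blowup A I y" if "a \<in> ideal_pow A I n" for a n
  proof -
    have "ideal_pow A I n \<subseteq> {a \<in> A. a / y ^ n \<in> blowup A I y}"
    proof (induction n)
      case 0 then show ?case using inc by auto
    next
      case (Suc n)
      show ?case unfolding ideal_pow_Suc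
      proof (rule ideal_prod_least)
        show "ideal A {a \<in> A. a / y ^ Suc n \<in> blowup A I y}"
        proof (rule idealI)
          show "r * a \<in> {a \<in> A. a / y ^ Suc n \<in> blowup A I y}"
            if "r \<in> A" "a \<in> {a \<in> A. a / y ^ Suc n \<in> blowup A I y}" for r a
            using that C.mult_closed[of r "a / y ^ Suc n"] inc(1) by auto
        qed (auto simp: add_divide_distrib simp del: power_Suc)
        fix a b assume ab: "a \<in> ideal_pow A I n" "b \<in> I"
        then have "(a / y ^ n) * (b / y) \<in> blowup A I y" using Suc inc(2) by (intro C.mult_closed) auto
        then show "a * b \<in> {a \<in> A. a / y ^ Suc n \<in> blowup A I y}"
          using ab pA ideal_closed[OF I] by (auto simp: mult.commute)
      qed
    qed
    then show ?thesis using that by blast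
  qed
  then show "?R \<subseteq> blowup A I y" by blast
qed

lemma blowup_subring: "subring (blowup A I y)"
  by (simp add: blowup_def gen_subring_subring)

lemma blowup_incl: "A \<subseteq> blowup A I y" "a \<in> I \<Longrightarrow> a / y \<in> blowup A I y"
  using gen_subring_incl[of "A \<union> {a / y | a. a \<in> I}"] unfolding blowup_def by auto

lemma blowupI: "ideal A I \<Longrightarrow> y \<in> I \<Longrightarrow> y \<noteq> 0 \<Longrightarrow> a \<in> ideal_pow A I n \<Longrightarrow> a / y ^ n \<in> blowup A I y"
  using blowup_eq by blast

lemma blowupE:
  assumes "ideal A I" "y \<in> I" "y \<noteq> 0" "b \<in> blowup A I y"
  obtains a n where "a \<in> ideal_pow A I n" "b = a / y ^ n"
  using assms blowup_eq by blast

end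

section \<open>Local quadratic transforms\<close>

locale quadratic_transform = regular_ring A for A :: "'a::field set" +
  fixes y :: 'a and q :: "'a set"
  assumes y_max: "y \<in> max_ideal A" and y_not2: "y \<notin> mpow 2"
    and q: "prime_ideal (blowup A (max_ideal A) y) q" and mq: "max_ideal A \<subseteq> q"
begin

abbreviation Bl :: "'a set" where "Bl \<equiv> blowup A (max_ideal A) y"
abbreviation B :: "'a set" where "B \<equiv> localization_at Bl q"

sublocale BL: field_subring Bl
  by standard (rule blowup_subring)

sublocale B: local_domain B
  using BL.loc_subring[OF q] BL.loc_local[OF q] by unfold_locales

lemma y_nonzero: "y \<noteq> 0"
  using y_not2 by auto

lemma y_closed: "y \<in> A"
  using y_max by (rule max_closed)

lemma ordF_y [simp]: "ordF A y = 1"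
proof -
  have "y \<in> mpow (Suc 0)" "y \<notin> mpow (Suc (Suc 0))" using y_max y_not2 by (simp_all add: numeral_2_eq_2)
  then have "ord A y = Suc 0" by (rule ord_eqI)
  then show ?thesis using ordF_ring[OF y_closed y_nonzero] by simp
qed

lemma A_Bl: "A \<subseteq> Bl" by (rule blowup_incl)

lemma Bl_B: "Bl \<subseteq> B" by (rule BL.loc_incl[OF q])

lemma A_B: "A \<subseteq> B" using A_Bl Bl_B by blast

lemma y_Bl: "y \<in> Bl" and y_B: "y \<in> B"
  using A_Bl A_B y_closed by auto

lemma max_divide: "a \<in> max_ideal A \<Longrightarrow> a / y \<in> Bl"
  by (rule blowup_incl)

lemma ordF_Bl:
  assumes "c \<in> Bl" "c \<noteq> 0" shows "ordF A c \<ge> 0"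
proof -
  obtain a n where a: "a \<in> mpow n" "c = a / y ^ n"
    by (rule blowupE[OF max_ideal y_max y_nonzero assms(1)])
  have "a \<in> A" "a \<noteq> 0" using a assms ideal_closed[OF ideal_pow_ideal[OF max_ideal]] by auto
  then show ?thesis
    using a mpow_iff_ord[of a n] y_nonzero by (simp add: ordF_divide ordF_power ordF_ring)
qed

lemma Bl_principal:
  assumes "c \<in> Bl" "c \<noteq> 0" "ordF A c \<ge> 1" shows "c \<in> principal Bl y"
proof -
  obtain a n where a: "a \<in> mpow n" "c = a / y ^ n"
    by (rule blowupE[OF max_ideal y_max y_nonzero assms(1)])
  have aA: "a \<in> A" "a \<noteq> 0" using a assms ideal_closed[OF ideal_pow_ideal[OF max_ideal]] by auto
  then have "int (ord A a) \<ge> int (Suc n)"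
    using a assms(3) y_nonzero by (simp add: ordF_divide ordF_power ordF_ring)
  then have "a \<in> mpow (Suc n)" using mpow_iff_ord[OF aA] by simp
  then have "a / y ^ Suc n \<in> Bl" by (rule blowupI[OF max_ideal y_max y_nonzero])
  moreover have "c = y * (a / y ^ Suc n)" using a y_nonzero by simp
  ultimately show ?thesis using BL.principalI by metis
qed

lemma yq: "y \<in> q" using y_max mq by blast

lemma ordF_compl_q:
  assumes "s \<in> Bl" "s \<notin> q" shows "ordF A s = 0"
proof (rule ccontr)
  assume "ordF A s \<noteq> 0"
  moreover have "s \<noteq> 0" using assms BL.not_prime_nonzero[OF q] by blast
  ultimately have "s \<in> principal Bl y" using Bl_principal[of s] ordF_Bl[of s] assms by auto
  then show False using assms yq BL.prime_ideal_ideal[OF q] by (auto simp: principal_def)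
qed

lemma B_E:
  assumes "b \<in> B" obtains a s where "a \<in> Bl" "s \<in> Bl" "s \<notin> q" "s \<noteq> 0" "b = a / s"
proof -
  obtain a s where "a \<in> Bl" "s \<in> Bl" "s \<notin> q" "b = a / s"
    using assms unfolding localization_at_eq by (rule loc_extE)
  then show ?thesis using that BL.not_prime_nonzero[OF q] by blast
qed

lemma ordF_B:
  assumes "b \<in> B" "b \<noteq> 0" shows "ordF A b \<ge> 0"
proof -
  obtain a s where a: "a \<in> Bl" "s \<in> Bl" "s \<notin> q" "s \<noteq> 0" "b = a / s" by (rule B_E[OF assms(1)])
  have "a \<noteq> 0" using a assms by auto
  then show ?thesis using a ordF_Bl[of a] ordF_compl_q[of s] by (simp add: ordF_divide)
qed

text \<open>The order valuation of \<open>A\<close> is nonnegative on \<open>B\<close>, and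
  denominators outside \<open>q\<close> have order zero since \<open>y\<close> lies in
  \<open>q\<close>. Thus \<open>y\<close> generates the elements of positive order, which makes it
  prime in \<open>B\<close>.\<close>

lemma B_principal_iff:
  assumes "b \<in> B" "b \<noteq> 0" shows "b \<in> principal B y \<longleftrightarrow> ordF A b \<ge> 1"
proof
  assume "b \<in> principal B y"
  then obtain c where c: "c \<in> B" "b = y * c" by (auto simp: principal_def)
  then show "ordF A b \<ge> 1" using ordF_B[of c] assms y_nonzero by (simp add: ordF_mult)
next
  assume o: "ordF A b \<ge> 1"
  obtain a s where a: "a \<in> Bl" "s \<in> Bl" "s \<notin> q" "s \<noteq> 0" "b = a / s" by (rule B_E[OF assms(1)])
  have "a \<noteq> 0" using a assms by auto
  then have "ordF A a \<ge> 1" using o a ordF_compl_q[of s] by (simp add: ordF_divide)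
  then obtain c where c: "c \<in> Bl" "a = y * c" using Bl_principal[of a] a \<open>a \<noteq> 0\<close> by (auto simp: principal_def)
  have "c / s \<in> B" unfolding localization_at_eq using c a by (intro loc_extI) auto
  moreover have "b = y * (c / s)" using c a by simp
  ultimately show "b \<in> principal B y" using B.principalI by metis
qed

lemma y_maxB: "y \<in> max_ideal B"
  using yq BL.loc_ext_incl[OF q, of q] BL.loc_max_ideal[OF q] by auto

lemma prime_principal_y: "prime_ideal B (principal B y)"
proof (rule B.prime_idealI)
  show "ideal B (principal B y)" using y_B by simp
  show "1 \<notin> principal B y" using B_principal_iff[of 1] by simp
  fix a b assume ab: "a \<in> B" "b \<in> B" "a * b \<in> principal B y" "a \<notin> principal B y" "b \<notin> principal B y"
  have nz: "a \<noteq> 0" "b \<noteq> 0" using ab B.ideal_zero[of "principal B y"] y_B by auto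
  then have "ordF A a = 0" "ordF A b = 0" using ab B_principal_iff[of a] B_principal_iff[of b] ordF_B[of a] ordF_B[of b] by auto
  then show False using nz B_principal_iff[of "a * b"] ab by (simp add: ordF_mult)
qed

lemma max_principal: "a \<in> max_ideal A \<Longrightarrow> a \<in> principal B y"
  using B.principalI[of "a / y" y] max_divide Bl_B y_nonzero by auto

lemma max_maxB: "max_ideal A \<subseteq> max_ideal B"
  using mq BL.loc_ext_incl[OF q, of q] BL.loc_max_ideal[OF q] by auto

lemma maxB_A: "a \<in> A \<Longrightarrow> a \<in> max_ideal B \<Longrightarrow> a \<in> max_ideal A"
  using A_B by (auto simp: max_ideal_def units_of_ring_def)

lemma q_maxB: "a \<in> Bl \<Longrightarrow> a \<notin> q \<Longrightarrow> a \<notin> max_ideal B"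
  using BL.loc_ext_Int[OF q q order_refl] BL.loc_max_ideal[OF q] by auto

text \<open>The preimage in \<open>B\<close> of the \<open>s\<close>-th power of the maximal ideal
  of B/yB. The estimate is made modulo \<open>y\<close> because there the fractions z/y behave like
  independent variables.\<close>

definition G :: "nat \<Rightarrow> 'a set" where
  "G s = ideal_sum (ideal_pow B (max_ideal B) s) (principal B y)"

lemma G_ideal [simp]: "ideal B (G s)"
  using y_B by (simp add: G_def)

lemma G_0: "G 0 = B"
  using B.ideal_sum_upper(1)[of B "principal B y"] y_B B.ideal_closed[OF G_ideal, of _ 0] by (auto simp: G_def)

lemma G_antimono: "m \<le> n \<Longrightarrow> G n \<subseteq> G m"
  unfolding G_def by (intro ideal_sum_mono B.ideal_pow_antimono) auto

lemma G_mult: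
  assumes "a \<in> G m" "b \<in> G n" shows "a * b \<in> G (m + n)"
proof -
  obtain a1 a2 where a: "a1 \<in> ideal_pow B (max_ideal B) m" "a2 \<in> principal B y" "a = a1 + a2"
    using assms(1) unfolding G_def by (rule ideal_sumE)
  obtain b1 b2 where b: "b1 \<in> ideal_pow B (max_ideal B) n" "b2 \<in> principal B y" "b = b1 + b2"
    using assms(2) unfolding G_def by (rule ideal_sumE)
  have iy: "ideal B (principal B y)" using y_B by simp
  have A: "a1 \<in> B" "b1 \<in> B" "a2 \<in> B" "b2 \<in> B"
    using a b iy B.ideal_closed B.ideal_pow_ideal B.max_ideal by meson+
  have "a * b = a1 * b1 + (a1 * b2 + a2 * (b1 + b2))" using a b by (simp add: algebra_simps)
  moreover have "a1 * b1 \<in> ideal_pow B (max_ideal B) (m + n)" using a b by (intro B.ideal_pow_mult) auto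
  moreover have "a1 * b2 + a2 * (b1 + b2) \<in> principal B y" using a b A iy by simp
  ultimately show ?thesis unfolding G_def by (auto intro: ideal_sumI)
qed

lemma principal_G: "principal B y \<subseteq> G s"
  unfolding G_def using y_B by (intro B.ideal_sum_upper) auto

lemma max_G: "max_ideal B \<subseteq> G (Suc 0)"
  unfolding G_def using y_B B.ideal_sum_upper(1)[of "max_ideal B" "principal B y"] by simp

end

text \<open>The coefficients are the Hasse derivatives at \<open>t\<close>.\<close>

definition taylor :: "'a::field \<Rightarrow> 'a poly \<Rightarrow> 'a poly" where
  "taylor t g = pcompose g [:t, 1:]"

lemma taylor_pCons: "taylor t (pCons a p) = [:a:] + [:t, 1:] * taylor t p"
  by (simp add: taylor_def pcompose_pCons)

lemma taylor_0: "coeff (taylor t g) 0 = poly g t"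
  by (simp add: taylor_def poly_pcompose flip: poly_0_coeff_0)

lemma taylor_mult: "taylor t (g * h) = taylor t g * taylor t h"
  and taylor_add: "taylor t (g + h) = taylor t g + taylor t h"
  and taylor_diff: "taylor t (g - h) = taylor t g - taylor t h"
  by (simp_all add: taylor_def pcompose_mult pcompose_add pcompose_diff)

lemma coeff_taylor_pCons:
  "coeff (taylor t (pCons a p)) i =
    (case i of 0 \<Rightarrow> a + t * coeff (taylor t p) 0 | Suc k \<Rightarrow> t * coeff (taylor t p) (Suc k) + coeff (taylor t p) k)"
  by (simp add: taylor_pCons split: nat.split)

context field_subring
begin

lemma taylor_coeff_ideal:
  assumes K: "ideal A K" and t: "t \<in> A" and g: "\<And>i. coeff g i \<in> K"
  shows "coeff (taylor t g) i \<in> K"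
  using g
proof (induction g arbitrary: i)
  case 0 then show ?case using K by (simp add: taylor_def)
next
  case (pCons a p)
  have "coeff p i \<in> K" for i using pCons.prems[of "Suc i"] by simp
  moreover have "a \<in> K" using pCons.prems[of 0] by simp
  ultimately show ?case using pCons.IH K t by (auto simp: coeff_taylor_pCons split: nat.split)
qed

text \<open>Only terms of degree at least \<open>i\<close> contribute to the \<open>i\<close>-th
  Taylor coefficient, and the term of degree \<open>i\<close> does so with factor one.\<close>

lemma taylor_coeff_top:
  assumes K: "ideal A K" and t: "t \<in> A" and g: "\<And>j. j > i \<Longrightarrow> coeff g j \<in> K"
  shows "coeff (taylor t g) i - coeff g i \<in> K"
  using g
proof (induction g arbitrary: i)
  case 0 then show ?case using K by (simp add: taylor_def)
next
  case (pCons a p)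
  show ?case
  proof (cases i)
    case 0
    have "coeff p j \<in> K" for j using pCons.prems[of "Suc j"] 0 by simp
    then have "coeff (taylor t p) 0 \<in> K" by (rule taylor_coeff_ideal[OF K t])
    then show ?thesis using 0 K t by (simp add: coeff_taylor_pCons)
  next
    case (Suc k)
    have p: "coeff p j \<in> K" if "j > k" for j using pCons.prems[of "Suc j"] that Suc by simp
    have 1: "coeff (taylor t p) k - coeff p k \<in> K" using pCons.IH[of k] p by blast
    have "coeff (taylor t p) (Suc k) - coeff p (Suc k) \<in> K" using pCons.IH[of "Suc k"] p by auto
    then have "coeff (taylor t p) (Suc k) \<in> K" using p[of "Suc k"] K ideal_add[OF K] by fastforce
    then have "t * coeff (taylor t p) (Suc k) + (coeff (taylor t p) k - coeff p k) \<in> K" using 1 K t by simp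
    then show ?thesis using Suc by (simp add: coeff_taylor_pCons algebra_simps)
  qed
qed

lemma coeff_mult_closed:
  "(\<And>i. coeff g i \<in> A) \<Longrightarrow> (\<And>i. coeff h i \<in> A) \<Longrightarrow> coeff (g * h) i \<in> A"
  by (simp add: coeff_mult)

end

text \<open>One parameter \<open>z\<close> other than \<open>y\<close> is singled out: with
  \<open>E\<close> the chart built from the remaining parameters, \<open>Bl\<close> consists of the
  polynomials over \<open>E\<close> in \<open>t = z / y\<close>.\<close>

locale transform_variable = quadratic_transform A y q for A :: "'a::field set" and y q +
  fixes Y :: "'a set" and z :: 'a
  assumes Y: "Y \<subseteq> A" "gen_ideal A Y = max_ideal A" "prime_family A {0} Y"
    and yz: "y \<in> Y" "z \<in> Y" "y \<noteq> z"
begin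

definition H :: "'a set" where "H = gen_ideal A (Y - {z})"
abbreviation E :: "'a set" where "E \<equiv> blowup A H y"
definition t :: 'a where "t = z / y"

sublocale E: field_subring E
  by standard (rule blowup_subring)

lemma H: "ideal A H" "y \<in> H" "H \<subseteq> max_ideal A"
  using ideal_gen[of "Y - {z}"] Y yz gen_incl[of y "Y - {z}"] gen_mono[of "Y - {z}" Y]
  unfolding H_def by blast+

lemma z_facts: "z \<in> A" "z \<noteq> 0" "z \<in> max_ideal A" "z \<notin> H"
proof -
  show "z \<in> A" "z \<in> max_ideal A" using Y yz gen_incl[of z Y] by auto
  have "gen_ideal A ({0} \<union> (Y - {z})) = H" using gen_Un_gen[of "{}" "Y - {z}"] Y by (auto simp: H_def)
  then show "z \<notin> H" using Y(3) yz unfolding prime_family_def by (metis DiffD2 DiffI Diff_subset insertI1)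
  then show "z \<noteq> 0" using H(1) by auto
qed

lemma t_Bl: "t \<in> Bl" and t_nonzero: "t \<noteq> 0" and ty: "t * y = z"
  using z_facts max_divide y_nonzero by (auto simp: t_def)

lemma E_Bl: "E \<subseteq> Bl"
  unfolding blowup_def[of A H] using A_Bl H(3) max_divide
  by (intro gen_subring_least blowup_subring) auto

lemma A_E: "A \<subseteq> E" by (rule blowup_incl)

lemma poly_Bl: "(\<And>i. coeff g i \<in> E) \<Longrightarrow> poly g t \<in> Bl"
  unfolding poly_altdef using subsetD[OF E_Bl] t_Bl by (intro BL.sum_closed BL.mult_closed) auto

lemma Bl_poly:
  assumes "b \<in> Bl" obtains g where "\<And>i. coeff g i \<in> E" "b = poly g t"
proof -
  let ?R = "{poly g t | g. \<forall>i. coeff g i \<in> E}"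
  have mem: "poly g t \<in> ?R" if "\<And>i. coeff g i \<in> E" for g using that by blast
  have const: "e \<in> ?R" if "e \<in> E" for e
    using mem[of "[:e:]"] that by (auto simp: coeff_pCons split: nat.split)
  have "subring ?R" unfolding subring_def
  proof (intro conjI ballI)
    show "0 \<in> ?R" "1 \<in> ?R" by (rule const; simp)+
    fix a assume "a \<in> ?R"
    then obtain g where g: "a = poly g t" "\<And>i. coeff g i \<in> E" by blast
    show "- a \<in> ?R" using mem[of "- g"] g by simp
    fix b assume "b \<in> ?R"
    then obtain h where h: "b = poly h t" "\<And>i. coeff h i \<in> E" by blast
    show "a + b \<in> ?R" using mem[of "g + h"] g h by simp
    show "a * b \<in> ?R" using mem[of "g * h"] E.coeff_mult_closed[of g h] g h by simp
  qed
  moreover have "a / y \<in> ?R" if a: "a \<in> max_ideal A" for a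
  proof -
    have "a \<in> gen_ideal A (insert z (Y - {z}))" using a Y yz by (simp add: insert_absorb)
    then obtain s b where s: "s \<in> A" "b \<in> H" "a = z * s + b"
      unfolding H_def using gen_insertE[of a z "Y - {z}"] z_facts Y by blast
    have co: "coeff [:b / y, s:] i \<in> E" for i
      using s A_E blowup_incl(2)[of b H y] by (auto simp: coeff_pCons split: nat.split)
    have eq: "a / y = poly [:b / y, s:] t" using s by (simp add: t_def add_divide_distrib)
    show ?thesis unfolding eq using co by (rule mem)
  qed
  ultimately have "Bl \<subseteq> ?R" unfolding blowup_def[of A "max_ideal A"]
    using const A_E by (intro gen_subring_least) auto
  then show ?thesis using assms that by blast
qed

text \<open>\<open>y\<close> is a nonzerodivisor modulo zE. In terms of numerators, \<open>z\<close>
  is prime in \<open>A\<close> and does not divide \<open>y\<close>, so it divides \<open>a\<close>;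
  since \<open>z\<close> is not in \<open>H\<close>, the cofactor stays in the same power of
  \<open>H\<close> by \<open>order_filt_cancel\<close>.\<close>

lemma E_cancel:
  assumes c: "c \<in> E" and yc: "y ^ N * c \<in> (*) z ` E" shows "c \<in> (*) z ` E"
proof -
  obtain a M where a: "a \<in> ideal_pow A H M" "c = a / y ^ M" by (rule blowupE[OF H(1,2) y_nonzero c])
  obtain c' where c': "c' \<in> E" "y ^ N * c = z * c'" using yc by blast
  obtain b K where b: "b \<in> ideal_pow A H K" "c' = b / y ^ K" by (rule blowupE[OF H(1,2) y_nonzero c'(1)])
  have aA: "a \<in> A" "b \<in> A" using a b ideal_closed[OF ideal_pow_ideal[OF H(1)]] by auto
  have "y ^ (N + K) * a = z * (b * y ^ M)"
    using c'(2) a b y_nonzero by (simp add: power_add field_simps)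
  then have "y ^ (N + K) * a \<in> principal A z" using aA y_closed principalI[of "b * y ^ M" z] by simp
  moreover have "prime_ideal A (principal A z)" "y \<notin> principal A z"
  proof -
    have "gen_ideal A ({0} \<union> {z}) = principal A z" using gen_Un_gen[of "{}" "{z}"] z_facts by simp
    then show "prime_ideal A (principal A z)" "y \<notin> principal A z"
      using Y(3) yz unfolding prime_family_def by (metis DiffI empty_subsetI insert_subset singletonD)+
  qed
  ultimately have "a \<in> principal A z"
    using prime_ideal_mult[of "principal A z" "y ^ (N + K)" a] prime_ideal_power[of "principal A z" y] aA y_closed by auto
  then obtain a' where a': "a' \<in> A" "a = z * a'" by (auto simp: principal_def)
  have "a' \<in> order_filt A {0} (Y - {z}) M"
  proof (rule order_filt_cancel)
    show "prime_family A {0} (Y - {z})" by (rule prime_family_mono[OF Y(3)]) auto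
    have "gen_ideal A ({0} \<union> (Y - {z})) = H" using gen_Un_gen[of "{}" "Y - {z}"] Y by (auto simp: H_def)
    then show "z \<notin> gen_ideal A ({0} \<union> (Y - {z}))" using z_facts by simp
    show "z * a' \<in> order_filt A {0} (Y - {z}) M"
      using a(1) a' order_filt_zero[of "Y - {z}" M] Y(1) by (auto simp: H_def)
  qed (use z_facts a' in auto)
  then have "a' \<in> ideal_pow A H M" using order_filt_zero[of "Y - {z}" M] Y(1) by (auto simp: H_def)
  then have "a' / y ^ M \<in> E" by (rule blowupI[OF H(1,2) y_nonzero])
  moreover have "c = z * (a' / y ^ M)" using a a' by simp
  ultimately show ?thesis by blast
qed

text \<open>Modulo \<open>y\<close> the element \<open>t\<close> is transcendental over \<open>E\<close>, so Taylor expansion at \<open>t\<close> is well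
  defined modulo \<open>y\<close>.\<close>

lemma poly_zero_coeffs:
  assumes "\<And>i. coeff g i \<in> E" "poly g t = 0"
  shows "coeff g i \<in> principal Bl y"
proof -
  have iP: "ideal Bl (principal Bl y)" using y_Bl by simp
  have "\<forall>i. coeff g i \<in> principal Bl y"
    if "\<And>i. coeff g i \<in> E" "poly g t = 0" "\<And>i. i \<ge> N \<Longrightarrow> coeff g i = 0" for N g
    using that
  proof (induction N arbitrary: g)
    case 0 then show ?case using iP by simp
  next
    case (Suc N)
    obtain g0 h where g: "g = pCons g0 h" by (cases g) auto
    have h: "coeff h i \<in> E" "i \<ge> N \<Longrightarrow> coeff h i = 0" for i using Suc.prems(1,3)[of "Suc i"] g by auto
    have g0: "g0 \<in> E" using Suc.prems(1)[of 0] g by simp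
    have eq: "g0 + t * poly h t = 0" using Suc.prems(2) g by simp
    have yE: "y \<in> E" "z \<in> E" using A_E y_closed z_facts by auto
    \<comment> \<open>The coefficients of \<open>h\<close> vanish from degree \<open>N\<close> on,
      so \<open>y ^ N\<close> clears all denominators of the powers of \<open>t\<close>.\<close>
    have "y ^ N * poly h t \<in> E"
    proof -
      have "y ^ N * (coeff h i * t ^ i) \<in> E" for i
      proof (cases "i < N")
        case True
        then have "y ^ N * t ^ i = z ^ i * y ^ (N - i)"
          using y_nonzero by (simp add: t_def power_divide power_diff)
        then have "y ^ N * (coeff h i * t ^ i) = coeff h i * (z ^ i * y ^ (N - i))" by (simp add: mult.left_commute)
        also have "\<dots> \<in> E" using h yE by simp
        finally show ?thesis .
      qed (use h in simp)
      then show ?thesis unfolding poly_altdef sum_distrib_left by simp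
    qed
    then have "z * (- (y ^ N * poly h t)) \<in> (*) z ` E" by (rule imageI[OF E.minus_closed])
    moreover have "y ^ Suc N * g0 = z * (- (y ^ N * poly h t))"
    proof -
      have "g0 = - (t * poly h t)" using eq by (simp add: eq_neg_iff_add_eq_0)
      then have "y ^ Suc N * g0 = - ((t * y) * (y ^ N * poly h t))" by simp
      then show ?thesis using ty by simp
    qed
    ultimately have "g0 \<in> (*) z ` E" using E_cancel[OF g0, of "Suc N"] by simp
    then obtain c where c: "c \<in> E" "g0 = z * c" by blast
    have "t * (poly h t + y * c) = (g0 + t * poly h t) - g0 + (t * y) * c" by (simp add: algebra_simps)
    also have "\<dots> = 0" by (simp only: eq ty) (simp add: c(2))
    finally have "t * (poly h t + y * c) = 0" .
    then have hc: "poly h t + y * c = 0" using t_nonzero by simp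
    \<comment> \<open>The constant term equals \<open>t * (y * c)\<close>. It is transferred to the
      next coefficient and the factor \<open>t\<close> is cancelled, which lowers the bound
      \<open>N\<close> by one and changes coefficients only by multiples of
      \<open>y\<close>.\<close>
    let ?h = "h + [:y * c:]"
    have "\<forall>i. coeff ?h i \<in> principal Bl y"
    proof (rule Suc.IH)
      show "coeff ?h i \<in> E" for i using h c yE by (auto simp: coeff_pCons split: nat.split)
      show "poly ?h t = 0" using hc by simp
      show "coeff ?h i = 0" if "i \<ge> N" for i
      \<comment> \<open>For \<open>N = 0\<close> the transferred constant could violate the bound,
        but then \<open>h\<close> vanishes and with it \<open>y * c\<close>.\<close>
      proof (cases "N = 0")
        case True
        then have "h = 0" using h(2) by (intro poly_eqI) simp
        moreover from this have "y * c = 0" using hc by simp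
        ultimately show ?thesis by (simp only: pCons_0_0 add_0 coeff_0)
      qed (use h(2) that in \<open>auto simp: coeff_pCons split: nat.split\<close>)
    qed
    moreover have "coeff [:y * c:] i \<in> principal Bl y" for i
      using c E_Bl iP BL.principalI[of c y] by (auto simp: coeff_pCons split: nat.split)
    ultimately have "coeff ?h i - coeff [:y * c:] i \<in> principal Bl y" for i using iP by (intro BL.ideal_diff) auto
    then have hi: "coeff h i \<in> principal Bl y" for i by simp
    have "t * c \<in> Bl" using c E_Bl t_Bl by auto
    moreover have "g0 = y * (t * c)" using c(2) ty by (metis mult.assoc mult.commute)
    ultimately have "g0 \<in> principal Bl y" using BL.principalI[of "t * c" y] by simp
    then show ?case unfolding g using hi by (auto simp: coeff_pCons split: nat.split)
  qed
  from this[of g "Suc (degree g)"] show ?thesis using assms by (auto simp: coeff_eq_0)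
qed

text \<open>With the polynomial variable given weight one, the condition says that the total order
  is at least \<open>s\<close>. Truncated subtraction leaves coefficients of degree \<open>s\<close>
  and above arbitrary in \<open>B\<close>, because \<open>G 0 = B\<close>.\<close>

definition Phi :: "nat \<Rightarrow> 'a poly set" where
  "Phi s = {p. \<forall>i. coeff p i \<in> G (s - i)}"

lemma Phi_mult:
  assumes p: "p \<in> Phi m" and r: "r \<in> Phi n" shows "p * r \<in> Phi (m + n)"
proof -
  have "coeff p j * coeff r (i - j) \<in> G (m + n - i)" if "j \<le> i" for i j
  proof -
    have "coeff p j * coeff r (i - j) \<in> G ((m - j) + (n - (i - j)))" using p r by (intro G_mult) (auto simp: Phi_def)
    moreover have "m + n - i \<le> (m - j) + (n - (i - j))" using that by simp
    ultimately show ?thesis using G_antimono by blast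
  qed
  then have "coeff (p * r) i \<in> G (m + n - i)" for i
    unfolding coeff_mult by (intro B.ideal_sum_closed[OF G_ideal]) simp
  then show ?thesis by (simp add: Phi_def)
qed

lemma Phi_0: "(\<And>i. coeff p i \<in> Bl) \<Longrightarrow> p \<in> Phi 0"
  using Bl_B by (auto simp: Phi_def G_0)

lemma Phi_add: "p \<in> Phi s \<Longrightarrow> r \<in> Phi s \<Longrightarrow> p + r \<in> Phi s"
  by (auto simp: Phi_def)

lemma taylor_Bl: "(\<And>i. coeff g i \<in> E) \<Longrightarrow> coeff (taylor t g) i \<in> Bl"
  using BL.taylor_coeff_ideal[OF BL.ideal_self t_Bl, of g] E_Bl by auto

lemma principal_Phi: "(\<And>i. coeff p i \<in> principal B y) \<Longrightarrow> p \<in> Phi s"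
  using principal_G by (auto simp: Phi_def)

lemma principal_Bl_B: "principal Bl y \<subseteq> principal B y"
  using Bl_B by (auto simp: principal_def)

lemma taylor_kernel:
  assumes "\<And>i. coeff g i \<in> E" "poly g t = 0" shows "taylor t g \<in> Phi s"
proof (rule principal_Phi)
  have "coeff (taylor t g) i \<in> principal Bl y" for i
    using poly_zero_coeffs[OF assms] y_Bl t_Bl by (intro BL.taylor_coeff_ideal) auto
  then show "coeff (taylor t g) i \<in> principal B y" for i using principal_Bl_B by blast
qed

text \<open>Fractions g(t)/h(t) for which some numerator has its \<open>i\<close>-th Hasse
  derivative in \<open>G (s - i)\<close> for all \<open>i\<close>. Asking for one representation
  only makes closure under sums and products checkable before independence of the representation is
  known.\<close>

definition Xi :: "nat \<Rightarrow> 'a set" where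
  "Xi s = {b \<in> B. \<exists>g h. (\<forall>i. coeff g i \<in> E) \<and> (\<forall>i. coeff h i \<in> E) \<and> poly h t \<notin> q \<and>
     b * poly h t = poly g t \<and> taylor t g \<in> Phi s}"

lemma B_rep:
  assumes "b \<in> B"
  obtains g h where "\<And>i. coeff g i \<in> E" "\<And>i. coeff h i \<in> E" "poly h t \<notin> q" "b * poly h t = poly g t"
proof -
  obtain a s where a: "a \<in> Bl" "s \<in> Bl" "s \<notin> q" "s \<noteq> 0" "b = a / s" by (rule B_E[OF assms])
  obtain g where "\<And>i. coeff g i \<in> E" "a = poly g t" by (rule Bl_poly[OF a(1)]) auto
  moreover obtain h where "\<And>i. coeff h i \<in> E" "s = poly h t" by (rule Bl_poly[OF a(2)]) auto
  ultimately show ?thesis using that[of g h] a by simp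
qed

lemma compl_q_mult: "(\<And>i. coeff h i \<in> E) \<Longrightarrow> (\<And>i. coeff k i \<in> E) \<Longrightarrow> poly h t \<notin> q \<Longrightarrow> poly k t \<notin> q \<Longrightarrow> poly (h * k) t \<notin> q"
  using BL.compl_prime_mult[OF q] poly_Bl by simp

lemma Xi_mult:
  assumes a: "a \<in> Xi m" and b: "b \<in> Xi n" shows "a * b \<in> Xi (m + n)"
proof -
  obtain g h where g: "\<And>i. coeff g i \<in> E" "\<And>i. coeff h i \<in> E" "poly h t \<notin> q" "a * poly h t = poly g t" "taylor t g \<in> Phi m"
    using a unfolding Xi_def by blast
  obtain g' h' where g': "\<And>i. coeff g' i \<in> E" "\<And>i. coeff h' i \<in> E" "poly h' t \<notin> q" "b * poly h' t = poly g' t" "taylor t g' \<in> Phi n"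
    using b unfolding Xi_def by blast
  have "a * b * poly (h * h') t = poly (g * g') t" unfolding poly_mult g(4)[symmetric] g'(4)[symmetric] by simp
  moreover have "taylor t (g * g') \<in> Phi (m + n)" unfolding taylor_mult by (rule Phi_mult[OF g(5) g'(5)])
  moreover have "a * b \<in> B" using a b by (simp add: Xi_def)
  ultimately show ?thesis unfolding Xi_def
    using compl_q_mult[OF g(2) g'(2) g(3) g'(3)] E.coeff_mult_closed[of g g'] E.coeff_mult_closed[of h h'] g g' by blast
qed

lemma Xi_0: "Xi 0 = B"
proof
  show "Xi 0 \<subseteq> B" by (auto simp: Xi_def)
  show "B \<subseteq> Xi 0"
  proof
    fix b assume b: "b \<in> B"
    obtain g h where g: "\<And>i. coeff g i \<in> E" "\<And>i. coeff h i \<in> E" "poly h t \<notin> q" "b * poly h t = poly g t"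
      by (rule B_rep[OF b]) auto
    then show "b \<in> Xi 0" using b taylor_Bl[of g] Phi_0[of "taylor t g"] unfolding Xi_def by blast
  qed
qed

lemma Xi_ideal: "ideal B (Xi s)"
proof (rule idealI)
  show "a \<in> B" if "a \<in> Xi s" for a using that by (simp add: Xi_def)
  have "coeff 0 i \<in> E" "coeff 1 i \<in> E" for i :: nat by (auto simp: coeff_pCons one_pCons split: nat.split)
  moreover have "1 \<notin> q" using BL.prime_ideal_one[OF q] .
  moreover have "taylor t 0 \<in> Phi s" by (simp add: taylor_def Phi_def)
  ultimately show "0 \<in> Xi s" unfolding Xi_def by (intro CollectI conjI exI[of _ 0] exI[of _ 1]) auto
  show "r * a \<in> Xi s" if "r \<in> B" "a \<in> Xi s" for r a using Xi_mult[of r 0 a s] that Xi_0 by simp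
  fix a b assume a: "a \<in> Xi s" and b: "b \<in> Xi s"
  obtain g h where g: "\<And>i. coeff g i \<in> E" "\<And>i. coeff h i \<in> E" "poly h t \<notin> q" "a * poly h t = poly g t" "taylor t g \<in> Phi s"
    using a unfolding Xi_def by blast
  obtain g' h' where g': "\<And>i. coeff g' i \<in> E" "\<And>i. coeff h' i \<in> E" "poly h' t \<notin> q" "b * poly h' t = poly g' t" "taylor t g' \<in> Phi s"
    using b unfolding Xi_def by blast
  let ?g = "h' * g + h * g'"
  have "(a + b) * poly (h * h') t = poly ?g t"
    unfolding poly_mult poly_add g(4)[symmetric] g'(4)[symmetric] by (simp add: algebra_simps)
  moreover have "taylor t ?g \<in> Phi s"
    unfolding taylor_add taylor_mult
    using Phi_mult[OF Phi_0[of "taylor t h'"] g(5)] Phi_mult[OF Phi_0[of "taylor t h"] g'(5)]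
      taylor_Bl[OF g(2)] taylor_Bl[OF g'(2)] by (intro Phi_add) auto
  moreover have "a + b \<in> B" using a b by (simp add: Xi_def)
  moreover have "coeff ?g i \<in> E" for i
    using E.coeff_mult_closed[of h' g] E.coeff_mult_closed[of h g'] g g' by simp
  ultimately show "a + b \<in> Xi s" unfolding Xi_def
    using compl_q_mult[OF g(2) g'(2) g(3) g'(3)] E.coeff_mult_closed[of h h'] g g' by blast
qed

lemma max_Xi: "max_ideal B \<subseteq> Xi (Suc 0)"
proof
  fix b assume bm: "b \<in> max_ideal B"
  then have b: "b \<in> B" by (rule B.max_closed)
  obtain g h where g: "\<And>i. coeff g i \<in> E" "\<And>i. coeff h i \<in> E" "poly h t \<notin> q" "b * poly h t = poly g t"
    by (rule B_rep[OF b]) auto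
  have "poly h t \<in> B" using poly_Bl[OF g(2)] Bl_B by blast
  then have "poly g t \<in> max_ideal B" using bm g(4)[symmetric] by simp
  then have "coeff (taylor t g) i \<in> G (Suc 0 - i)" for i
    using max_G taylor_Bl[OF g(1), of i] Bl_B by (cases i) (auto simp: taylor_0 G_0)
  then show "b \<in> Xi (Suc 0)" using g b unfolding Xi_def Phi_def by blast
qed

text \<open>Hasse derivatives of order \<open>i\<close> lower the order by at most \<open>i\<close>:
  the sets \<open>Xi\<close> are ideals that multiply like powers and contain the maximal ideal at
  level one, hence its powers. The element \<open>y\<close> enters at every level as a constant
  polynomial.\<close>

lemma G_Xi: "G s \<subseteq> Xi s"
proof -
  have "ideal_pow B (max_ideal B) s \<subseteq> Xi s"
  proof (induction s)
    case 0 then show ?case by (simp add: Xi_0)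
  next
    case (Suc s)
    show ?case unfolding ideal_pow_Suc
      using Suc max_Xi Xi_mult[of _ s _ "Suc 0"] by (intro B.ideal_prod_least[OF Xi_ideal]) auto
  qed
  moreover have "y \<in> Xi s"
  proof -
    have "coeff [:y:] i \<in> E" "coeff 1 i \<in> E" for i :: nat
      using A_E y_closed by (auto simp: coeff_pCons one_pCons split: nat.split)
    moreover have "1 \<notin> q" using BL.prime_ideal_one[OF q] .
    moreover have "taylor t [:y:] \<in> Phi s"
      using B.principalI[of 1 y] y_B B.ideal_zero[of "principal B y"]
      by (intro principal_Phi) (auto simp: taylor_def coeff_pCons split: nat.split)
    ultimately show ?thesis unfolding Xi_def using y_B
      by (intro CollectI conjI exI[of _ "[:y:]"] exI[of _ 1]) auto
  qed
  then have "principal B y \<subseteq> Xi s" using Xi_ideal by (auto simp: principal_def)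
  ultimately show ?thesis unfolding G_def by (intro B.ideal_sum_least Xi_ideal)
qed

text \<open>Passes from some numerator to the given one: \<open>g0 * h - g\<close> vanishes at
  \<open>t\<close>, so its Taylor coefficients are multiples of \<open>y\<close>. It remains to
  divide by the expansion of \<open>h\<close>.\<close>

lemma taylor_in_Phi:
  assumes g0: "\<And>i. coeff g0 i \<in> E" and phi: "poly g0 t \<in> G s"
  shows "taylor t g0 \<in> Phi s"
proof -
  obtain g h where g: "\<And>i. coeff g i \<in> E" "\<And>i. coeff h i \<in> E" "poly h t \<notin> q"
      "poly g0 t * poly h t = poly g t" "taylor t g \<in> Phi s"
    using phi G_Xi unfolding Xi_def by blast
  have "taylor t (g0 * h - g) \<in> Phi s"
    using g g0 E.coeff_mult_closed[of g0 h] by (intro taylor_kernel) auto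
  then have "taylor t (g0 * h - g) + taylor t g \<in> Phi s" using g(5) by (rule Phi_add)
  then have prod: "taylor t g0 * taylor t h \<in> Phi s" by (simp add: taylor_diff taylor_mult)
  have hB: "coeff (taylor t h) i \<in> B" for i using taylor_Bl[OF g(2)] Bl_B by blast
  have u: "poly h t \<in> B" "poly h t \<notin> max_ideal B" using hB[of 0] q_maxB[OF poly_Bl[OF g(2)] g(3)] by (auto simp: taylor_0)
  \<comment> \<open>Division as for power series: the constant term \<open>poly h t\<close> is a
    unit of \<open>B\<close>, so the coefficients are recovered one after another.\<close>
  have "coeff (taylor t g0) i \<in> G (s - i)" for i
  proof (induction i rule: less_induct)
    case (less i)
    let ?p = "taylor t g0" and ?r = "taylor t h"
    have "coeff (?p * ?r) i = (\<Sum>j<i. coeff ?p j * coeff ?r (i - j)) + coeff ?p i * coeff ?r 0"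
      by (simp add: coeff_mult lessThan_Suc_atMost[symmetric])
    moreover have "(\<Sum>j<i. coeff ?p j * coeff ?r (i - j)) \<in> G (s - i)"
    proof (rule B.ideal_sum_closed[OF G_ideal])
      fix j assume "j \<in> {..<i}"
      then have "j < i" "s - i \<le> s - j" by auto
      then have "coeff ?p j \<in> G (s - i)" using less.IH[of j] G_antimono[of "s - i" "s - j"] by blast
      then show "coeff ?p j * coeff ?r (i - j) \<in> G (s - i)" using hB by simp
    qed
    moreover have "coeff (?p * ?r) i \<in> G (s - i)" using prod by (simp add: Phi_def)
    ultimately have "poly h t * coeff ?p i \<in> G (s - i)"
      using B.ideal_add_cancel[OF G_ideal] by (simp add: taylor_0 mult.commute)
    then show ?case using B.ideal_cancel_unit[OF G_ideal u] by blast
  qed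
  then show ?thesis by (simp add: Phi_def)
qed

end

context quadratic_transform
begin

text \<open>The hypothesis on \<open>a\<close> says that \<open>a/y\<^sup>r\<close> is a polynomial of degree at most \<open>r\<close> in the fractions
  \<open>w/y\<close>, \<open>w \<in> W\<close>.\<close>

lemma degree_bound:
  assumes Y: "finite Y" "Y \<subseteq> A" "gen_ideal A Y = max_ideal A" "prime_family A {0} Y" "y \<in> Y"
    and W: "W \<subseteq> Y - {y}" and a: "a \<in> ideal_pow A (gen_ideal A (insert y W)) r" and phi: "a / y ^ r \<in> G (Suc r)"
  shows "a / y ^ r \<in> principal B y"
  using finite_subset[OF W finite_Diff[OF Y(1)]] W a phi
proof (induction W arbitrary: r a rule: finite_induct)
  case empty
  have "a \<in> principal A (y ^ r)" using empty.prems(2) y_closed by (simp add: ideal_pow_principal)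
  then obtain c where c: "c \<in> A" "a = y ^ r * c" by (auto simp: principal_def)
  \<comment> \<open>Without variables \<open>a / y ^ r\<close> is an element of \<open>A\<close>.
    Being a nonunit in \<open>B\<close> it is one in \<open>A\<close>, and the maximal ideal of
    \<open>A\<close> is contained in yB.\<close>
  have "G (Suc r) \<subseteq> max_ideal B"
    unfolding G_def using y_maxB B.ideal_pow_antimono[OF B.max_ideal, of "Suc 0" "Suc r"]
    by (intro B.ideal_sum_least) (auto simp: principal_def)
  then have "c \<in> max_ideal B" using empty.prems(3) c y_nonzero by auto
  then have "c \<in> principal B y" using maxB_A c max_principal by blast
  then show ?case using c y_nonzero by simp
next
  case (insert z W)
  interpret tv: transform_variable A y q Y z
    using Y insert.prems(1) by unfold_locales auto
  have WY: "insert y W \<subseteq> Y - {z}" using insert.prems(1) insert.hyps(2) Y(5) by auto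
  have WA: "insert y W \<subseteq> A" using WY Y(2) by auto
  let ?I = "gen_ideal A (insert y W)"
  have I: "ideal A ?I" using WA by simp
  have "gen_ideal A (insert z ?I) = gen_ideal A (insert y (insert z W))"
    using gen_insert_gen[OF tv.z_facts(1) WA] by (simp add: insert_commute)
  then have "a \<in> ideal_pow A (gen_ideal A (insert z ?I)) r" using insert.prems(2) by simp
  then obtain p where p: "a = poly p z" "\<And>i. i \<le> r \<Longrightarrow> coeff p i \<in> ideal_pow A ?I (r - i)"
    "\<And>i. i > r \<Longrightarrow> coeff p i = 0"
    by (rule ideal_pow_insert_poly[OF I tv.z_facts(1)]) auto
  have deg: "degree p \<le> r" using p(3) by (intro degree_le) auto
  \<comment> \<open>Dehomogenization with respect to \<open>z\<close>: the \<open>i\<close>-th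
    coefficient, divided by \<open>y ^ (r - i)\<close>, has degree at most \<open>r - i\<close> in
    the remaining fractions.\<close>
  define g where "g = (\<Sum>i\<le>r. monom (coeff p i / y ^ (r - i)) i)"
  have cg: "coeff g i = (if i \<le> r then coeff p i / y ^ (r - i) else 0)" for i
    by (simp add: g_def coeff_sum)
  have IH: "?I \<subseteq> tv.H" unfolding tv.H_def using WY by (intro gen_mono)
  have gE: "coeff g i \<in> tv.E" for i
    using blowupI[OF tv.H(1,2) y_nonzero, of "coeff p i" "r - i"] p(2)[of i] ideal_pow_mono[OF IH, of "r - i"] by (auto simp: cg)
  have val: "poly g tv.t = a / y ^ r"
  proof -
    have "coeff p i / y ^ (r - i) * tv.t ^ i = coeff p i * z ^ i / y ^ r" if "i \<le> r" for i
    proof -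
      have "y ^ r = y ^ (r - i) * y ^ i" using that by (simp flip: power_add)
      then show ?thesis by (simp add: tv.t_def power_divide)
    qed
    then have "poly g tv.t = (\<Sum>i\<le>r. coeff p i * z ^ i / y ^ r)"
      unfolding g_def by (simp add: poly_sum poly_monom)
    also have "\<dots> = (\<Sum>i\<le>r. coeff p i * z ^ i) / y ^ r" by (simp add: sum_divide_distrib)
    also have "(\<Sum>i\<le>r. coeff p i * z ^ i) = poly p z"
      unfolding poly_altdef using deg by (intro sum.mono_neutral_right) (auto simp: coeff_eq_0)
    finally show ?thesis using p(1) by simp
  qed
  have tay: "taylor tv.t g \<in> tv.Phi (Suc r)" using tv.taylor_in_Phi[of g "Suc r"] gE val insert.prems(3) by simp
  have yB: "ideal B (principal B y)" using y_B by simp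
  have tB: "tv.t \<in> B" using tv.t_Bl Bl_B by blast
  \<comment> \<open>Once the higher coefficients are multiples of \<open>y\<close>, the
    \<open>i\<close>-th coefficient agrees modulo \<open>y\<close> with the \<open>i\<close>-th
    Taylor coefficient, which lies in \<open>G (Suc r - i)\<close>. As its degree is at most
    \<open>r - i\<close>, the induction hypothesis for \<open>W\<close> applies.\<close>
  have descend: "coeff g i \<in> principal B y" if above: "\<And>j. j > i \<Longrightarrow> coeff g j \<in> principal B y" for i
  proof (cases "i \<le> r")
    case True
    have "coeff (taylor tv.t g) i - coeff g i \<in> principal B y"
      using above by (rule B.taylor_coeff_top[OF yB tB])
    then have 1: "coeff (taylor tv.t g) i - coeff g i \<in> G (Suc r - i)" using principal_G by blast
    have 2: "coeff (taylor tv.t g) i \<in> G (Suc r - i)" using tay by (simp add: tv.Phi_def)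
    have "coeff (taylor tv.t g) i - (coeff (taylor tv.t g) i - coeff g i) \<in> G (Suc r - i)"
      by (rule B.ideal_diff[OF G_ideal 2 1])
    then have "coeff p i / y ^ (r - i) \<in> G (Suc (r - i))" using True by (simp add: cg Suc_diff_le)
    then show ?thesis using insert.IH[of "coeff p i" "r - i"] p(2)[OF True] insert.prems(1) True by (simp add: cg)
  qed (use yB in \<open>simp add: cg\<close>)
  have above: "\<forall>j\<ge>k. coeff g j \<in> principal B y" if "k \<le> Suc r" for k
    using that
  proof (induction rule: inc_induct)
    case base then show ?case using yB by (auto simp: cg)
  next
    case (step n)
    have n: "coeff g n \<in> principal B y"
      by (rule descend) (use step.IH in \<open>simp add: Suc_le_eq\<close>)
    show ?case
    proof (intro allI impI)
      fix j assume "n \<le> j"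
      then show "coeff g j \<in> principal B y" using n step.IH by (cases "j = n") (simp_all add: Suc_le_eq)
    qed
  qed
  have "coeff g i \<in> principal B y" for i using above[of 0] by simp
  then have "poly g tv.t \<in> principal B y" unfolding poly_altdef using yB tB by (intro B.ideal_sum_closed) auto
  then show ?case using val by simp
qed

text \<open>Apply \<open>degree_bound\<close> to all parameters of a system containing
  \<open>y\<close>: if the order were too large, the transform would be divisible by
  \<open>y\<close>, although its order with respect to \<open>A\<close> is zero.\<close>

theorem transform_order:
  assumes f: "f \<in> A" "f \<noteq> 0"
  shows "f / y ^ ord A f \<in> B" "f / y ^ ord A f \<notin> G (Suc (ord A f))"
proof -
  let ?r = "ord A f"
  have fr: "f \<in> mpow ?r" using mpow_iff_ord[OF f] by simp
  have "f / y ^ ?r \<in> Bl" by (rule blowupI[OF max_ideal y_max y_nonzero fr])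
  then show fB: "f / y ^ ?r \<in> B" using Bl_B by blast
  show "f / y ^ ?r \<notin> G (Suc ?r)"
  proof
    assume "f / y ^ ?r \<in> G (Suc ?r)"
    moreover obtain Y where Y: "finite Y" "Y \<subseteq> A" "y \<in> Y" "gen_ideal A Y = max_ideal A" "prime_family A {0} Y"
      by (rule params_containing[OF y_max y_not2])
    moreover have "insert y (Y - {y}) = Y" using Y by auto
    ultimately have "f / y ^ ?r \<in> principal B y"
      using degree_bound[OF Y(1,2,4,5,3) order_refl, of f ?r] fr by simp
    then have "ordF A (f / y ^ ?r) \<ge> 1" using B_principal_iff[OF fB] f y_nonzero by simp
    then show False using f y_nonzero by (simp add: ordF_divide ordF_power ordF_ring)
  qed
qed

end

section \<open>Rank one valuation rings\<close>

lemma valuation_ring_local: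
  assumes "valuation_ring U" shows "local_domain U"
proof -
  interpret field_subring U using assms by unfold_locales (simp add: valuation_ring_def)
  have dich: "q \<in> U \<or> inverse q \<in> U" if "q \<noteq> 0" for q using assms that by (simp add: valuation_ring_def)
  have unit: "b \<in> units_of_ring U" if "a * b \<in> units_of_ring U" "a \<in> U" "b \<in> U" for a b
  proof -
    have "a \<noteq> 0" "b \<noteq> 0" "inverse (a * b) \<in> U" using that by (auto simp: units_of_ring_def)
    then have "a * inverse (a * b) \<in> U" using that by (intro mult_closed) auto
    then show ?thesis using \<open>a \<noteq> 0\<close> \<open>b \<noteq> 0\<close> that by (simp add: units_of_ring_def flip: mult.assoc)
  qed
  have "ideal U (max_ideal U)"
  proof (rule idealI)
    show "0 \<in> max_ideal U" by (simp add: max_ideal_def units_of_ring_def)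
    show "a \<in> U" if "a \<in> max_ideal U" for a using that by (simp add: max_ideal_def)
    show mult: "r * a \<in> max_ideal U" if "r \<in> U" "a \<in> max_ideal U" for r a
      using that unit[of r a] by (auto simp: max_ideal_def)
    have add: "a + b \<in> max_ideal U" if ab: "a \<in> max_ideal U" "b \<in> max_ideal U" "b \<noteq> 0" "a / b \<in> U" for a b
    proof -
      have "a + b = (a / b + 1) * b" using ab by (simp add: field_simps)
      then show ?thesis using mult[of "a / b + 1" b] ab by simp
    qed
    fix a b assume ab: "a \<in> max_ideal U" "b \<in> max_ideal U"
    show "a + b \<in> max_ideal U"
    proof (cases "a = 0 \<or> b = 0")
      case False
      then have "a / b \<in> U \<or> b / a \<in> U" using dich[of "a / b"] by auto
      then show ?thesis using add[of a b] add[of b a] ab False by (auto simp: add.commute)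
    qed (use ab in auto)
  qed
  then show ?thesis by unfold_locales (simp add: local_ring_def subring)
qed

text \<open>The principal ideals of the \<open>d n\<close> would form a strictly increasing
  chain.\<close>

lemma DVR_no_descent:
  assumes D: "DVR D" and d: "\<And>n::nat. d n \<in> D" "\<And>n. d n \<noteq> 0" and p: "\<And>n. p n \<in> max_ideal D"
    and eq: "\<And>n. d n = p n * d (Suc n)"
  shows False
proof -
  interpret local_domain D using D by (intro valuation_ring_local) (simp add: DVR_def)
  interpret noeth_ring D using D by unfold_locales (simp add: DVR_def)
  obtain n where n: "\<And>m. m \<ge> n \<Longrightarrow> principal D (d m) = principal D (d n)"
  proof (rule ideal_acc[of "\<lambda>n. principal D (d n)"])
    show "ideal D (principal D (d n))" for n using d by simp
    show "principal D (d n) \<subseteq> principal D (d (Suc n))" for n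
    proof
      fix a assume "a \<in> principal D (d n)"
      then obtain s where "s \<in> D" "a = d n * s" by (auto simp: principal_def)
      then have "a = d (Suc n) * (p n * s)" "p n * s \<in> D" using eq[of n] max_closed[OF p] by auto
      then show "a \<in> principal D (d (Suc n))" using principalI by metis
    qed
  qed blast
  have "principal D (d (Suc n)) = principal D (d n)" by (rule n) simp
  moreover have "d (Suc n) \<in> principal D (d (Suc n))" using principalI[of 1 "d (Suc n)"] by simp
  ultimately obtain c where c: "c \<in> D" "d (Suc n) = d n * c" by (auto simp: principal_def)
  then have "d (Suc n) = d (Suc n) * (p n * c)" using eq[of n] by (simp add: mult_ac)
  then have "p n * c = 1" using d(2) by simp
  moreover have "p n * c \<in> max_ideal D" using p c by simp
  ultimately show False using one_not_max by simp
qed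

lemma valuation_not_mem:
  assumes "valuation_ring U" "t \<notin> U" shows "t \<noteq> 0" "inverse t \<in> max_ideal U"
proof -
  interpret local_domain U by (rule valuation_ring_local[OF assms(1)])
  show "t \<noteq> 0" using assms(2) by auto
  then have "inverse t \<in> U" using assms by (auto simp: valuation_ring_def)
  then show "inverse t \<in> max_ideal U" using assms(2) by (simp add: max_ideal_def units_of_ring_def)
qed

lemma DVR_completely_integrally_closed:
  assumes D: "DVR D" and d: "d \<in> D" "d \<noteq> 0" "\<And>n. d * t ^ n \<in> D"
  shows "t \<in> D"
proof (rule ccontr)
  assume "t \<notin> D"
  then have t: "t \<noteq> 0" "inverse t \<in> max_ideal D" using valuation_not_mem[of D t] D by (auto simp: DVR_def)
  show False
  proof (rule DVR_no_descent[OF D, of "\<lambda>n. d * t ^ n" "\<lambda>_. inverse t"])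
    show "d * t ^ n = inverse t * (d * t ^ Suc n)" for n using t by (simp add: field_simps)
  qed (use d t in auto)
qed

text \<open>Otherwise every power of \<open>p\<close> divides \<open>d\<close>. The intersection of
  the ideals generated by the powers of \<open>p\<close> is a prime, nonzero because of
  \<open>d\<close> and not maximal because of \<open>p\<close>, which contradicts dimension
  one.\<close>

lemma rank_one_power:
  assumes U: "valuation_ring U" "krull_dim U = 1" and p: "p \<in> max_ideal U" and d: "d \<in> U" "d \<noteq> 0"
  shows "\<exists>k. p ^ k / d \<in> U"
proof (rule ccontr)
  assume no: "\<not> ?thesis"
  interpret local_domain U by (rule valuation_ring_local[OF U(1)])
  have dich: "q \<in> U \<or> inverse q \<in> U" if "q \<noteq> 0" for q using U that by (simp add: valuation_ring_def)
  have p0: "p \<noteq> 0" using no d by (auto dest: spec[of _ 1])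
  have pU: "p \<in> U" using p max_closed by blast
  have nu: "p * c \<noteq> 1" if "c \<in> U" for c using ideal_mult_right[OF max_ideal that p] one_not_max by metis
  define P where "P = {z \<in> U. \<forall>k. z / p ^ k \<in> U}"
  have "prime_ideal U P"
  proof (rule prime_idealI)
    show "ideal U P" unfolding P_def
    proof (rule idealI)
      show "r * a \<in> {z \<in> U. \<forall>k. z / p ^ k \<in> U}" if "r \<in> U" "a \<in> {z \<in> U. \<forall>k. z / p ^ k \<in> U}" for r a
        using that mult_closed[of r "a / p ^ _"] by auto
    qed (auto simp: add_divide_distrib)
    show "1 \<notin> P"
    proof
      assume "1 \<in> P"
      then have "1 / p ^ 1 \<in> U" unfolding P_def by blast
      then show False using nu[of "1 / p"] p0 by simp
    qed
    fix a b assume ab: "a \<in> U" "b \<in> U" "a * b \<in> P" "a \<notin> P" "b \<notin> P"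
    obtain i where i: "a / p ^ i \<notin> U" using ab unfolding P_def by blast
    obtain j where j: "b / p ^ j \<notin> U" using ab unfolding P_def by blast
    have nz: "a \<noteq> 0" "b \<noteq> 0" using i j by auto
    have c: "p ^ i / a \<in> U" "p ^ j / b \<in> U" using dich[of "a / p ^ i"] dich[of "b / p ^ j"] i j nz p0 by auto
    have "a * b / p ^ (i + j + 1) \<in> U" using ab(3) unfolding P_def by blast
    then have "(p ^ i / a) * (p ^ j / b) * (a * b / p ^ (i + j + 1)) \<in> U" by (rule mult_closed[OF mult_closed[OF c]])
    moreover have "(p ^ i / a) * (p ^ j / b) * (a * b / p ^ (i + j + 1)) = 1 / p"
      using nz p0 by (simp add: field_simps power_add)
    ultimately show False using nu[of "1 / p"] p0 by simp
  qed
  moreover have "P \<subset> max_ideal U"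
  proof -
    have "p \<notin> P"
    proof
      assume "p \<in> P"
      then have "p / p ^ 2 \<in> U" unfolding P_def by blast
      then show False using nu[of "1 / p"] p0 by (simp add: power2_eq_square)
    qed
    then show ?thesis using prime_subset_max[OF \<open>prime_ideal U P\<close>] p by blast
  qed
  moreover have "{0} \<subset> P"
  proof -
    have "d / p ^ k \<in> U" for k
    proof -
      have "p ^ k / d \<notin> U" using no by blast
      then show ?thesis using dich[of "p ^ k / d"] p0 d by auto
    qed
    then have "d \<in> P" using d by (simp add: P_def)
    then show ?thesis using d ideal_zero[OF prime_ideal_ideal[OF \<open>prime_ideal U P\<close>]] by auto
  qed
  ultimately have "prime_chain U (\<lambda>i. if i = 0 then {0} else if i = 1 then P else max_ideal U) 2"
    using prime_max prime_ideal_0 by (auto simp: prime_chain_def less_2_cases_iff)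
  then have "enat 2 \<le> krull_dim U" unfolding krull_dim_def by (intro Sup_upper) blast
  then show False using U(2) by (simp add: one_enat_def)
qed

lemma rank_one_completely_integrally_closed:
  assumes U: "valuation_ring U" "krull_dim U = 1" and d: "d \<in> U" "d \<noteq> 0" "\<And>n. d * t ^ n \<in> U"
  shows "t \<in> U"
proof (rule ccontr)
  assume n: "t \<notin> U"
  interpret local_domain U by (rule valuation_ring_local[OF U(1)])
  have t: "t \<noteq> 0" "inverse t \<in> max_ideal U" using valuation_not_mem[OF U(1) n] by auto
  obtain k where k: "inverse t ^ k / d \<in> U" using rank_one_power[OF U t(2) d(1,2)] by blast
  have "(inverse t ^ k / d) * (d * t ^ Suc k) \<in> U" by (rule mult_closed[OF k d(3)])
  moreover have "(inverse t ^ k / d) * (d * t ^ Suc k) = t" using t d by (simp add: field_simps)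
  ultimately show False using n by simp
qed

section \<open>Height and dimension in a ring with a least nonzero prime\<close>

context field_subring
begin

lemma prime_chain_nonzero:
  assumes "prime_chain A c n" "i < n" shows "c (Suc i) \<noteq> {0}"
proof -
  have "prime_ideal A (c i)" "c i \<subset> c (Suc i)" using assms by (auto simp: prime_chain_def)
  then show ?thesis using ideal_zero[OF prime_ideal_ideal[of "c i"]] by auto
qed

lemma prime_chain_two:
  assumes "prime_ideal A P" "P \<noteq> {0}" shows "prime_chain A (\<lambda>i. if i = 0 then {0} else P) (Suc 0)"
  using assms prime_ideal_0 ideal_zero[OF prime_ideal_ideal[OF assms(1)]] by (auto simp: prime_chain_def)

context
  fixes P assumes P: "prime_ideal A P" "P \<noteq> {0}"
    and least: "\<And>Q. prime_ideal A Q \<Longrightarrow> Q \<noteq> {0} \<Longrightarrow> P \<subseteq> Q"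
begin

lemma height_least_prime: "height A P = 1"
proof (rule antisym)
  show "height A P \<le> 1" unfolding height_def
  proof (rule Sup_least)
    fix e assume "e \<in> {enat n | n. \<exists>c. prime_chain A c n \<and> c n = P}"
    then obtain n c where c: "e = enat n" "prime_chain A c n" "c n = P" by blast
    have "n \<le> 1"
    proof (rule ccontr)
      assume "\<not> n \<le> 1"
      then obtain i where i: "n = Suc (Suc i)" by (intro that[of "n - 2"]) simp
      have "c (Suc i) \<noteq> {0}" using prime_chain_nonzero[OF c(2), of i] i by simp
      moreover have "prime_ideal A (c (Suc i))" "c (Suc i) \<subset> P" using c i by (auto simp: prime_chain_def)
      ultimately show False using least[of "c (Suc i)"] by auto
    qed
    then show "e \<le> 1" using c(1) by (simp add: one_enat_def)
  qed
  have "enat (Suc 0) \<in> {enat n | n. \<exists>c. prime_chain A c n \<and> c n = P}" using prime_chain_two[OF P] by auto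
  then have "enat (Suc 0) \<le> height A P" unfolding height_def by (rule Sup_upper)
  then show "1 \<le> height A P" by (simp add: one_enat_def)
qed

lemma height_one_unique:
  assumes Q: "prime_ideal A Q" "height A Q = 1" shows "Q = P"
proof (rule ccontr)
  assume ne: "Q \<noteq> P"
  have "Q \<noteq> {0}"
  proof
    assume Q0: "Q = {0}"
    have "height A Q \<le> 0" unfolding height_def
    proof (rule Sup_least)
      fix e assume "e \<in> {enat n | n. \<exists>c. prime_chain A c n \<and> c n = Q}"
      then obtain n c where c: "e = enat n" "prime_chain A c n" "c n = Q" by blast
      then have "n = 0" using prime_chain_nonzero[OF c(2)] Q0 by (cases n) auto
      then show "e \<le> 0" using c(1) by (simp add: zero_enat_def)
    qed
    then show False using Q(2) by simp
  qed
  then have "P \<subset> Q" using least[OF Q(1)] ne by blast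
  then have "prime_chain A (\<lambda>i. if i = 0 then {0} else if i = 1 then P else Q) 2"
    using prime_chain_two[OF P] Q(1) P by (auto simp: prime_chain_def less_2_cases_iff)
  then have "enat 2 \<in> {enat n | n. \<exists>c. prime_chain A c n \<and> c n = Q}"
    by (intro CollectI exI[of _ 2] conjI exI[of _ "\<lambda>i. if i = 0 then {0} else if i = 1 then P else Q"]) auto
  then have "enat 2 \<le> height A Q" unfolding height_def by (rule Sup_upper)
  then show False using Q(2) by (simp add: one_enat_def)
qed

lemma krull_dim_one:
  assumes only: "\<And>Q. prime_ideal A Q \<Longrightarrow> Q \<noteq> {0} \<Longrightarrow> Q = P" shows "krull_dim A = 1"
proof (rule antisym)
  show "krull_dim A \<le> 1" unfolding krull_dim_def
  proof (rule Sup_least)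
    fix e assume "e \<in> {enat n | n. \<exists>c. prime_chain A c n}"
    then obtain n c where c: "e = enat n" "prime_chain A c n" by blast
    have "\<not> 1 < n"
    proof
      assume n: "1 < n"
      have "c 1 \<noteq> {0}" "c (Suc 1) \<noteq> {0}" using prime_chain_nonzero[OF c(2), of 0] prime_chain_nonzero[OF c(2), of 1] n by auto
      moreover have "prime_ideal A (c 1)" "prime_ideal A (c (Suc 1))" "c 1 \<subset> c (Suc 1)" using c n by (auto simp: prime_chain_def)
      ultimately show False using only[of "c 1"] only[of "c (Suc 1)"] by auto
    qed
    then show "e \<le> 1" using c(1) by (simp add: one_enat_def)
  qed
  have "enat (Suc 0) \<in> {enat n | n. \<exists>c. prime_chain A c n}" using prime_chain_two[OF P] by blast
  then have "enat (Suc 0) \<le> krull_dim A" unfolding krull_dim_def by (rule Sup_upper)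
  then show "1 \<le> krull_dim A" by (simp add: one_enat_def)
qed

end

end

section \<open>Sequences of local quadratic transforms\<close>

lemma regular_ringI:
  assumes "regular_local A" "krull_dim A \<ge> 2" "\<And>q. \<exists>a\<in>A. \<exists>b\<in>A. b \<noteq> 0 \<and> q = a / b"
  shows "regular_ring A"
proof -
  interpret noeth_local A using assms(1) by unfold_locales (auto simp: regular_local_def local_ring_def)
  obtain X where X: "finite X" "X \<subseteq> A" "enat (card X) = krull_dim A" "gen_ideal A X = max_ideal A"
    using assms(1) unfolding regular_local_def by blast
  have "enat (card X) \<in> {enat n | n. \<exists>c. prime_chain A c n}"
  proof (rule ccontr)
    assume no: "\<not> ?thesis"
    \<comment> \<open>If no chain attained the supremum, all would be shorter by at least one. The
      subtraction is a genuine one because \<open>card X\<close> is at least two.\<close>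
    have "krull_dim A \<le> enat (card X - 1)" unfolding krull_dim_def
    proof (rule Sup_least)
      fix e assume e: "e \<in> {enat n | n. \<exists>c. prime_chain A c n}"
      then have "e \<le> krull_dim A" unfolding krull_dim_def by (rule Sup_upper)
      then show "e \<le> enat (card X - 1)" using e no X(3)[symmetric] by (auto simp: le_less)
    qed
    moreover have "card X \<ge> 2" using assms(2) X(3)[symmetric] by (metis enat_ord_simps(1) numeral_eq_enat)
    ultimately show False using X(3)[symmetric] by simp
  qed
  then show ?thesis using X by unfold_locales (blast, rule assms(3))
qed

locale quad_seq =
  fixes Rs :: "nat \<Rightarrow> 'a::field set" and y :: "nat \<Rightarrow> 'a" and q :: "nat \<Rightarrow> 'a set"
  assumes step: "\<And>n. quadratic_transform (Rs n) (y n) (q n)"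
    and Rs_Suc: "\<And>n. Rs (Suc n) = localization_at (blowup (Rs n) (max_ideal (Rs n)) (y n)) (q n)"

lemma quad_seqE:
  assumes seq: "quadratic_sequence Rs" and quot: "has_quotient_field (Rs 0)"
  obtains y q where "quad_seq Rs y q"
proof -
  have mono: "Rs 0 \<subseteq> Rs n" for n
    using lift_Suc_mono_le[of Rs 0 n] seq by (auto simp: quadratic_sequence_def)
  have reg: "regular_ring (Rs n)" for n
  proof (rule regular_ringI)
    show "regular_local (Rs n)" "krull_dim (Rs n) \<ge> 2" using seq by (auto simp: quadratic_sequence_def)
    show "\<exists>a\<in>Rs n. \<exists>b\<in>Rs n. b \<noteq> 0 \<and> u = a / b" for u
      using quot mono[of n] unfolding has_quotient_field_def by blast
  qed
  have "\<exists>y q. quadratic_transform (Rs n) y q \<and> Rs (Suc n) = localization_at (blowup (Rs n) (max_ideal (Rs n)) y) q" for n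
  proof -
    have "local_quadratic_transform (Rs n) (Rs (Suc n))" using seq by (simp add: quadratic_sequence_def)
    then obtain y q where yq: "y \<in> max_ideal (Rs n) - ideal_pow (Rs n) (max_ideal (Rs n)) 2"
      "prime_ideal (blowup (Rs n) (max_ideal (Rs n)) y) q" "max_ideal (Rs n) \<subseteq> q"
      "Rs (Suc n) = localization_at (blowup (Rs n) (max_ideal (Rs n)) y) q"
      unfolding local_quadratic_transform_def blowup_def by blast
    interpret regular_ring "Rs n" by (rule reg)
    have "quadratic_transform (Rs n) y q" using yq by unfold_locales auto
    then show ?thesis using yq by blast
  qed
  then obtain y q where "\<And>n. quadratic_transform (Rs n) (y n) (q n)"
    "\<And>n. Rs (Suc n) = localization_at (blowup (Rs n) (max_ideal (Rs n)) (y n)) (q n)" by metis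
  then show ?thesis using that[of y q] by (auto simp: quad_seq_def)
qed

context quad_seq
begin

abbreviation m :: "nat \<Rightarrow> 'a set" where "m n \<equiv> max_ideal (Rs n)"
abbreviation S :: "'a set" where "S \<equiv> seq_union Rs"
abbreviation N :: "'a set" where "N \<equiv> seq_max Rs"
abbreviation V :: "'a set" where "V \<equiv> boundary_val Rs"

lemma regular: "regular_ring (Rs n)"
  using step[of n] by (simp add: quadratic_transform_def)

lemma local: "local_domain (Rs n)"
  using regular[of n] by (simp add: regular_ring_def noeth_local_def)

lemma field_subring_Rs: "field_subring (Rs n)"
  using local[of n] by (simp add: local_domain_def)

lemma Rs_step: "Rs n \<subseteq> Rs (Suc n)"
  unfolding Rs_Suc by (rule quadratic_transform.A_B[OF step])

lemma Rs_mono: "k \<le> n \<Longrightarrow> Rs k \<subseteq> Rs n"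
  by (rule lift_Suc_mono_le[of Rs, OF Rs_step])

lemma m_step: "m n \<subseteq> m (Suc n)"
  unfolding Rs_Suc by (rule quadratic_transform.max_maxB[OF step])

lemma m_mono: "k \<le> n \<Longrightarrow> m k \<subseteq> m n"
  by (rule lift_Suc_mono_le[of m, OF m_step])

lemma m_closed: "a \<in> m n \<Longrightarrow> a \<in> Rs n"
  by (simp add: max_ideal_def)

lemma y_m: "y n \<in> m n" and y_nz: "y n \<noteq> 0"
  using quadratic_transform.y_max[OF step] quadratic_transform.y_nonzero[OF step] by auto

lemma divide_y: "a \<in> m n \<Longrightarrow> a / y n \<in> Rs (Suc n)"
  unfolding Rs_Suc
  using quadratic_transform.max_divide[OF step] quadratic_transform.Bl_B[OF step] by blast

lemma divide_y_power:
  assumes "a \<in> Rs n" "a \<noteq> 0" "k \<le> ord (Rs n) a" shows "a / y n ^ k \<in> Rs (Suc n)"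
proof -
  interpret quadratic_transform "Rs n" "y n" "q n" by (rule step)
  have "a \<in> mpow k" using assms mpow_iff_ord by simp
  then have "a / y n ^ k \<in> Bl" by (rule blowupI[OF max_ideal y_max y_nonzero])
  then show ?thesis unfolding Rs_Suc using Bl_B by blast
qed

lemma transform_ord_le:
  assumes a: "a \<in> Rs n" "a \<noteq> 0"
  shows "ord (Rs (Suc n)) (a / y n ^ ord (Rs n) a) \<le> ord (Rs n) a"
proof -
  interpret quadratic_transform "Rs n" "y n" "q n" by (rule step)
  let ?r = "ord (Rs n) a"
  interpret B': regular_ring "Rs (Suc n)" by (rule regular)
  have B: "a / y n ^ ?r \<in> Rs (Suc n)" "a / y n ^ ?r \<noteq> 0" using divide_y_power[OF a order_refl] a y_nonzero by auto
  have "a / y n ^ ?r \<notin> G (Suc ?r)" using transform_order(2)[OF a] .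
  moreover have "ideal_pow (Rs (Suc n)) (m (Suc n)) (Suc ?r) \<subseteq> G (Suc ?r)"
    unfolding G_def Rs_Suc using y_B by (intro B.ideal_sum_upper) auto
  ultimately show ?thesis using B'.mpow_iff_ord[OF B, of "Suc ?r"] by auto
qed

lemma S_iff: "a \<in> S \<longleftrightarrow> (\<exists>n. a \<in> Rs n)" by (auto simp: seq_union_def)
lemma N_iff: "a \<in> N \<longleftrightarrow> (\<exists>n. a \<in> m n)" by (auto simp: seq_max_def)

lemma Rs_common:
  assumes "a \<in> S" "b \<in> S" obtains n where "a \<in> Rs n" "b \<in> Rs n"
proof -
  obtain i j where "a \<in> Rs i" "b \<in> Rs j" using assms S_iff by blast
  then show ?thesis using that[of "max i j"] Rs_mono[of i "max i j"] Rs_mono[of j "max i j"] by auto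
qed

lemma S_subring: "subring S"
  unfolding subring_def
proof (intro conjI ballI)
  show "0 \<in> S" "1 \<in> S" using field_subring.zero_closed[OF field_subring_Rs] field_subring.one_closed[OF field_subring_Rs] S_iff by blast+
  show "- a \<in> S" if "a \<in> S" for a using that field_subring.minus_closed[OF field_subring_Rs] S_iff by blast
  fix a b assume "a \<in> S" "b \<in> S"
  then obtain n where "a \<in> Rs n" "b \<in> Rs n" by (rule Rs_common)
  then show "a + b \<in> S" "a * b \<in> S"
    using field_subring.add_closed[OF field_subring_Rs] field_subring.mult_closed[OF field_subring_Rs] S_iff by blast+
qed

lemma N_max: "max_ideal S = N"
proof
  show "max_ideal S \<subseteq> N"
  proof
    fix a assume a: "a \<in> max_ideal S"
    then obtain n where n: "a \<in> Rs n" using S_iff by (auto simp: max_ideal_def)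
    have "a \<in> m n" using a n S_iff by (auto simp: max_ideal_def units_of_ring_def)
    then show "a \<in> N" using N_iff by blast
  qed
  show "N \<subseteq> max_ideal S"
  proof
    fix a assume "a \<in> N"
    then obtain n where n: "a \<in> m n" using N_iff by blast
    have "a \<in> S" using n m_closed S_iff by blast
    moreover have "\<not> (a \<noteq> 0 \<and> inverse a \<in> S)"
    proof
      assume i: "a \<noteq> 0 \<and> inverse a \<in> S"
      then obtain k where k: "inverse a \<in> Rs k" using S_iff by blast
      have "a \<in> m (max n k)" using n m_mono[of n "max n k"] by auto
      moreover have "inverse a \<in> Rs (max n k)" using k Rs_mono[of k "max n k"] by auto
      ultimately show False using i by (simp add: max_ideal_def units_of_ring_def)
    qed
    ultimately show "a \<in> max_ideal S" by (simp add: max_ideal_def units_of_ring_def)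
  qed
qed

sublocale S: local_domain S
proof unfold_locales
  interpret field_subring S by standard (rule S_subring)
  show "subring S" by (rule S_subring)
  have "ideal S N"
  proof (rule idealI)
    show "a \<in> S" if "a \<in> N" for a using that m_closed S_iff N_iff by blast
    show "0 \<in> N" using field_subring.ideal_zero[OF field_subring_Rs local_domain.max_ideal[OF local]] N_iff by blast
    fix a b assume "a \<in> N" "b \<in> N"
    then obtain i j where "a \<in> m i" "b \<in> m j" using N_iff by blast
    then have "a \<in> m (max i j)" "b \<in> m (max i j)" using m_mono[of i "max i j"] m_mono[of j "max i j"] by auto
    then show "a + b \<in> N"
      using field_subring.ideal_add[OF field_subring_Rs local_domain.max_ideal[OF local]] N_iff by blast
  next
    fix r a assume "r \<in> S" "a \<in> N"
    then obtain i j where "r \<in> Rs i" "a \<in> m j" using N_iff S_iff by blast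
    then have "r \<in> Rs (max i j)" "a \<in> m (max i j)" using Rs_mono[of i "max i j"] m_mono[of j "max i j"] by auto
    then show "r * a \<in> N"
      using field_subring.ideal_mult[OF field_subring_Rs local_domain.max_ideal[OF local]] N_iff by blast
  qed
  then show "local_ring S" by (simp add: local_ring_def N_max S_subring)
qed

lemma N_S: "N \<subseteq> S" using S.max_closed by (auto simp: N_max)

lemma quotients0: "\<exists>a\<in>Rs 0. \<exists>b\<in>Rs 0. b \<noteq> 0 \<and> u = a / b"
  using regular_ring.quotients[OF regular[of 0]] .

lemma V_iff: "u \<noteq> 0 \<Longrightarrow> u \<in> V \<longleftrightarrow> (\<exists>k. \<forall>n\<ge>k. ordF (Rs n) u \<ge> 0)"
  by (simp add: boundary_val_def eventually_sequentially)

lemma V_I: "(\<And>n. n \<ge> k \<Longrightarrow> ordF (Rs n) u \<ge> 0) \<Longrightarrow> u \<in> V"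
  by (auto simp: boundary_val_def eventually_sequentially)

lemma S_V: "S \<subseteq> V"
proof
  fix a assume "a \<in> S"
  then obtain k where k: "a \<in> Rs k" using S_iff by blast
  show "a \<in> V"
  proof (cases "a = 0")
    case False
    have "ordF (Rs n) a \<ge> 0" if "n \<ge> k" for n
      using regular_ring.ordF_ring[OF regular, of a n] False k Rs_mono[OF that] by auto
    then show ?thesis by (rule V_I)
  qed (simp add: boundary_val_def)
qed

lemma N_inverse_V:
  assumes "s \<in> N" "s \<noteq> 0" shows "inverse s \<notin> V"
proof
  assume "inverse s \<in> V"
  then obtain k where k: "\<And>n. n \<ge> k \<Longrightarrow> ordF (Rs n) (inverse s) \<ge> 0" using V_iff[of "inverse s"] assms by auto
  obtain j where j: "s \<in> m j" using assms N_iff by blast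
  let ?n = "max k j"
  interpret regular_ring "Rs ?n" by (rule regular)
  have sm: "s \<in> m ?n" using j m_mono[of j ?n] by auto
  then have "ord (Rs ?n) s \<ge> Suc 0" using mpow_iff_ord[of s "Suc 0"] max_closed[OF sm] assms by simp
  then have "ordF (Rs ?n) (inverse s) < 0" using ordF_inverse[of s] ordF_ring[OF max_closed[OF sm]] assms by simp
  then show False using k[of ?n] by simp
qed

lemma V_subring: "subring V"
  unfolding subring_def
proof (intro conjI ballI)
  show "0 \<in> V" "1 \<in> V" using S_V S.zero_closed S.one_closed by auto
  have mult: "a * b \<in> V" if ab: "a \<in> V" "b \<in> V" for a b
  proof (cases "a = 0 \<or> b = 0")
    case True then show ?thesis by (auto simp: boundary_val_def)
  next
    case False
    obtain i where i: "\<And>n. n \<ge> i \<Longrightarrow> ordF (Rs n) a \<ge> 0" using V_iff[of a] ab False by auto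
    obtain j where j: "\<And>n. n \<ge> j \<Longrightarrow> ordF (Rs n) b \<ge> 0" using V_iff[of b] ab False by auto
    show ?thesis
      by (rule V_I[of "max i j"]) (use i j False regular_ring.ordF_mult[OF regular, of a b] in auto)
  qed
  show "- a \<in> V" if a: "a \<in> V" for a
  proof -
    have "-1 \<in> V" using S_V S.minus_closed[OF S.one_closed] by blast
    then show ?thesis using mult[of "-1" a] a by simp
  qed
  fix a b assume ab: "a \<in> V" "b \<in> V"
  show "a * b \<in> V" using mult ab .
  show "a + b \<in> V"
  proof (cases "a = 0 \<or> b = 0 \<or> a + b = 0")
    case True then show ?thesis using ab by (auto simp: boundary_val_def)
  next
    case False
    obtain i where i: "\<And>n. n \<ge> i \<Longrightarrow> ordF (Rs n) a \<ge> 0" using V_iff[of a] ab False by auto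
    obtain j where j: "\<And>n. n \<ge> j \<Longrightarrow> ordF (Rs n) b \<ge> 0" using V_iff[of b] ab False by auto
    show ?thesis
    proof (rule V_I[of "max i j"])
      fix n assume "max i j \<le> n"
      then show "ordF (Rs n) (a + b) \<ge> 0"
        using regular_ring.ordF_add[OF regular, of a b 0 n] i[of n] j[of n] False by auto
    qed
  qed
qed

text \<open>Divide numerator and denominator repeatedly by the common power of \<open>y n\<close>. The minimum of the two
  orders never increases, so it is eventually constant, and from then on whichever of the two attains
  it keeps attaining it.\<close>

lemma V_dichotomy:
  assumes "u \<noteq> 0" shows "u \<in> V \<or> inverse u \<in> V"
proof -
  obtain a0 b0 where ab0: "a0 \<in> Rs 0" "b0 \<in> Rs 0" "b0 \<noteq> 0" "u = a0 / b0" using quotients0 by blast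
  have a0: "a0 \<noteq> 0" using ab0 assms by auto
  define mn where "mn n p = min (ord (Rs n) (fst p)) (ord (Rs n) (snd p))" for n and p :: "'a \<times> 'a"
  define good where "good n p \<longleftrightarrow> fst p \<in> Rs n \<and> snd p \<in> Rs n \<and> fst p \<noteq> 0 \<and> snd p \<noteq> 0 \<and> u = fst p / snd p"
    for n and p :: "'a \<times> 'a"
  define nxt where "nxt n p p' \<longleftrightarrow> p' = (fst p / y n ^ mn n p, snd p / y n ^ mn n p)" for n and p p' :: "'a \<times> 'a"
  have "\<exists>f. \<forall>n. good n (f n) \<and> nxt n (f n) (f (Suc n))"
  proof (rule dependent_nat_choice)
    show "\<exists>p. good 0 p" using ab0 a0 by (intro exI[of _ "(a0, b0)"]) (auto simp: good_def)
    fix p n assume p: "good n p"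
    then show "\<exists>p'. good (Suc n) p' \<and> nxt n p p'"
      using divide_y_power[of "fst p" n "mn n p"] divide_y_power[of "snd p" n "mn n p"] y_nz[of n]
      by (intro exI[of _ "(fst p / y n ^ mn n p, snd p / y n ^ mn n p)"]) (auto simp: good_def nxt_def mn_def)
  qed
  then obtain f where f: "\<And>n. good n (f n)" "\<And>n. nxt n (f n) (f (Suc n))" by blast
  define a b r where "a n = fst (f n)" and "b n = snd (f n)" and "r n = mn n (f n)" for n
  have ab: "a n \<in> Rs n" "b n \<in> Rs n" "a n \<noteq> 0" "b n \<noteq> 0" "u = a n / b n" for n
    using f(1)[of n] by (auto simp: good_def a_def b_def)
  have sc: "a (Suc n) = a n / y n ^ r n" "b (Suc n) = b n / y n ^ r n" for n
    using f(2)[of n] by (auto simp: nxt_def a_def b_def r_def)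
  have r: "r n = min (ord (Rs n) (a n)) (ord (Rs n) (b n))" for n by (simp add: r_def mn_def a_def b_def)
  have le_a: "ord (Rs (Suc n)) (a (Suc n)) \<le> r n" if "ord (Rs n) (a n) = r n" for n
    using transform_ord_le[OF ab(1,3), of n] sc(1)[of n] that by simp
  have le_b: "ord (Rs (Suc n)) (b (Suc n)) \<le> r n" if "ord (Rs n) (b n) = r n" for n
    using transform_ord_le[OF ab(2,4), of n] sc(2)[of n] that by simp
  have r_step: "r (Suc n) \<le> r n" for n
  proof -
    have "ord (Rs n) (a n) = r n \<or> ord (Rs n) (b n) = r n" using r[of n] by linarith
    then show ?thesis using le_a[of n] le_b[of n] r[of "Suc n"] by auto
  qed
  obtain K where K: "\<And>n. r K \<le> r n" using ex_has_least_nat[of "\<lambda>_. True" undefined r] by auto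
  have const: "r n = r K" if "n \<ge> K" for n
    using lift_Suc_antimono_le[of r, OF r_step that] K[of n] by simp
  have ordFu: "ordF (Rs n) u = int (ord (Rs n) (a n)) - int (ord (Rs n) (b n))" for n
    using regular_ring.ordF_eq[OF regular ab(1,3,2,4), of n] ab(5)[of n] by simp
  have "ord (Rs K) (a K) = r K \<or> ord (Rs K) (b K) = r K" using r[of K] by linarith
  then show ?thesis
  proof
    assume aK: "ord (Rs K) (a K) = r K"
    have an: "ord (Rs n) (a n) = r K" if "n \<ge> K" for n
      using that
    proof (induction n rule: dec_induct)
      case (step n)
      then show ?case using le_a[of n] const[of n] const[of "Suc n"] r[of "Suc n"] by simp
    qed (rule aK)
    have "inverse u \<in> V"
    proof (rule V_I[of K])
      fix n assume n: "K \<le> n"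
      show "0 \<le> ordF (Rs n) (inverse u)"
        using regular_ring.ordF_inverse[OF regular assms, of n] ordFu[of n] an[OF n] const[OF n] r[of n] by simp
    qed
    then show ?thesis ..
  next
    assume bK: "ord (Rs K) (b K) = r K"
    have bn: "ord (Rs n) (b n) = r K" if "n \<ge> K" for n
      using that
    proof (induction n rule: dec_induct)
      case (step n)
      then show ?case using le_b[of n] const[of n] const[of "Suc n"] r[of "Suc n"] by simp
    qed (rule bK)
    have "u \<in> V"
    proof (rule V_I[of K])
      fix n assume n: "K \<le> n"
      show "0 \<le> ordF (Rs n) u" using ordFu[of n] bn[OF n] const[OF n] r[of n] by simp
    qed
    then show ?thesis ..
  qed
qed

lemma V_valuation: "valuation_ring V"
  using V_subring V_dichotomy by (simp add: valuation_ring_def)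

end

section \<open>The Noetherian hull\<close>

lemma finite_decseq_Inter_nonempty:
  assumes fin: "finite (X (0::nat))" and ne: "\<And>n. X n \<noteq> {}" and dec: "\<And>n. X (Suc n) \<subseteq> X n"
  shows "(\<Inter>n. X n) \<noteq> {}"
proof -
  have anti: "X n \<subseteq> X k" if "k \<le> n" for k n using lift_Suc_antimono_le[of X, OF dec that] .
  have fin': "finite (X n)" for n using finite_subset[OF anti[of 0 n] fin] by simp
  obtain K where K: "\<And>n. card (X K) \<le> card (X n)" using ex_has_least_nat[of "\<lambda>_. True" undefined "\<lambda>n. card (X n)"] by auto
  have "X K \<subseteq> X n" for n
  proof (cases "n \<le> K")
    case False
    then have "X n = X K" using card_subset_eq[OF fin'[of K] anti[of K n]] K[of n] card_mono[OF fin'[of K] anti[of K n]] by simp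
    then show ?thesis by simp
  qed (use anti in auto)
  then show ?thesis using ne[of K] by blast
qed

context quad_seq
begin

definition minp :: "nat \<Rightarrow> 'a \<Rightarrow> 'a set set" where
  "minp n s = {Q. prime_ideal (Rs n) Q \<and> s \<in> Q \<and> (\<forall>Q'. prime_ideal (Rs n) Q' \<and> s \<in> Q' \<and> Q' \<subseteq> Q \<longrightarrow> Q' = Q)}"

lemma minp_finite_nonempty:
  assumes "s \<in> m n" shows "finite (minp n s)" "minp n s \<noteq> {}"
proof -
  interpret regular_ring "Rs n" by (rule regular)
  have sA: "s \<in> Rs n" using assms max_closed by blast
  obtain \<P> where PP: "finite \<P>" "\<forall>P\<in>\<P>. prime_ideal (Rs n) P \<and> principal (Rs n) s \<subseteq> P"
    "\<forall>P. prime_ideal (Rs n) P \<and> principal (Rs n) s \<subseteq> P \<longrightarrow> (\<exists>P'\<in>\<P>. P' \<subseteq> P)"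
    using finite_primes_over[OF principal_closed[OF sA]] by (elim exE conjE)
  note P = PP(1) PP(2)[rule_format] PP(3)[rule_format, OF conjI]
  have s_iff: "principal (Rs n) s \<subseteq> P \<longleftrightarrow> s \<in> P" if "prime_ideal (Rs n) P" for P
  proof
    show "s \<in> P" if "principal (Rs n) s \<subseteq> P" using that principalI[of 1 s] by auto
    show "principal (Rs n) s \<subseteq> P" if "s \<in> P"
      using that prime_ideal_ideal[OF \<open>prime_ideal (Rs n) P\<close>] by (auto simp: principal_def)
  qed
  have "minp n s \<subseteq> \<P>"
  proof
    fix Q assume Q: "Q \<in> minp n s"
    then have "prime_ideal (Rs n) Q" "principal (Rs n) s \<subseteq> Q" using s_iff by (auto simp: minp_def)
    then obtain P' where P': "P' \<in> \<P>" "P' \<subseteq> Q" using P(3) by blast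
    then have "P' = Q" using Q P(2)[OF P'(1)] s_iff unfolding minp_def by blast
    then show "Q \<in> \<P>" using P' by blast
  qed
  then show "finite (minp n s)" using P(1) finite_subset by blast
  have "\<P> \<noteq> {}" using P(3)[OF prime_max] s_iff[OF prime_max] assms by blast
  then obtain M where M: "M \<in> \<P>" "\<And>P. P \<in> \<P> \<Longrightarrow> P \<subseteq> M \<Longrightarrow> P = M"
    using finite_has_minimal[OF P(1)] by metis
  have "M \<in> minp n s" unfolding minp_def
  proof (intro CollectI conjI allI impI)
    show "prime_ideal (Rs n) M" "s \<in> M" using P(2)[OF M(1)] s_iff by auto
    fix Q assume Q: "prime_ideal (Rs n) Q \<and> s \<in> Q \<and> Q \<subseteq> M"
    then obtain P' where P': "P' \<in> \<P>" "P' \<subseteq> Q" using P(3)[of Q] s_iff[of Q] by blast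
    then have "P' = M" using M(2)[of P'] Q by blast
    then show "Q = M" using P' Q by blast
  qed
  then show "minp n s \<noteq> {}" by blast
qed

text \<open>If \<open>Q\<close> contained \<open>y n\<close>, it would lie strictly above the prime
  generated by \<open>y n\<close>, because \<open>s'\<close> has order zero with respect to the old
  ring; the principal ideal theorem would then give a smaller prime through \<open>s'\<close>.
  Outside the locus of \<open>y n\<close> the blow-up changes no local ring.\<close>

lemma minp_contract:
  assumes s: "s \<in> Rs n" "s \<noteq> 0" and s'_def: "s' = s / y n ^ ord (Rs n) s" and Q: "Q \<in> minp (Suc n) s'"
  shows "y n \<notin> Q" "Q \<inter> Rs n \<in> minp n s" "localization_at (Rs n) (Q \<inter> Rs n) = localization_at (Rs (Suc n)) Q"
proof -
  interpret A: quadratic_transform "Rs n" "y n" "q n" by (rule step)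
  interpret B: regular_ring "Rs (Suc n)" by (rule regular)
  let ?r = "ord (Rs n) s"
  have Qp: "prime_ideal (Rs (Suc n)) Q" and sQ: "s' \<in> Q"
    and Qmin: "\<And>Q'. prime_ideal (Rs (Suc n)) Q' \<Longrightarrow> s' \<in> Q' \<Longrightarrow> Q' \<subseteq> Q \<Longrightarrow> Q' = Q"
    using Q by (auto simp: minp_def)
  note iQ = B.prime_ideal_ideal[OF Qp]
  have s'B: "s' \<in> Rs (Suc n)" "s' \<noteq> 0" using divide_y_power[OF s order_refl] s y_nz[of n] by (auto simp: s'_def)
  have yA: "y n \<in> Rs n" using A.y_closed .
  have yB: "y n \<in> Rs (Suc n)" using yA Rs_step by blast
  show yQ: "y n \<notin> Q"
  proof
    assume y: "y n \<in> Q"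
    let ?P = "principal (Rs (Suc n)) (y n)"
    have pP: "prime_ideal (Rs (Suc n)) ?P" using A.prime_principal_y by (simp add: Rs_Suc)
    have PQ: "?P \<subseteq> Q" using y iQ by (auto simp: principal_def)
    have "ordF (Rs n) s' = 0"
      unfolding s'_def using s y_nz[of n] by (simp add: A.ordF_divide A.ordF_power A.ordF_ring)
    then have "s' \<notin> ?P" using A.B_principal_iff[of s'] s'B by (simp add: Rs_Suc)
    then have "?P \<subset> Q" using PQ sQ by blast
    moreover have "y n \<in> ?P" using B.principalI[of 1 "y n"] by simp
    then have "{0} \<subset> ?P" using y_nz[of n] B.ideal_zero[OF B.prime_ideal_ideal[OF pP]] by blast
    ultimately obtain P' where "prime_ideal (Rs (Suc n)) P'" "P' \<subset> Q" "s' \<in> P'"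
      using B.prime_between_containing[OF B.prime_ideal_0 pP Qp _ _ sQ] by blast
    then show False using Qmin[of P'] by blast
  qed
  have ypQ: "y n ^ k \<notin> Q" for k using yQ B.prime_ideal_power[OF Qp yB] by blast
  have ss': "s = y n ^ ?r * s'" using y_nz[of n] by (simp add: s'_def)
  let ?P = "Q \<inter> Rs n"
  have Rsub: "Rs n \<subseteq> Rs (Suc n)" by (rule Rs_step)
  have pP: "prime_ideal (Rs n) ?P"
  proof (rule A.prime_idealI)
    show "ideal (Rs n) ?P" using iQ Rsub by (intro idealI) auto
    show "1 \<notin> ?P" using B.prime_ideal_one[OF Qp] by blast
    show False if "a \<in> Rs n" "b \<in> Rs n" "a * b \<in> ?P" "a \<notin> ?P" "b \<notin> ?P" for a b
      using that B.prime_ideal_mult[OF Qp, of a b] Rsub by blast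
  qed
  have sP: "s \<in> ?P" using ss' s iQ sQ yB by (metis B.ideal_mult B.power_closed IntI)
  \<comment> \<open>Clearing powers of \<open>y n\<close> writes elements of the new ring over the
    old one. The denominators avoid \<open>Q\<close> since neither \<open>t\<close> nor
    \<open>y n\<close> lies in it.\<close>
  have rep: "\<exists>c\<in>Rs n. \<exists>d\<in>Rs n. d \<notin> Q \<and> b = c / d" if b: "b \<in> Rs (Suc n)" for b
  proof -
    obtain c t where ct: "c \<in> A.Bl" "t \<in> A.Bl" "t \<notin> q n" "t \<noteq> 0" "b = c / t" using A.B_E b unfolding Rs_Suc by blast
    obtain a i where a: "a \<in> A.mpow i" "c = a / y n ^ i" by (rule A.blowupE[OF A.max_ideal A.y_max y_nz ct(1)])
    obtain d j where d: "d \<in> A.mpow j" "t = d / y n ^ j" by (rule A.blowupE[OF A.max_ideal A.y_max y_nz ct(2)])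
    have adA: "a \<in> Rs n" "d \<in> Rs n" using a d A.ideal_closed[OF A.ideal_pow_ideal[OF A.max_ideal]] by auto
    have tB: "t \<in> Rs (Suc n)" "inverse t \<in> Rs (Suc n)" unfolding Rs_Suc
      using ct A.Bl_B A.BL.loc_inverse[OF A.q] by auto
    have tQ: "t \<notin> Q"
    proof
      assume "t \<in> Q"
      then have "inverse t * t \<in> Q" using iQ tB by simp
      then show False using ct(4) B.prime_ideal_one[OF Qp] by simp
    qed
    have "d * y n ^ i = t * y n ^ (j + i)" using d y_nz[of n] by (simp add: power_add)
    moreover have "t * y n ^ (j + i) \<notin> Q"
      using B.prime_ideal_mult[OF Qp tB(1), of "y n ^ (j + i)"] tQ ypQ B.power_closed[OF yB] by blast
    ultimately have "d * y n ^ i \<notin> Q" by simp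
    moreover have "b = (a * y n ^ j) / (d * y n ^ i)" using a d ct y_nz[of n] by simp
    moreover have "a * y n ^ j \<in> Rs n" "d * y n ^ i \<in> Rs n" using adA yA by auto
    ultimately show ?thesis by blast
  qed
  show loc: "localization_at (Rs n) ?P = localization_at (Rs (Suc n)) Q"
  proof
    show "localization_at (Rs n) ?P \<subseteq> localization_at (Rs (Suc n)) Q"
      unfolding localization_at_def using Rsub by blast
    show "localization_at (Rs (Suc n)) Q \<subseteq> localization_at (Rs n) ?P"
    proof
      fix u assume "u \<in> localization_at (Rs (Suc n)) Q"
      then obtain b e where be: "b \<in> Rs (Suc n)" "e \<in> Rs (Suc n)" "e \<notin> Q" "u = b / e"
        unfolding localization_at_def by blast
      obtain c d where c: "c \<in> Rs n" "d \<in> Rs n" "d \<notin> Q" "b = c / d" using rep[OF be(1)] by blast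
      obtain c' d' where c': "c' \<in> Rs n" "d' \<in> Rs n" "d' \<notin> Q" "e = c' / d'" using rep[OF be(2)] by blast
      have d0: "d \<noteq> 0" "d' \<noteq> 0" using c c' B.ideal_zero[OF iQ] by auto
      have "e * d' \<notin> Q" using B.prime_ideal_mult[OF Qp be(2), of d'] be(3) c' Rsub by blast
      moreover have "e * d' = c'" using c' d0 by simp
      ultimately have "c' \<notin> Q" by simp
      then have "d * c' \<notin> Q" using B.prime_ideal_mult[OF Qp, of d c'] c c' Rsub by blast
      moreover have "u = (c * d') / (d * c')" using be c c' by simp
      moreover have "c * d' \<in> Rs n" "d * c' \<in> Rs n" using c c' by auto
      ultimately show "u \<in> localization_at (Rs n) ?P" unfolding localization_at_def by blast
    qed
  qed
  show "?P \<in> minp n s" unfolding minp_def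
  proof (intro CollectI conjI allI impI)
    show "prime_ideal (Rs n) ?P" by (rule pP)
    show "s \<in> ?P" by (rule sP)
    fix Q' assume "prime_ideal (Rs n) Q' \<and> s \<in> Q' \<and> Q' \<subseteq> ?P"
    then have Q': "prime_ideal (Rs n) Q'" "s \<in> Q'" "Q' \<subseteq> ?P" by auto
    let ?E = "loc_ext (Rs n) ?P Q'"
    have E: "prime_ideal (localization_at (Rs (Suc n)) Q) ?E" using A.prime_loc_ext[OF pP Q'(1,3)] unfolding loc .
    have EB: "prime_ideal (Rs (Suc n)) (?E \<inter> Rs (Suc n))" "?E \<inter> Rs (Suc n) \<subseteq> Q" using B.contract_prime[OF Qp E] by auto
    \<comment> \<open>A prime of the old ring inside \<open>?P\<close> extends to the common local
      ring and restricts to the new ring. There it contains \<open>s'\<close> because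
      \<open>y n\<close> is outside \<open>Q\<close>, so minimality of \<open>Q\<close> can be
      invoked.\<close>
    have "y n ^ ?r * s' \<in> ?E \<inter> Rs (Suc n)"
      using Q'(2) A.loc_ext_incl[OF pP, of Q'] s(1) Rsub unfolding ss'[symmetric] by blast
    then have "s' \<in> ?E \<inter> Rs (Suc n)"
      using B.prime_ideal_mult[OF EB(1) B.power_closed[OF yB] s'B(1)] EB(2) ypQ by blast
    then have "?E \<inter> Rs (Suc n) = Q" using Qmin[OF EB(1) _ EB(2)] by blast
    then have "?P = ?E \<inter> Rs n" using Rsub by blast
    then show "Q' = ?P" using A.loc_ext_Int[OF pP Q'(1,3)] by simp
  qed
qed

text \<open>The localizations at the minimal primes over \<open>s j\<close> form a decreasing sequence of finite nonempty
  sets of discrete valuation rings, and \<open>D\<close> is a common member.\<close>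

lemma exists_DVR:
  assumes s: "\<And>j. s j \<in> m (k + j)" "\<And>j. s j \<noteq> 0"
    and s_Suc: "\<And>j. s (Suc j) = s j / y (k + j) ^ ord (Rs (k + j)) (s j)"
  obtains D where "DVR D" "S \<subset> D" "s 0 \<in> max_ideal D"
proof -
  define X where "X j = (\<lambda>Q. localization_at (Rs (k + j)) Q) ` minp (k + j) (s j)" for j
  have sR: "s j \<in> Rs (k + j)" for j using s(1) m_closed by blast
  have "(\<Inter>j. X j) \<noteq> {}"
  proof (rule finite_decseq_Inter_nonempty)
    show "finite (X 0)" unfolding X_def by (intro finite_imageI minp_finite_nonempty(1) s)
    show "X j \<noteq> {}" for j using minp_finite_nonempty(2)[OF s(1)] by (simp add: X_def)
    show "X (Suc j) \<subseteq> X j" for j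
    proof
      fix D assume "D \<in> X (Suc j)"
      then obtain Q where Q: "Q \<in> minp (Suc (k + j)) (s (Suc j))" "D = localization_at (Rs (Suc (k + j))) Q"
        by (auto simp: X_def)
      show "D \<in> X j" using minp_contract(2,3)[OF sR s(2) s_Suc Q(1)] Q(2) by (auto simp: X_def)
    qed
  qed
  then obtain D where D: "\<And>j. D \<in> X j" by blast
  have Dj: "\<exists>Q\<in>minp (k + j) (s j). D = localization_at (Rs (k + j)) Q" for j using D[of j] by (auto simp: X_def)
  have RD: "Rs (k + j) \<subseteq> D" for j
  proof -
    obtain Q where Q: "Q \<in> minp (k + j) (s j)" "D = localization_at (Rs (k + j)) Q" using Dj by blast
    then show ?thesis using field_subring.loc_incl[OF field_subring_Rs, of "k + j" Q] by (simp add: minp_def)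
  qed
  have SD: "S \<subseteq> D"
  proof
    fix a assume "a \<in> S"
    then obtain n where "a \<in> Rs n" using S_iff by blast
    then have "a \<in> Rs (k + n)" using Rs_mono[of n "k + n"] by auto
    then show "a \<in> D" using RD by blast
  qed
  obtain Q where Q: "Q \<in> minp k (s 0)" "D = localization_at (Rs k) Q" using Dj[of 0] by auto
  interpret A: regular_ring "Rs k" by (rule regular)
  have Qp: "prime_ideal (Rs k) Q" "s 0 \<in> Q" using Q by (auto simp: minp_def)
  have "DVR D" unfolding Q(2)
    using Q(1) s(2)[of 0] by (intro A.DVR_height_one[OF Qp]) (auto simp: minp_def)
  moreover have "s 0 \<in> max_ideal D"
    unfolding Q(2) A.loc_max_ideal[OF Qp(1)] using A.loc_ext_incl[OF Qp(1), of Q] Qp(2) by blast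
  \<comment> \<open>\<open>y k\<close> is a unit of \<open>D\<close>, but as a nonzero element of
    \<open>N\<close> it has no inverse in \<open>V\<close>, let alone in \<open>S\<close>.\<close>
  moreover have "S \<noteq> D"
  proof
    assume SD: "S = D"
    obtain Q1 where Q1: "Q1 \<in> minp (k + 1) (s 1)" "D = localization_at (Rs (k + 1)) Q1" using Dj by blast
    have "y k \<notin> Q1" using minp_contract(1)[OF sR s(2) s_Suc, of Q1 0] Q1(1) by simp
    moreover have "y k \<in> Rs (k + 1)" using y_m m_closed Rs_step[of k] by auto
    moreover have "prime_ideal (Rs (k + 1)) Q1" using Q1 by (simp add: minp_def)
    ultimately have "inverse (y k) \<in> D"
      unfolding Q1(2) using field_subring.loc_inverse[OF field_subring_Rs] by blast
    then have "inverse (y k) \<in> V" using SD S_V by blast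
    moreover have "y k \<in> N" using y_m N_iff by blast
    ultimately show False using N_inverse_V y_nz by blast
  qed
  ultimately show ?thesis using that SD by blast
qed

abbreviation T :: "'a set" where "T \<equiv> noetherian_hull S"

lemma S_T: "S \<subseteq> T"
  by (auto simp: noetherian_hull_def)

text \<open>For \<open>u\<close> in \<open>D\<close> outside \<open>S\<close>, a denominator
  \<open>d\<close> and the numerator \<open>u * d\<close> are nonunits at every stage: the former
  since \<open>u\<close> is not in \<open>S\<close>, the latter since it lies in the maximal ideal
  of \<open>D\<close>. Both can be divided by \<open>y n\<close> forever, against
  \<open>DVR_no_descent\<close>.\<close>

lemma DVR_dominating:
  assumes D: "DVR D" and SD: "S \<subseteq> D" and ND: "N \<subseteq> max_ideal D"
  shows "D \<subseteq> S"
proof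
  fix u assume u: "u \<in> D"
  interpret D: local_domain D using D by (intro valuation_ring_local) (simp add: DVR_def)
  show "u \<in> S"
  proof (rule ccontr)
    assume nS: "u \<notin> S"
    obtain a0 b0 where ab0: "a0 \<in> Rs 0" "b0 \<in> Rs 0" "b0 \<noteq> 0" "u = a0 / b0" using quotients0 by blast
    define good where "good n d \<longleftrightarrow> d \<in> Rs n \<and> d \<noteq> 0 \<and> u * d \<in> Rs n" for n d
    have "\<exists>f. \<forall>n. good n (f n) \<and> f n = y n * f (Suc n)"
    proof (rule dependent_nat_choice)
      show "\<exists>d. good 0 d" using ab0 by (intro exI[of _ b0]) (auto simp: good_def)
      fix d n assume d: "good n d"
      interpret R: local_domain "Rs n" by (rule local)
      have "d \<in> m n"
      proof (rule ccontr)
        assume "d \<notin> m n"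
        then have "inverse d \<in> Rs n" using R.not_max_unit d by (auto simp: good_def)
        moreover have "u * d \<in> Rs n" using d by (simp add: good_def)
        ultimately have "(u * d) * inverse d \<in> Rs n" by (rule R.mult_closed[rotated])
        then show False using nS d S_iff by (auto simp: good_def mult.assoc)
      qed
      have "u * d \<in> max_ideal D" using u ND N_iff \<open>d \<in> m n\<close> D.ideal_mult[OF D.max_ideal] by blast
      have "u * d \<in> m n"
      proof (rule ccontr)
        assume "u * d \<notin> m n"
        then have i: "u * d \<noteq> 0" "inverse (u * d) \<in> Rs n" using R.not_max_unit[of "u * d"] d unfolding good_def by blast+
        then have "inverse (u * d) \<in> D" using SD S_iff by blast
        then show False using i \<open>u * d \<in> max_ideal D\<close> by (auto simp: max_ideal_def units_of_ring_def)
      qed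
      then have "good (Suc n) (d / y n)"
        using divide_y[OF \<open>d \<in> m n\<close>] divide_y[of "u * d" n] d y_nz[of n] by (auto simp: good_def)
      then show "\<exists>d'. good (Suc n) d' \<and> d = y n * d'" using y_nz[of n] by (intro exI[of _ "d / y n"]) auto
    qed
    then obtain f where f: "\<And>n. good n (f n)" "\<And>n. f n = y n * f (Suc n)" by blast
    show False
    proof (rule DVR_no_descent[OF D, of f y])
      show "f n \<in> D" "f n \<noteq> 0" for n using f(1)[of n] SD S_iff by (auto simp: good_def)
      show "y n \<in> max_ideal D" for n using ND y_m N_iff by blast
      show "f n = y n * f (Suc n)" for n by (rule f(2))
    qed
  qed
qed

end

section \<open>The archimedean case\<close>

locale archimedean_quad_seq = quad_seq +
  fixes x
  assumes xS: "x \<in> S" and rad: "radical S (principal S x) = N"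
    and loc: "is_localization (Rs 0) T" and arch: "archimedean S" and notDVR: "\<not> DVR S"
begin

sublocale V: local_domain V
  by (rule valuation_ring_local[OF V_valuation])

lemma xN: "x \<in> N"
proof -
  have "x ^ 1 \<in> principal S x" using S.principalI[of 1 x] by simp
  then show ?thesis using xS rad unfolding radical_def by blast
qed

lemma yN: "y n \<in> N" using y_m N_iff by blast

lemma N_power: "s \<in> N \<Longrightarrow> \<exists>k. \<exists>c\<in>S. s ^ k = x * c"
  using rad unfolding radical_def principal_def by blast

lemma x_nz: "x \<noteq> 0"
proof
  assume "x = 0"
  then obtain k where "y 0 ^ k = 0" using N_power[OF yN[of 0]] by auto
  then show False using y_nz[of 0] by simp
qed

text \<open>A discrete valuation ring in whose maximal ideal \<open>x\<close> lay would have all of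
  \<open>N\<close> there, because xS is N-primary, and so could not contain \<open>S\<close>
  properly.\<close>

lemma x_inverse_T: "inverse x \<in> T"
  unfolding noetherian_hull_def
proof (rule InterI)
  fix D assume "D \<in> {D. DVR D \<and> S \<subset> D}"
  then have D: "DVR D" "S \<subset> D" by auto
  interpret D: local_domain D using D by (intro valuation_ring_local) (simp add: DVR_def)
  have "x \<notin> max_ideal D"
  proof
    assume xD: "x \<in> max_ideal D"
    have "N \<subseteq> max_ideal D"
    proof
      fix s assume s: "s \<in> N"
      then obtain k c where "c \<in> S" "s ^ k = x * c" using N_power by blast
      then have "s ^ k \<in> max_ideal D" using xD D by auto
      then show "s \<in> max_ideal D" using D.prime_ideal_power[OF D.prime_max] s N_S D by blast
    qed
    then show False using DVR_dominating[OF D(1)] D(2) by blast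
  qed
  then show "inverse x \<in> D" using D.not_max_unit xS D(2) by blast
qed

lemma T_subring: "subring T"
proof -
  have "subring D" if "DVR D" for D using that by (simp add: DVR_def valuation_ring_def)
  then show ?thesis unfolding noetherian_hull_def subring_def by blast
qed

sublocale T: field_subring T
  by standard (rule T_subring)

text \<open>The denominator \<open>s0\<close> of \<open>f\<close> is invertible in \<open>T\<close>,
  so by \<open>exists_DVR\<close> some iterated transform of it is a unit. Since \<open>f\<close>
  has nonnegative order from stage \<open>k\<close> on, \<open>f * s\<close> can be divided by the
  same powers as \<open>s\<close>, and at that unit the fraction \<open>f\<close> becomes an element
  of the ring.\<close>

lemma V_Int_T: "V \<inter> T \<subseteq> S"
proof
  fix f assume f: "f \<in> V \<inter> T"
  show "f \<in> S"
  proof (cases "f = 0")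
    case False
    obtain M where M: "M \<subseteq> Rs 0 - {0}" "T = {a / s | a s. a \<in> Rs 0 \<and> s \<in> M}"
      using loc unfolding is_localization_def by blast
    obtain a0 s0 where as0: "a0 \<in> Rs 0" "s0 \<in> M" "f = a0 / s0" using f M(2) by blast
    have s0: "s0 \<in> Rs 0" "s0 \<noteq> 0" using as0 M by auto
    have "1 / s0 \<in> T" unfolding M(2) using as0(2) field_subring.one_closed[OF field_subring_Rs] by blast
    obtain k where k: "\<And>n. n \<ge> k \<Longrightarrow> ordF (Rs n) f \<ge> 0" using f V_iff[OF False] by blast
    \<comment> \<open>The index \<open>j\<close> counts from stage \<open>k\<close>, where the
      orders of \<open>f\<close> become nonnegative. The last clause ties the start of the sequence
      to \<open>s0\<close>, whose inverse in \<open>T\<close> yields the contradiction.\<close>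
    define good where "good j s \<longleftrightarrow> s \<in> Rs (k + j) \<and> s \<noteq> 0 \<and> f * s \<in> Rs (k + j) \<and> (j = 0 \<longrightarrow> s = s0)" for j s
    define nxt where "nxt j s s' \<longleftrightarrow> s' = s / y (k + j) ^ ord (Rs (k + j)) s" for j s s'
    have "\<exists>g. \<forall>j. good j (g j) \<and> nxt j (g j) (g (Suc j))"
    proof (rule dependent_nat_choice)
      have "good 0 s0" using s0 as0 Rs_mono[of 0 k] by (auto simp: good_def)
      then show "\<exists>s. good 0 s" by blast
      fix s j assume s: "good j s"
      let ?n = "k + j"
      interpret regular_ring "Rs ?n" by (rule regular)
      have h: "s \<in> Rs ?n" "s \<noteq> 0" "f * s \<in> Rs ?n" "f * s \<noteq> 0" using s False by (auto simp: good_def)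
      have "int (ord (Rs ?n) (f * s)) = ordF (Rs ?n) f + int (ord (Rs ?n) s)"
        using ordF_ring[OF h(3,4)] ordF_ring[OF h(1,2)] ordF_mult[OF False h(2)] by simp
      then have "ord (Rs ?n) s \<le> ord (Rs ?n) (f * s)" using k[of ?n] by simp
      then have "f * s / y ?n ^ ord (Rs ?n) s \<in> Rs (Suc ?n)" by (rule divide_y_power[OF h(3,4)])
      moreover have "s / y ?n ^ ord (Rs ?n) s \<in> Rs (Suc ?n)" by (rule divide_y_power[OF h(1,2) order_refl])
      ultimately show "\<exists>s'. good (Suc j) s' \<and> nxt j s s'"
        using h y_nz[of ?n] by (auto simp: good_def nxt_def)
    qed
    then obtain g where g: "\<And>j. good j (g j)" "\<And>j. nxt j (g j) (g (Suc j))" by blast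
    have "\<exists>j. g j \<notin> m (k + j)"
    proof (rule ccontr)
      assume "\<not> ?thesis"
      then obtain D where D: "DVR D" "S \<subset> D" "g 0 \<in> max_ideal D"
        using exists_DVR[of g k] g by (auto simp: good_def nxt_def)
      have "g 0 = s0" using g(1)[of 0] by (simp add: good_def)
      moreover have "inverse s0 \<in> D" using \<open>1 / s0 \<in> T\<close> D by (auto simp: noetherian_hull_def inverse_eq_divide)
      ultimately show False using D(3) s0 by (simp add: max_ideal_def units_of_ring_def)
    qed
    then obtain j where j: "g j \<notin> m (k + j)" by blast
    interpret R: local_domain "Rs (k + j)" by (rule local)
    have h: "g j \<in> Rs (k + j)" "g j \<noteq> 0" "f * g j \<in> Rs (k + j)" using g(1)[of j] by (auto simp: good_def)
    have "(f * g j) * inverse (g j) \<in> Rs (k + j)" using R.not_max_unit[OF h(1) j] by (intro R.mult_closed[OF h(3)]) auto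
    then show ?thesis using h S_iff by (auto simp: mult.assoc)
  qed (use S.zero_closed in simp)
qed

lemma V_cases:
  assumes "a \<noteq> 0" "b \<noteq> 0" obtains "a / b \<in> V" | "b / a \<in> V"
  using V_dichotomy[of "a / b"] assms by auto

text \<open>If the successive quotients \<open>y k / y (k + 1)\<close> were eventually units, then \<open>N\<close> would be principal.\<close>

lemma N_halving:
  assumes s: "s \<in> N" "s \<noteq> 0"
  obtains t c where "t \<in> N" "t \<noteq> 0" "c \<in> V" "s = t\<^sup>2 * c"
proof -
  obtain n where n: "s \<in> m n" using s N_iff by blast
  define c where "c k = y k / y (Suc k)" for k
  have cS: "c k \<in> S" for k using divide_y[of "y k" "Suc k"] y_m[of k] m_step[of k] S_iff by (auto simp: c_def)
  have yc: "y k = y (Suc k) * c k" for k using y_nz[of "Suc k"] by (simp add: c_def)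
  have chain: "\<exists>e\<in>S. y i = y j * e" if "i \<le> j" for i j
    using that
  proof (induction j rule: dec_induct)
    case base then show ?case by (intro bexI[of _ 1]) auto
  next
    case (step j)
    then obtain e where "e \<in> S" "y i = y j * e" by blast
    then show ?case using yc[of j] cS[of j] by (intro bexI[of _ "c j * e"]) (auto simp: mult.assoc)
  qed
  have "\<exists>k\<ge>n. c k \<in> N"
  proof (rule ccontr)
    assume "\<not> ?thesis"
    then have u: "inverse (c k) \<in> S" if "k \<ge> n" for k using S.not_max_unit[OF cS] that N_max by blast
    have y_assoc: "\<exists>e\<in>S. y k = y n * e" if "k \<ge> n" for k
      using that
    proof (induction k rule: dec_induct)
      case base then show ?case by (intro bexI[of _ 1]) auto
    next
      case (step k)
      then obtain e where e: "e \<in> S" "y k = y n * e" by blast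
      have "c k \<noteq> 0" using y_nz by (simp add: c_def)
      then have "y (Suc k) = y k * inverse (c k)" using yc[of k] by simp
      then show ?case using e u[of k] step by (intro bexI[of _ "e * inverse (c k)"]) (auto simp: mult.assoc)
    qed
    have "max_ideal S = principal S (y n)"
    proof
      show "max_ideal S \<subseteq> principal S (y n)"
      proof
        fix t assume "t \<in> max_ideal S"
        then obtain k where "t \<in> m k" using N_max N_iff by blast
        then have "t \<in> m (max n k)" using m_mono[of k "max n k"] by auto
        then have w: "t / y (max n k) \<in> S" using divide_y S_iff by blast
        obtain e where e: "e \<in> S" "y (max n k) = y n * e" using y_assoc[of "max n k"] by auto
        have "t = y (max n k) * (t / y (max n k))" using y_nz by simp
        then have "t = y n * (e * (t / y (max n k)))" using e(2) by (metis mult.assoc)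
        then show "t \<in> principal S (y n)" using S.principalI[OF S.mult_closed[OF e(1) w], of "y n"] by argo
      qed
      show "principal S (y n) \<subseteq> max_ideal S" using yN[of n] N_max S.ideal_mult_right[OF S.max_ideal] by (auto simp: principal_def)
    qed
    moreover have "a = 0" if "a \<in> S" "\<And>i. a \<in> principal S (y n ^ i)" for a
    proof -
      have "y n \<in> S - units_of_ring S" using yN[of n] N_max by (auto simp: max_ideal_def)
      then have "(\<Inter>i. principal S (y n ^ i)) = {0}" using arch by (simp add: archimedean_def)
      then show ?thesis using that by blast
    qed
    moreover have "\<exists>a\<in>S. \<exists>b\<in>S. b \<noteq> 0 \<and> u = a / b" for u using quotients0[of u] S_iff by blast
    ultimately have "DVR S" using DVR_of_principal_max[OF S.local] yN[of n] N_S y_nz by blast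
    then show False using notDVR by blast
  qed
  then obtain k where k: "k \<ge> n" "c k \<in> N" by blast
  obtain e where e: "e \<in> S" "y n = y k * e" using chain[OF k(1)] by blast
  define e' where "e' = s / y n * e"
  have "s / y n \<in> S" using divide_y[OF n] S_iff by blast
  then have e'S: "e' \<in> S" unfolding e'_def using e(1) by (rule S.mult_closed)
  let ?a = "y (Suc k)" and ?b = "c k"
  define w where "w = s / y n"
  have "s = w * y n" using y_nz by (simp add: w_def)
  also have "\<dots> = w * (?a * ?b * e)" using e(2) yc[of k] by argo
  finally have s_eq: "s = ?a * ?b * e'" by (simp add: e'_def w_def mult_ac)
  have nz: "?a \<noteq> 0" "?b \<noteq> 0" using y_nz by (auto simp: c_def)
  have e'V: "e' \<in> V" using e'S S_V by blast
  \<comment> \<open>Of the two factors of \<open>s\<close> in \<open>N\<close>, the one of smaller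
    value in \<open>V\<close> serves as \<open>t\<close>; the quotient of the other by it goes into
    the cofactor.\<close>
  show ?thesis
  proof (rule V_cases[OF nz])
    assume "?a / ?b \<in> V"
    moreover have "s = ?b\<^sup>2 * (?a / ?b * e')" using s_eq nz by (simp add: power2_eq_square)
    ultimately show ?thesis using that[OF k(2) nz(2) V.mult_closed] e'V by blast
  next
    assume "?b / ?a \<in> V"
    moreover have "s = ?a\<^sup>2 * (?b / ?a * e')" using s_eq nz by (simp add: power2_eq_square)
    ultimately show ?thesis using that[OF yN nz(1) V.mult_closed] e'V by blast
  qed
qed

section \<open>The ideal NV and the rank one valuation ring W\<close>

definition p :: "'a set" where "p = gen_ideal V N"

lemma N_V: "N \<subseteq> V" using N_S S_V by blast

text \<open>In a valuation ring a sum is a multiple of the summand of smallest value, so one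
  generator suffices. The condition \<open>s \<noteq> 0\<close> permits division by it; zero is
  represented as \<open>y 0 * 0\<close>.\<close>

lemma p_iff: "a \<in> p \<longleftrightarrow> (\<exists>s\<in>N. \<exists>c\<in>V. s \<noteq> 0 \<and> a = s * c)"
proof -
  let ?P = "{s * c | s c. s \<in> N \<and> s \<noteq> 0 \<and> c \<in> V}"
  have "ideal V ?P"
  proof (rule idealI)
    show "a \<in> V" if "a \<in> ?P" for a using that N_V by auto
    show "0 \<in> ?P" using yN[of 0] y_nz[of 0] V.zero_closed by force
    show "r * a \<in> ?P" if r: "r \<in> V" and a: "a \<in> ?P" for r a
    proof -
      obtain s c where s: "a = s * c" "s \<in> N" "s \<noteq> 0" "c \<in> V" using a by blast
      have "r * a = s * (r * c)" using s(1) by simp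
      then show ?thesis using s V.mult_closed[OF r s(4)] by blast
    qed
    have add: "s * c + s' * c' \<in> ?P"
      if h: "s \<in> N" "s \<noteq> 0" "c \<in> V" "c' \<in> V" "s' / s \<in> V" for s c s' c'
    proof -
      have "s * c + s' * c' = s * (c + s' / s * c')" using h(2) by (simp add: algebra_simps)
      then show ?thesis using h V.add_closed[OF h(3) V.mult_closed[OF h(5,4)]] by blast
    qed
    fix a b assume "a \<in> ?P" "b \<in> ?P"
    then obtain s c s' c' where h: "s \<in> N" "s \<noteq> 0" "c \<in> V" "a = s * c" "s' \<in> N" "s' \<noteq> 0" "c' \<in> V" "b = s' * c'" by blast
    show "a + b \<in> ?P"
      by (rule V_cases[OF h(2,6)]) (use add[of s c c' s'] add[of s' c' c s] h in \<open>simp_all add: add.commute\<close>)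
  qed
  moreover have "N \<subseteq> ?P"
  proof
    fix s assume s: "s \<in> N"
    show "s \<in> ?P"
    proof (cases "s = 0")
      case True
      then show ?thesis using yN[of 0] y_nz[of 0] by (intro CollectI exI[of _ "y 0"] exI[of _ 0]) auto
    next
      case False
      then show ?thesis using s by (intro CollectI exI[of _ s] exI[of _ 1]) auto
    qed
  qed
  ultimately have "p \<subseteq> ?P" unfolding p_def by (rule V.gen_least)
  moreover have "?P \<subseteq> p" using V.gen_incl[of _ N] V.ideal_gen[OF N_V] unfolding p_def by auto
  ultimately show ?thesis by blast
qed

lemma N_p: "N \<subseteq> p" unfolding p_def by (rule V.gen_subset)

lemma p_ideal: "ideal V p" unfolding p_def by (rule V.ideal_gen[OF N_V])

text \<open>If \<open>a\<close> has at least the value of \<open>b\<close> and \<open>a * b\<close>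
  is a multiple of \<open>s = t\<^sup>2 * e\<close>, then the square of \<open>a / t\<close> lies in
  \<open>V\<close>, hence \<open>a / t\<close> does too, and \<open>a\<close> is a multiple of
  \<open>t\<close>.\<close>

lemma p_prime: "prime_ideal V p"
proof (rule V.prime_idealI[OF p_ideal])
  show "1 \<notin> p"
  proof
    assume "1 \<in> p"
    then obtain s c where s: "s \<in> N" "c \<in> V" "s \<noteq> 0" "1 = s * c" using p_iff by blast
    then have "inverse s = c" by (metis inverse_unique)
    then show False using s N_inverse_V by blast
  qed
  have main: "a \<in> p" if h: "a \<in> V" "b \<in> V" "a * b \<in> p" "a \<noteq> 0" "b \<noteq> 0" "a / b \<in> V" for a b
  proof -
    obtain s c where s: "s \<in> N" "c \<in> V" "s \<noteq> 0" "a * b = s * c" using p_iff h by blast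
    obtain t e where t: "t \<in> N" "t \<noteq> 0" "e \<in> V" "s = t\<^sup>2 * e" by (rule N_halving[OF s(1,3)])
    have "(a / t)\<^sup>2 = (a * b) * (a / b) / t\<^sup>2" using h t by (simp add: power2_eq_square)
    also have "\<dots> = e * c * (a / b)" using s t by (simp add: power2_eq_square)
    finally have sq: "(a / t)\<^sup>2 \<in> V"
      using V.mult_closed[OF V.mult_closed[OF t(3) s(2)] h(6)] by (simp only:)
    have "a / t \<in> V"
    proof (rule ccontr)
      assume n: "a / t \<notin> V"
      then have "inverse (a / t) \<in> V" using V_dichotomy[of "a / t"] h t by auto
      then have "(a / t)\<^sup>2 * inverse (a / t) \<in> V" by (rule V.mult_closed[OF sq])
      moreover have "(a / t)\<^sup>2 * inverse (a / t) = a / t" using h t by (simp add: power2_eq_square)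
      ultimately show False using n by simp
    qed
    moreover have "a = t * (a / t)" using t by simp
    ultimately show ?thesis using p_iff t by blast
  qed
  fix a b assume ab: "a \<in> V" "b \<in> V" "a * b \<in> p" "a \<notin> p" "b \<notin> p"
  have nz: "a \<noteq> 0" "b \<noteq> 0" using ab V.ideal_zero[OF p_ideal] by auto
  show False
    by (rule V_cases[OF nz]) (use main[of a b] main[of b a] ab nz in \<open>auto simp: mult.commute\<close>)
qed

lemma p_nonzero: "p \<noteq> {0}"
  using N_p yN[of 0] y_nz[of 0] by auto

text \<open>A nonzero \<open>a\<close> of \<open>S\<close> in \<open>P\<close> cannot be divided in
  \<open>V\<close> by all powers of \<open>x\<close>: the quotients would lie in \<open>T\<close> as
  well, hence in \<open>S\<close>, against \<open>S\<close> being archimedean. So a power of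
  \<open>x\<close> is a multiple of \<open>a\<close> and lies in \<open>P\<close>, and
  \<open>N\<close> follows since it is the radical of xS.\<close>

lemma p_least:
  assumes P: "prime_ideal V P" "P \<noteq> {0}" shows "p \<subseteq> P"
proof -
  note iP = V.prime_ideal_ideal[OF P(1)]
  obtain u where u: "u \<in> P" "u \<noteq> 0" using P V.ideal_zero[OF iP] by blast
  obtain a b where ab: "a \<in> Rs 0" "b \<in> Rs 0" "b \<noteq> 0" "u = a / b" using quotients0 by blast
  have bV: "b \<in> V" and aS: "a \<in> S" using ab S_iff S_V by blast+
  have a: "a \<noteq> 0" "a \<in> P" using ab u V.ideal_mult[OF iP bV u(1)] by auto
  have xV: "x \<in> V" using xS S_V by blast
  have "\<exists>k. x ^ k / a \<in> V"
  proof (rule ccontr)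
    assume no: "\<not> ?thesis"
    have "a \<in> principal S (x ^ k)" for k
    proof -
      have "a / x ^ k \<in> V" using V_cases[of a "x ^ k"] no a x_nz by auto
      moreover have "a / x ^ k \<in> T"
        using T.mult_closed[OF subsetD[OF S_T aS] T.power_closed[OF x_inverse_T, of k]] by (simp add: divide_inverse power_inverse)
      ultimately have "a / x ^ k \<in> S" using V_Int_T by blast
      moreover have "a = x ^ k * (a / x ^ k)" using x_nz by simp
      ultimately show ?thesis using S.principalI by metis
    qed
    moreover have "x \<in> S - units_of_ring S" using xN N_max by (auto simp: max_ideal_def)
    then have "(\<Inter>i. principal S (x ^ i)) = {0}" using arch by (simp add: archimedean_def)
    ultimately show False using a by blast
  qed
  then obtain k where "x ^ k / a \<in> V" by blast
  then have "a * (x ^ k / a) \<in> P" using V.ideal_mult_right[OF iP _ a(2)] by blast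
  then have "x ^ k \<in> P" using a by simp
  then have xP: "x \<in> P" using V.prime_ideal_power[OF P(1) xV] by blast
  have "N \<subseteq> P"
  proof
    fix s assume s: "s \<in> N"
    then obtain j c where c: "c \<in> S" "s ^ j = x * c" using N_power by blast
    then have "s ^ j \<in> P" using V.ideal_mult_right[OF iP _ xP, of c] S_V by auto
    then show "s \<in> P" using V.prime_ideal_power[OF P(1)] s N_V by blast
  qed
  then show ?thesis unfolding p_def by (rule V.gen_least[OF iP])
qed

definition W :: "'a set" where "W = localization_at V p"

lemma V_W: "V \<subseteq> W" unfolding W_def by (rule V.loc_incl[OF p_prime])

lemma W_valuation: "valuation_ring W"
  using V.loc_subring[OF p_prime] V_valuation V_W by (auto simp: valuation_ring_def W_def)

text \<open>The maximal ideal does not grow under localization, since in a valuation ring a prime is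
  stable under division by elements outside it.\<close>

lemma W_max: "max_ideal W = p"
proof
  show "max_ideal W \<subseteq> p"
  proof
    fix b assume "b \<in> max_ideal W"
    then have "b \<in> loc_ext V p p" by (simp add: W_def V.loc_max_ideal[OF p_prime])
    then obtain c s where c: "c \<in> p" "s \<in> V" "s \<notin> p" "b = c / s" by (rule loc_extE)
    have s0: "s \<noteq> 0" using V.not_prime_nonzero[OF p_prime c(3)] .
    show "b \<in> p"
    proof (cases "c = 0")
      case True then show ?thesis using c V.ideal_zero[OF p_ideal] by simp
    next
      case False
      have "s / c \<notin> V"
      proof
        assume "s / c \<in> V"
        then have "c * (s / c) \<in> p" using V.ideal_mult_right[OF p_ideal _ c(1)] by blast
        then show False using False c by simp
      qed
      then have "c / s \<in> V" using V_cases[OF False s0] by blast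
      moreover have "s * (c / s) \<in> p" using c s0 by simp
      ultimately show ?thesis using V.prime_ideal_mult[OF p_prime c(2), of "c / s"] c by blast
    qed
  qed
  show "p \<subseteq> max_ideal W" using V.loc_ext_incl[OF p_prime, of p] by (simp add: W_def V.loc_max_ideal[OF p_prime])
qed

sublocale W: local_domain W
  by (rule valuation_ring_local[OF W_valuation])

lemma W_prime_eq:
  assumes Q: "prime_ideal W Q" "Q \<noteq> {0}" shows "Q = p"
proof -
  have Qp: "prime_ideal V (Q \<inter> V)" "Q \<inter> V \<subseteq> p" using V.contract_prime[OF p_prime] Q(1) by (auto simp: W_def)
  have ext: "loc_ext V p (Q \<inter> V) = Q"
    using V.loc_ext_contract[OF p_prime, of Q] W.prime_ideal_ideal[OF Q(1)] by (simp add: W_def)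
  have "Q \<inter> V \<noteq> {0}"
  proof
    assume "Q \<inter> V = {0}"
    then have "Q \<subseteq> {0}" using ext by (auto simp: loc_ext_def)
    then show False using Q W.ideal_zero[OF W.prime_ideal_ideal[OF Q(1)]] by blast
  qed
  then have "Q \<inter> V = p" using p_least[OF Qp(1)] Qp(2) by blast
  then have "Q = loc_ext V p p" using ext by simp
  then show ?thesis using W_max V.loc_max_ideal[OF p_prime] by (simp add: W_def)
qed

lemma W_dim: "krull_dim W = 1"
proof -
  have pW: "prime_ideal W p" using W.prime_max unfolding W_max .
  show ?thesis
  proof (rule W.krull_dim_one[OF pW p_nonzero])
    show "p \<subseteq> Q" if "prime_ideal W Q" "Q \<noteq> {0}" for Q using W_prime_eq[OF that] by simp
  qed (rule W_prime_eq)
qed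

text \<open>The multipliers of \<open>N\<close> form a ring containing \<open>S\<close>, and
  \<open>x\<close> carries this ring into \<open>N\<close>. So \<open>x\<close> is a common
  denominator for all powers of \<open>t\<close>.\<close>

lemma colon_subset_cic: "colon N \<subseteq> complete_integral_closure S"
proof
  fix t assume t: "t \<in> colon N"
  have N: "ideal S N" using S.max_ideal unfolding N_max .
  have SN: "S \<subseteq> colon N" using S.ideal_mult[OF N] by (auto simp: colon_def)
  have "subring (colon N)" unfolding subring_def
  proof (intro conjI ballI)
    show "0 \<in> colon N" "1 \<in> colon N" using SN by auto
    show "- a \<in> colon N" if "a \<in> colon N" for a
      using that S.ideal_minus[OF N] by (auto simp: colon_def)
    fix a b assume "a \<in> colon N" "b \<in> colon N"
    then show "a + b \<in> colon N" "a * b \<in> colon N"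
      using S.ideal_add[OF N] by (auto simp: colon_def distrib_right mult.assoc)
  qed
  then have sub: "gen_subring (S \<union> {t}) \<subseteq> colon N" using SN t by (intro gen_subring_least) auto
  interpret G: field_subring "gen_subring (S \<union> {t})" by standard (rule gen_subring_subring)
  have "fractional_ideal S (gen_subring (S \<union> {t}))" unfolding fractional_ideal_def
  proof (intro conjI ballI bexI)
    show "a * b \<in> gen_subring (S \<union> {t})" if "a \<in> S" "b \<in> gen_subring (S \<union> {t})" for a b
      using that gen_subring_incl[of "S \<union> {t}"] by (intro G.mult_closed) auto
    show "x * b \<in> S" if "b \<in> gen_subring (S \<union> {t})" for b
      using that sub xN N_S by (auto simp: colon_def mult.commute)
  qed (fact x_nz xS G.zero_closed | rule G.add_closed; assumption)+
  then show "t \<in> complete_integral_closure S" by (simp add: complete_integral_closure_def)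
qed

lemma cic_powers:
  assumes "t \<in> complete_integral_closure S" obtains d where "d \<in> S" "d \<noteq> 0" "\<And>n. d * t ^ n \<in> S"
proof -
  interpret G: field_subring "gen_subring (S \<union> {t})" by standard (rule gen_subring_subring)
  have "t \<in> gen_subring (S \<union> {t})" using gen_subring_incl by blast
  then have "t ^ n \<in> gen_subring (S \<union> {t})" for n by (rule G.power_closed)
  then show ?thesis
    using assms that unfolding complete_integral_closure_def fractional_ideal_def by blast
qed

lemma cic_subset: "complete_integral_closure S \<subseteq> W \<inter> T"
proof
  fix t assume "t \<in> complete_integral_closure S"
  then obtain d where d: "d \<in> S" "d \<noteq> 0" "\<And>n. d * t ^ n \<in> S" by (rule cic_powers) blast
  have "S \<subseteq> W" using S_V V_W by blast
  then have "t \<in> W" using rank_one_completely_integrally_closed[OF W_valuation W_dim, of d t] d by blast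
  moreover have "t \<in> D" if "DVR D" "S \<subset> D" for D
    using DVR_completely_integrally_closed[OF that(1), of d t] d that(2) by blast
  ultimately show "t \<in> W \<inter> T" by (auto simp: noetherian_hull_def)
qed

text \<open>\<open>N\<close> lies in the maximal ideal \<open>p\<close> of \<open>W\<close>, so
  \<open>t * s\<close> is in \<open>p\<close> and in \<open>T\<close>, hence in \<open>S\<close>. It
  is not a unit of \<open>S\<close> since \<open>p\<close> is proper.\<close>

lemma W_Int_T_colon: "W \<inter> T \<subseteq> colon N"
proof
  fix t assume t: "t \<in> W \<inter> T"
  have "t * s \<in> N" if s: "s \<in> N" for s
  proof -
    have "t * s \<in> p" using W.ideal_mult[OF W.max_ideal, of t s] t s N_p by (auto simp: W_max)
    moreover have "t * s \<in> T" using t s N_S S_T by (intro T.mult_closed) auto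
    ultimately have ts: "t * s \<in> S" "t * s \<in> p" using V_Int_T V.ideal_closed[OF p_ideal] by auto
    show ?thesis
    proof (rule ccontr)
      assume "t * s \<notin> N"
      then have "t * s \<noteq> 0" "inverse (t * s) \<in> S" using S.not_max_unit[OF ts(1)] N_max by auto
      then have "inverse (t * s) * (t * s) \<in> p" using V.ideal_mult[OF p_ideal _ ts(2)] S_V by blast
      then show False using left_inverse[OF \<open>t * s \<noteq> 0\<close>] V.prime_ideal_one[OF p_prime] by (simp only:)
    qed
  qed
  then show "t \<in> colon N" by (simp add: colon_def)
qed

text \<open>The intersection with \<open>T\<close> remembers whether 1/x is present, so
  \<open>x\<close> is a nonunit of \<open>U\<close>. Since 1/x lies in \<open>T\<close>, the values
  of elements of \<open>S\<close> can be compared with multiples of the value of \<open>x\<close>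
  inside \<open>T\<close>, and by rank one such comparisons detect any difference between
  \<open>U\<close> and \<open>W\<close>.\<close>

lemma W_unique:
  assumes U: "valuation_ring U" "S \<subseteq> U" "krull_dim U = 1" and eq: "U \<inter> T = W \<inter> T"
  shows "U = W"
proof -
  interpret U: local_domain U by (rule valuation_ring_local[OF U(1)])
  have dichU: "u \<in> U \<or> inverse u \<in> U" if "u \<noteq> 0" for u using U(1) that by (simp add: valuation_ring_def)
  have xU: "x \<in> max_ideal U"
  proof (rule ccontr)
    assume "x \<notin> max_ideal U"
    then have "inverse x \<in> U" using U.not_max_unit[of x] xS U(2) by blast
    then have "inverse x \<in> W" using x_inverse_T eq by blast
    moreover have "x \<in> max_ideal W" using xN N_p W_max by blast
    ultimately show False using x_nz by (auto simp: max_ideal_def units_of_ring_def)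
  qed
  have WU: "W \<subseteq> U"
  proof
    fix u assume u: "u \<in> W"
    show "u \<in> U"
    proof (rule ccontr)
      assume nU: "u \<notin> U"
      obtain a b where ab: "a \<in> Rs 0" "b \<in> Rs 0" "b \<noteq> 0" "u = a / b" using quotients0 by blast
      have abS: "a \<in> S" "b \<in> S" using ab S_iff by blast+
      have u0: "u \<noteq> 0" "inverse u \<in> max_ideal U" using valuation_not_mem[OF U(1) nU] by auto
      have a0: "a \<noteq> 0" using u0 ab by auto
      have xU': "x \<in> U" using xS U(2) by blast
      \<comment> \<open>Passing to \<open>k\<close>-th powers widens the gap between the values of
        \<open>a\<close> and \<open>b\<close> in \<open>U\<close> to at least the value of
        \<open>x\<close>, so that a power of \<open>x\<close> separates them.\<close>
      obtain k where k: "inverse u ^ k / x \<in> U" using rank_one_power[OF U(1,3) u0(2) xU' x_nz] by blast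
      have inT: "c / x ^ r \<in> T" if "c \<in> S" for c r
        using T.mult_closed[OF subsetD[OF S_T that] T.power_closed[OF x_inverse_T, of r]] by (simp add: divide_inverse power_inverse)
      have bk: "b ^ k \<in> U" "b ^ k \<noteq> 0" "b ^ k \<in> S" "a ^ k \<in> S" using abS U(2) ab by auto
      obtain i where i: "x ^ i / b ^ k \<in> U" using rank_one_power[OF U(1,3) xU bk(1,2)] by blast
      have "b ^ k / x ^ Suc i \<notin> U"
      proof
        assume "b ^ k / x ^ Suc i \<in> U"
        then have "x ^ i / b ^ k * (b ^ k / x ^ Suc i) \<in> U" by (rule U.mult_closed[OF i])
        moreover have "x ^ i / b ^ k * (b ^ k / x ^ Suc i) = inverse x" using x_nz bk by (simp add: field_simps)
        ultimately show False using xU x_nz by (auto simp: max_ideal_def units_of_ring_def)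
      qed
      then have "\<exists>r. b ^ k / x ^ r \<notin> U" by blast
      \<comment> \<open>With \<open>j = r - 1\<close> the power \<open>x ^ j\<close> divides
        \<open>b ^ k\<close> in \<open>U\<close> but not \<open>a ^ k\<close>. Both facts transfer
        to \<open>W\<close> through \<open>T\<close>, where \<open>a ^ k\<close> is a multiple of
        \<open>b ^ k\<close>.\<close>
      then obtain r where r: "b ^ k / x ^ r \<notin> U" "\<And>j. j < r \<Longrightarrow> b ^ k / x ^ j \<in> U"
        using exists_least_iff[of "\<lambda>r. b ^ k / x ^ r \<notin> U"] by blast
      have "r \<noteq> 0" using r(1) bk by (cases r) auto
      then obtain j where j: "r = Suc j" by (cases r) auto
      have w: "b ^ k / x ^ j \<in> W" using r(2)[of j] j inT[OF bk(3)] eq by auto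
      have "a ^ k / x ^ j \<notin> U"
      proof
        assume "a ^ k / x ^ j \<in> U"
        then have "a ^ k / x ^ j * (inverse u ^ k / x) \<in> U" using k by (rule U.mult_closed)
        moreover have "inverse u ^ k = b ^ k / a ^ k" using ab(4) by (simp add: power_divide)
        then have "a ^ k / x ^ j * (inverse u ^ k / x) = b ^ k / x ^ r"
          using a0 j x_nz by (simp add: field_simps)
        ultimately show False using r(1) by simp
      qed
      then have "a ^ k / x ^ j \<notin> W" using inT[OF bk(4)] eq by blast
      moreover have "a ^ k / x ^ j = u ^ k * (b ^ k / x ^ j)" using ab by (simp add: power_divide)
      ultimately show False using W.mult_closed[OF W.power_closed[OF u] w, of k] by metis
    qed
  qed
  \<comment> \<open>Rank one leaves no room for a proper overring: an element of \<open>U\<close>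
    outside \<open>W\<close> has a power exceeding 1/x in \<open>W\<close>, which would put 1/x into
    \<open>U\<close>.\<close>
  have "U \<subseteq> W"
  proof
    fix u assume u: "u \<in> U"
    show "u \<in> W"
    proof (rule ccontr)
      assume "u \<notin> W"
      then have u0: "u \<noteq> 0" "inverse u \<in> max_ideal W" using valuation_not_mem[OF W_valuation] by auto
      obtain k where "inverse u ^ k / x \<in> W"
        using rank_one_power[OF W_valuation W_dim u0(2), of x] x_nz xS S_V V_W by blast
      then have "u ^ k * (inverse u ^ k / x) \<in> U" using u WU by (intro U.mult_closed) auto
      moreover have "u ^ k * (inverse u ^ k / x) = inverse x" using u0 by (simp add: field_simps)
      ultimately show False using xU x_nz by (auto simp: max_ideal_def units_of_ring_def)
    qed
  qed
  then show ?thesis using WU by blast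
qed

end

theorem theorem6p2:
  fixes R :: "'a::field set" and Rs :: "nat \<Rightarrow> 'a set" and x :: 'a
  assumes "regular_local R" and "has_quotient_field R" and "krull_dim R \<ge> 2"
    and "quadratic_sequence Rs" and "Rs 0 = R"
    and "x \<in> seq_union Rs"
    and "radical (seq_union Rs) (principal (seq_union Rs) x) = seq_max Rs"
    and "is_localization R (noetherian_hull (seq_union Rs))"
    and "archimedean (seq_union Rs)" and "\<not> DVR (seq_union Rs)"
  shows "prime_ideal (boundary_val Rs) (gen_ideal (boundary_val Rs) (seq_max Rs))
       \<and> height (boundary_val Rs) (gen_ideal (boundary_val Rs) (seq_max Rs)) = 1
       \<and> (\<forall>P. prime_ideal (boundary_val Rs) P \<and> height (boundary_val Rs) P = 1
              \<longrightarrow> P = gen_ideal (boundary_val Rs) (seq_max Rs))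
       \<and> complete_integral_closure (seq_union Rs) = colon (seq_max Rs)
       \<and> colon (seq_max Rs) = localization_at (boundary_val Rs) (gen_ideal (boundary_val Rs) (seq_max Rs))
                              \<inter> noetherian_hull (seq_union Rs)
       \<and> rank_one_val_overring (seq_union Rs)
           (localization_at (boundary_val Rs) (gen_ideal (boundary_val Rs) (seq_max Rs)))
       \<and> (\<forall>U. rank_one_val_overring (seq_union Rs) U
              \<and> complete_integral_closure (seq_union Rs) = U \<inter> noetherian_hull (seq_union Rs)
              \<longrightarrow> U = localization_at (boundary_val Rs) (gen_ideal (boundary_val Rs) (seq_max Rs)))"
proof -
  obtain y q where "quad_seq Rs y q" using quad_seqE assms(2,4,5) by blast
  then interpret quad_seq Rs y q .
  interpret archimedean_quad_seq Rs y q x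
    using assms(5-10) by unfold_locales auto
  have cic: "complete_integral_closure S = colon N" "colon N = W \<inter> T"
    using colon_subset_cic cic_subset W_Int_T_colon by blast+
  have "rank_one_val_overring S W"
    unfolding rank_one_val_overring_def using W_valuation W_dim S_V V_W by blast
  moreover have "U = W" if "rank_one_val_overring S U" "complete_integral_closure S = U \<inter> T" for U
    using W_unique[of U] that cic unfolding rank_one_val_overring_def by blast
  moreover have "P = p" if "prime_ideal V P" "height V P = 1" for P
    using V.height_one_unique[OF p_prime p_nonzero p_least that] .
  ultimately show ?thesis
    using p_prime V.height_least_prime[OF p_prime p_nonzero p_least] cic unfolding W_def p_def by blast
qed

end
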